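(* For a tree $T$ with $n$ vertices, non-negative vertex and edge weights, given root (start vertex) $v_s$ and non-fixed end vertex (no-return variant of the strategic deployment problem), an optimal visiting order of the leaves and the minimum number of agents required can be computed in amortized time $O(n\log n)$.
   Context: Strategic deployment problem: A tree $T=(V,E)$ has non-negative vertex weights $w_v$ and edge weights $w_e$ and start vertex $v_s$. Agents start at $v_s$; in discrete steps non-settled agents stay or move along incident edges. When a vertex $v$ is reached for the first time, $w_v$ of the agents present must be left there permanently (settled); an edge $e$ may only be traversed by at least $w_e$ agents together. A strategy is valid if all vertices get filled. In the no-return variant, no agents have to return to $v_s$ and the strategy may end anywhere. An optimal strategy uses the minimum number of agents. *)

theory Defs
  imports Complex_Main "HOL-Library.Landau_Symbols"
begin

section \<open>Weighted trees\<close>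

text \<open>
  Weights count agents, hence they are natural numbers. Edges are two-element sets of vertices.
\<close>

record 'v weighted_graph =
  verts :: "'v set"
  edges :: "'v set set"
  vweight :: "'v \<Rightarrow> nat"
  eweight :: "'v set \<Rightarrow> nat"
  start :: 'v

definition is_cycle :: "'v set set \<Rightarrow> 'v list \<Rightarrow> bool" where
  "is_cycle E c \<longleftrightarrow> 3 \<le> length c \<and> distinct c \<and>
     (\<forall>i. Suc i < length c \<longrightarrow> {c ! i, c ! Suc i} \<in> E) \<and> {last c, hd c} \<in> E"

definition weighted_tree :: "'v weighted_graph \<Rightarrow> bool" where
  "weighted_tree T \<longleftrightarrow>
     finite (verts T) \<and> start T \<in> verts T \<and>
     (\<forall>e\<in>edges T. e \<subseteq> verts T \<and> card e = 2) \<and>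
     (\<forall>u\<in>verts T. \<forall>v\<in>verts T. (u, v) \<in> {(x, y). {x, y} \<in> edges T}\<^sup>*) \<and>
     (\<nexists>c. is_cycle (edges T) c)"

definition leaves :: "'v weighted_graph \<Rightarrow> 'v set" where
  "leaves T = {v \<in> verts T. v \<noteq> start T \<and> card {e \<in> edges T. v \<in> e} = 1}"


section \<open>Strategic deployment, no-return variant\<close>

text \<open>
  A strategy for \<open>k\<close> agents \<open>0, \<dots>, k - 1\<close> with \<open>N\<close> steps is given by the position \<open>pos t a\<close> of
  agent \<open>a\<close> at time \<open>t \<le> N\<close>.
\<close>

type_synonym 'v schedule = "nat \<Rightarrow> nat \<Rightarrow> 'v"

definition present :: "nat \<Rightarrow> 'v schedule \<Rightarrow> nat \<Rightarrow> 'v \<Rightarrow> nat set" where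
  "present k pos t v = {a. a < k \<and> pos t a = v}"

definition traversing :: "nat \<Rightarrow> 'v schedule \<Rightarrow> nat \<Rightarrow> 'v \<Rightarrow> 'v \<Rightarrow> nat set" where
  "traversing k pos t u v = {a. a < k \<and> pos t a = u \<and> pos (Suc t) a = v}"

definition first_visit :: "nat \<Rightarrow> 'v schedule \<Rightarrow> 'v \<Rightarrow> nat" where
  "first_visit k pos v = (LEAST t. present k pos t v \<noteq> {})"

text \<open>
  \<open>S v\<close> is the set of agents that settle at \<open>v\<close>; since they never leave \<open>v\<close>, these sets are disjoint
  for different vertices. A vertex of weight 0 still has to be reached by an agent. There is
  no condition on the positions of the agents at the final time \<open>N\<close>.
\<close>

definition valid_strategy :: "'v weighted_graph \<Rightarrow> nat \<Rightarrow> nat \<Rightarrow> 'v schedule \<Rightarrow> bool" where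
  "valid_strategy T k N pos \<longleftrightarrow>
     (\<forall>a<k. pos 0 a = start T) \<and>
     (\<forall>t<N. \<forall>a<k. pos (Suc t) a = pos t a \<or> {pos t a, pos (Suc t) a} \<in> edges T) \<and>
     (\<forall>t<N. \<forall>u v. {u, v} \<in> edges T \<and> traversing k pos t u v \<noteq> {} \<longrightarrow>
        eweight T {u, v} \<le> card (traversing k pos t u v)) \<and>
     (\<forall>v\<in>verts T. \<exists>t\<le>N. present k pos t v \<noteq> {}) \<and>
     (\<exists>S. \<forall>v\<in>verts T.
        S v \<subseteq> present k pos (first_visit k pos v) v \<and>
        card (S v) = vweight T v \<and>
        (\<forall>a\<in>S v. \<forall>t. first_visit k pos v \<le> t \<and> t \<le> N \<longrightarrow> pos t a = v))"

definition min_agents :: "'v weighted_graph \<Rightarrow> nat \<Rightarrow> bool" where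
  "min_agents T k \<longleftrightarrow>
     (\<exists>N pos. valid_strategy T k N pos) \<and>
     (\<forall>k' N pos. valid_strategy T k' N pos \<longrightarrow> k \<le> k')"

definition optimal_leaf_order :: "'v weighted_graph \<Rightarrow> 'v list \<Rightarrow> bool" where
  "optimal_leaf_order T ls \<longleftrightarrow>
     set ls = leaves T \<and> distinct ls \<and>
     (\<exists>k N pos. min_agents T k \<and> valid_strategy T k N pos \<and>
        sorted_wrt (\<lambda>u v. first_visit k pos u < first_visit k pos v) ls)"


section \<open>Random access machine\<close>

text \<open>
  Programs for a random access machine with unit-cost addition, truncated subtraction and
  comparison of natural numbers (no multiplication), and with recursive procedures. A program is the
  list of the bodies of its procedures. \<open>Var i\<close> is the \<open>i\<close>-th innermost local variable (parameter or
  \<open>Let\<close>-bound); \<open>Read\<close> and \<open>Write\<close> give indirect access to the memory. Every evaluated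
  subexpression costs one time unit. A procedure call costs constant time on a machine without
  procedures, because the size of its stack frame is bounded by a constant of the program.
\<close>

datatype expr =
    Lit nat
  | Var nat
  | Add expr expr
  | Sub expr expr
  | Read expr
  | Write expr expr
  | IfLess expr expr expr expr
  | Let expr expr
  | Call nat "expr list"

type_synonym memory = "nat \<Rightarrow> nat"

text \<open>
  \<open>eval P \<rho> e m x m' t\<close>: with local variables \<open>\<rho>\<close>, started in memory \<open>m\<close>, the expression \<open>e\<close>
  terminates with value \<open>x\<close> and memory \<open>m'\<close> after \<open>t\<close> time units. \<open>evals\<close> is the same for argument
  lists.
\<close>

inductive
  eval :: "expr list \<Rightarrow> nat list \<Rightarrow> expr \<Rightarrow> memory \<Rightarrow> nat \<Rightarrow> memory \<Rightarrow> nat \<Rightarrow> bool" and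
  evals :: "expr list \<Rightarrow> nat list \<Rightarrow> expr list \<Rightarrow> memory \<Rightarrow> nat list \<Rightarrow> memory \<Rightarrow> nat \<Rightarrow> bool"
  for P :: "expr list"
where
  Lit: "eval P \<rho> (Lit x) m x m 1"
| Var: "i < length \<rho> \<Longrightarrow> eval P \<rho> (Var i) m (\<rho> ! i) m 1"
| Add: "\<lbrakk>eval P \<rho> e1 m x1 m1 t1; eval P \<rho> e2 m1 x2 m2 t2\<rbrakk> \<Longrightarrow>
    eval P \<rho> (Add e1 e2) m (x1 + x2) m2 (t1 + t2 + 1)"
| Sub: "\<lbrakk>eval P \<rho> e1 m x1 m1 t1; eval P \<rho> e2 m1 x2 m2 t2\<rbrakk> \<Longrightarrow>
    eval P \<rho> (Sub e1 e2) m (x1 - x2) m2 (t1 + t2 + 1)"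
| Read: "eval P \<rho> e m x m1 t \<Longrightarrow> eval P \<rho> (Read e) m (m1 x) m1 (t + 1)"
| Write: "\<lbrakk>eval P \<rho> e1 m x1 m1 t1; eval P \<rho> e2 m1 x2 m2 t2\<rbrakk> \<Longrightarrow>
    eval P \<rho> (Write e1 e2) m x2 (m2(x1 := x2)) (t1 + t2 + 1)"
| IfLess_True: "\<lbrakk>eval P \<rho> e1 m x1 m1 t1; eval P \<rho> e2 m1 x2 m2 t2; x1 < x2;
     eval P \<rho> e3 m2 x m3 t3\<rbrakk> \<Longrightarrow>
    eval P \<rho> (IfLess e1 e2 e3 e4) m x m3 (t1 + t2 + t3 + 1)"
| IfLess_False: "\<lbrakk>eval P \<rho> e1 m x1 m1 t1; eval P \<rho> e2 m1 x2 m2 t2; \<not> x1 < x2;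
     eval P \<rho> e4 m2 x m3 t3\<rbrakk> \<Longrightarrow>
    eval P \<rho> (IfLess e1 e2 e3 e4) m x m3 (t1 + t2 + t3 + 1)"
| Let: "\<lbrakk>eval P \<rho> e1 m x1 m1 t1; eval P (x1 # \<rho>) e2 m1 x2 m2 t2\<rbrakk> \<Longrightarrow>
    eval P \<rho> (Let e1 e2) m x2 m2 (t1 + t2 + 1)"
| Call: "\<lbrakk>f < length P; evals P \<rho> es m xs m1 t1; eval P xs (P ! f) m1 x m2 t2\<rbrakk> \<Longrightarrow>
    eval P \<rho> (Call f es) m x m2 (t1 + t2 + 1)"
| Nil: "evals P \<rho> [] m [] m 0"
| Cons: "\<lbrakk>eval P \<rho> e m x m1 t1; evals P \<rho> es m1 xs m2 t2\<rbrakk> \<Longrightarrow>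
    evals P \<rho> (e # es) m (x # xs) m2 (t1 + t2)"

lemma eval_deterministic:
  "eval P \<rho> e m x m1 t \<Longrightarrow> eval P \<rho> e m y m2 s \<Longrightarrow> y = x \<and> m2 = m1 \<and> s = t"
  "evals P \<rho> es m xs m1 t \<Longrightarrow> evals P \<rho> es m ys m2 s \<Longrightarrow> ys = xs \<and> m2 = m1 \<and> s = t"
proof (induction arbitrary: y m2 s and ys m2 s rule: eval_evals.inducts)
  case Lit
  from Lit.prems show ?case by (cases rule: eval.cases) auto
next
  case Var
  from Var.prems show ?case by (cases rule: eval.cases) auto
next
  case Add
  from Add.prems show ?case by (cases rule: eval.cases) (use Add in blast)+
next
  case Sub
  from Sub.prems show ?case by (cases rule: eval.cases) (use Sub in blast)+
next
  case Read
  from Read.prems show ?case by (cases rule: eval.cases) (use Read in blast)+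
next
  case Write
  from Write.prems show ?case by (cases rule: eval.cases) (use Write in blast)+
next
  case IfLess_True
  from IfLess_True.prems show ?case by (cases rule: eval.cases) (use IfLess_True in blast)+
next
  case IfLess_False
  from IfLess_False.prems show ?case by (cases rule: eval.cases) (use IfLess_False in blast)+
next
  case Let
  from Let.prems show ?case by (cases rule: eval.cases) (use Let in blast)+
next
  case Call
  from Call.prems show ?case by (cases rule: eval.cases) (use Call in blast)+
next
  case Nil
  from Nil.prems show ?case by (cases rule: evals.cases) auto
next
  case Cons
  from Cons.prems show ?case by (cases rule: evals.cases) (use Cons in blast)+
qed

text \<open>Execution starts with procedure 0, which has no parameters, and the input in the memory.\<close>

definition computes_within ::
    "expr list \<Rightarrow> nat list \<Rightarrow> nat list \<Rightarrow> nat \<Rightarrow> bool" where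
  "computes_within P xs ys b \<longleftrightarrow>
     (\<exists>p m t. eval P [] (Call 0 []) (\<lambda>a. if a < length xs then xs ! a else 0) p m t \<and>
        t \<le> b \<and> (\<forall>i<length ys. m (p + i) = ys ! i))"


section \<open>Encoding of instances and results\<close>

text \<open>
  \<open>es\<close> lists every edge once, in arbitrary order and with its end points in arbitrary order.
\<close>

definition edge_listing :: "'v weighted_graph \<Rightarrow> ('v \<times> 'v) list \<Rightarrow> bool" where
  "edge_listing T es \<longleftrightarrow>
     set (map (\<lambda>(u, v). {u, v}) es) = edges T \<and> distinct (map (\<lambda>(u, v). {u, v}) es)"

definition encode_instance :: "nat weighted_graph \<Rightarrow> (nat \<times> nat) list \<Rightarrow> nat list" where
  "encode_instance T es =
     [card (verts T), start T] @ map (vweight T) [0..<card (verts T)] @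
     concat (map (\<lambda>(u, v). [u, v, eweight T {u, v}]) es)"

definition encode_result :: "nat \<Rightarrow> nat list \<Rightarrow> nat list" where
  "encode_result k ls = k # length ls # ls"

end

theory Submission
  imports Defs "HOL-Library.Discrete_Functions"
begin

text \<open>
  Read backwards, a strategy is a walk of a growing group: it starts somewhere with \<open>x\<close> agents in
  excess of the total vertex weight \<open>W\<close>, may cross an edge once it is strong enough, and collects the
  settled agents of a vertex as soon as the whole subtree of that vertex has been explored. So
  components are merged along the edges in order of increasing weight, as in Kruskal's algorithm. For
  a component \<open>C\<close> let \<open>D C\<close> be the weight of the vertices whose subtrees lie in \<open>C\<close>, and \<open>F C\<close> the least
  excess with which the group can start in \<open>C\<close> and explore \<open>C\<close>. It leaves \<open>C\<close> with \<open>x + D C\<close> agents;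
  hence merging \<open>A\<close> and \<open>B\<close> along an edge of weight \<open>M\<close> yields
  \<open>F = min (max (F A) (M - D A)) (max (F B) (M - D B))\<close>, and the side where the minimum is attained
  comes first in the walk. The optimum is \<open>max 1 (W + F V)\<close>, where edges of weight 0 count as edges
  of weight 1, because even these must be crossed by somebody.

  For the lower bound, \<open>x < F V\<close> implies that \<open>V\<close> is partitioned into components all of whose
  leaving edges weigh more than \<open>x + D\<close>. The last move between two of them brings more agents into a
  component than can settle there afterwards or never settle at all.

  The time bound comes from relabelling the smaller component. Storing for each vertex only the number
  and the sum of the neighbours that have not been peeled off yields the parent of a vertex when it is
  needed, so the tree is rooted and \<open>D\<close> is updated in amortized constant time.
\<close>

section \<open>Rooted trees\<close>

text \<open>Why the merging rule is right: let \<open>M\<close> be the weight of the edge that joins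
  \<open>A\<close> and \<open>B\<close>, at least that of every edge inside them. A group starting
  in \<open>A\<close> needs \<open>F A\<close> to explore \<open>A\<close> and
  \<open>M - D A\<close> to get across. Having crossed, it is at least \<open>M\<close> strong, so
  nothing inside \<open>B\<close> can stop it, and it can follow there any tour of \<open>B\<close>,
  entered and left at the entrance of \<open>B\<close>. Conversely, if \<open>x\<close> is below
  both terms of the minimum, each side either is already split into pieces that are too expensive to
  enter (\<open>x < F\<close>) or is itself such a piece (\<open>x + D < M\<close>). So an upper and
  a lower certificate are carried through the merging side by side, in \<open>good\<close>;
  optimality of the final value needs no comparison between strategies. The order of equally heavy
  edges is free, because only weak inequalities between the edges merged so far, the current one and
  the remaining ones enter.\<close>

lemma min_walk_distinct:
  assumes "(u, v) \<in> A\<^sup>*"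
  shows "\<exists>c. c \<noteq> [] \<and> hd c = u \<and> last c = v \<and> distinct c \<and> successively (\<lambda>x y. (x, y) \<in> A) c"
proof -
  define Q where "Q c \<longleftrightarrow> c \<noteq> [] \<and> hd c = u \<and> last c = v \<and> successively (\<lambda>x y. (x, y) \<in> A) c" for c
  have "\<exists>c. Q c"
    using assms unfolding Q_def
  proof (induction rule: rtrancl_induct)
    case base
    show ?case by (rule exI[of _ "[u]"]) simp
  next
    case (step y z)
    then obtain c where "c \<noteq> []" "hd c = u" "last c = y" "successively (\<lambda>x y. (x, y) \<in> A) c"
      by blast
    then show ?case
      using step.hyps by (intro exI[of _ "c @ [z]"]) (simp add: successively_append_iff)
  qed
  then obtain c where c: "Q c" "\<And>c'. Q c' \<Longrightarrow> length c \<le> length c'"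
    using ex_has_least_nat[of Q _ length] by blast
  \<comment> \<open>In a shortest walk no vertex repeats: the part between two occurrences could be
    cut out.\<close>
  have "distinct c"
  proof (rule ccontr)
    assume "\<not> distinct c"
    then obtain xs ys zs y where ys: "c = xs @ [y] @ ys @ [y] @ zs"
      using not_distinct_decomp by blast
    have "Q (xs @ [y] @ zs)"
      using c(1) unfolding Q_def ys
      by (auto simp: successively_append_iff successively_Cons hd_append split: if_splits)
    from c(2)[OF this] show False by (simp add: ys)
  qed
  with c(1) show ?thesis unfolding Q_def by blast
qed

locale rooted_tree =
  fixes V :: "'v set" and s :: 'v and par :: "'v \<Rightarrow> 'v"
  assumes finite_V: "finite V"
    and root_in_V: "s \<in> V"
    and par_in_V: "v \<in> V - {s} \<Longrightarrow> par v \<in> V"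
    and acyclic_par: "acyclic {(v, par v) |v. v \<in> V - {s}}"

text \<open>A parent is a neighbour strictly closer to the start. The parent edges alone connect the
  tree, so any further edge would close a cycle with the path between its ends.\<close>

lemma weighted_tree_rooted:
  assumes T: "weighted_tree T"
  obtains par where "rooted_tree (verts T) (start T) par"
    and "edges T = (\<lambda>v. {v, par v}) ` (verts T - {start T})"
proof -
  define s where "s = start T"
  define A where "A = {(x, y). {x, y} \<in> edges T}"
  define dep where "dep v = (LEAST d. (v, s) \<in> A ^^ d)" for v
  have fin: "finite (verts T)" and s: "s \<in> verts T"
    and edge: "\<And>e. e \<in> edges T \<Longrightarrow> e \<subseteq> verts T \<and> card e = 2"
    and conn: "\<And>u v. u \<in> verts T \<Longrightarrow> v \<in> verts T \<Longrightarrow> (u, v) \<in> A\<^sup>*"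
    and acyc: "\<nexists>c. is_cycle (edges T) c"
    using T unfolding weighted_tree_def A_def s_def by auto
  have dep: "(v, s) \<in> A ^^ dep v" if "v \<in> verts T" for v
  proof -
    have "\<exists>d. (v, s) \<in> A ^^ d"
      using conn[OF that s] by (simp add: rtrancl_power)
    then show ?thesis unfolding dep_def by (rule LeastI_ex)
  qed
  have closer: "\<exists>u. {v, u} \<in> edges T \<and> dep u < dep v" if v: "v \<in> verts T" "v \<noteq> s" for v
  proof -
    obtain d where d: "dep v = Suc d"
      using dep[OF v(1)] v(2) by (cases "dep v") auto
    then obtain u where "(v, u) \<in> A" "(u, s) \<in> A ^^ d"
      using dep[OF v(1)] by (metis relpow_Suc_D2)
    moreover from this have "dep u \<le> d" unfolding dep_def by (intro Least_le)
    ultimately show ?thesis using d by (auto simp: A_def)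
  qed
  define par where "par v = (SOME u. {v, u} \<in> edges T \<and> dep u < dep v)" for v
  have par: "{v, par v} \<in> edges T" "dep (par v) < dep v" if "v \<in> verts T" "v \<noteq> s" for v
    using someI_ex[OF closer[OF that]] unfolding par_def by auto
  have acyclic: "acyclic {(v, par v) |v. v \<in> verts T - {s}}"
  proof -
    have "{(v, par v) |v. v \<in> verts T - {s}} \<subseteq> (measure dep)\<inverse>"
      using par(2) by auto
    moreover have "acyclic ((measure dep)\<inverse>)"
      by (simp add: wf_acyclic)
    ultimately show ?thesis using acyclic_subset by blast
  qed
  have rt: "rooted_tree (verts T) s par"
  proof
    show "par v \<in> verts T" if "v \<in> verts T - {s}" for v
      using par(1)[of v] edge that by blast
  qed (use fin s acyclic in auto)
  define E0 where "E0 = (\<lambda>v. {v, par v}) ` (verts T - {s})"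
  define A0 where "A0 = {(x, y). {x, y} \<in> E0}"
  have E0_sub: "E0 \<subseteq> edges T" unfolding E0_def using par(1) by auto
  have to_root: "(v, s) \<in> A0\<^sup>*" if "v \<in> verts T" for v
    using that
  proof (induction "dep v" arbitrary: v rule: less_induct)
    case less
    show ?case
    proof (cases "v = s")
      case False
      have "(v, par v) \<in> A0" unfolding A0_def E0_def using less.prems False by auto
      moreover have "par v \<in> verts T" using par(1)[OF less.prems False] edge by blast
      ultimately show ?thesis
        using less.hyps[of "par v"] par(2)[OF less.prems False]
        by (meson converse_rtrancl_into_rtrancl)
    qed simp
  qed
  have sym: "sym (A0\<^sup>*)"
    by (intro sym_rtrancl symI) (auto simp: A0_def insert_commute)
  have "e \<in> E0" if e: "e \<in> edges T" for e
  proof (rule ccontr)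
    assume not: "e \<notin> E0"
    obtain u v where uv: "e = {u, v}" "u \<noteq> v"
      using edge[OF e] by (meson card_2_iff)
    then have "u \<in> verts T" "v \<in> verts T" using edge[OF e] by auto
    then have "(u, v) \<in> A0\<^sup>*"
      using to_root sym by (meson rtrancl_trans symE)
    then obtain c where c: "c \<noteq> []" "hd c = u" "last c = v" "distinct c"
      "successively (\<lambda>x y. (x, y) \<in> A0) c"
      using min_walk_distinct by metis
    have step: "{c ! i, c ! Suc i} \<in> E0" if "Suc i < length c" for i
      using c(5) that unfolding A0_def by (simp add: successively_conv_nth)
    \<comment> \<open>\<open>is_cycle\<close> demands three vertices. One is excluded because the
      ends differ, two because the edge would then be a parent edge.\<close>
    have "length c \<noteq> 1" using c(1-3) uv(2) by (cases c) auto
    moreover have "length c \<noteq> 2"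
    proof
      assume "length c = 2"
      then have "{u, v} \<in> E0"
        using step[of 0] c(1-3) by (simp add: hd_conv_nth last_conv_nth)
      with not uv(1) show False by simp
    qed
    moreover have "length c \<noteq> 0" using c(1) by simp
    ultimately have "3 \<le> length c" by linarith
    then have "is_cycle (edges T) c"
      unfolding is_cycle_def using c(2-4) step E0_sub e uv(1) by (auto simp: insert_commute)
    with acyc show False by blast
  qed
  with E0_sub have "edges T = E0" by blast
  with rt show ?thesis using that unfolding E0_def s_def by blast
qed

section \<open>Components of a set of parent edges and their completed subtrees\<close>

context rooted_tree
begin

definition up :: "('v \<times> 'v) set" where
  "up = {(v, par v) |v. v \<in> V - {s}}"

definition chld :: "'v \<Rightarrow> 'v set" where
  "chld v = {u \<in> V - {s}. par u = v}"

definition adj :: "'v \<Rightarrow> 'v \<Rightarrow> bool" where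
  "adj u v \<longleftrightarrow> (u, v) \<in> up \<or> (v, u) \<in> up"

text \<open>The set whose weight is \<open>D C\<close>. The root is left out: it is filled at time
  0, so in the reversed walk its agents join too late to help at any crossing.\<close>

definition inner :: "'v set \<Rightarrow> 'v set" where
  "inner C = {v \<in> V - {s}. \<forall>u. (u, v) \<in> up\<^sup>* \<longrightarrow> u \<in> C}"

text \<open>A set of tree edges is represented by the set \<open>K\<close> of their lower end
  points. The components of this forest are the sets \<open>cls K t\<close> with \<open>t\<close> in
  \<open>V - K\<close>, and \<open>t\<close> is where the component is entered from the
  root.\<close>

definition upK :: "'v set \<Rightarrow> ('v \<times> 'v) set" where
  "upK K = {(v, par v) |v. v \<in> K}"

definition cls :: "'v set \<Rightarrow> 'v \<Rightarrow> 'v set" where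
  "cls K t = {v. (v, t) \<in> (upK K)\<^sup>*}"

text \<open>All edges below \<open>v\<close> are in \<open>K\<close>, whether or not the one above
  it is. Unlike \<open>inner (cls K t)\<close> this does not mention a component;
  \<open>inner_cls\<close> relates the two.\<close>

definition fin :: "'v set \<Rightarrow> 'v set" where
  "fin K = {v \<in> V - {s}. \<forall>u. (u, v) \<in> up\<^sup>+ \<longrightarrow> u \<in> K}"

lemma acyclic_up: "acyclic up"
  using acyclic_par unfolding up_def .

lemma finite_up: "finite up"
  unfolding up_def using finite_V by (simp add: setcompr_eq_image)

lemma wf_up: "wf up"
  using finite_acyclic_wf[OF finite_up acyclic_up] .

lemma wf_up_converse: "wf (up\<inverse>)"
  using finite_acyclic_wf_converse[OF finite_up acyclic_up] .

lemma up_iff: "(u, v) \<in> up \<longleftrightarrow> u \<in> V - {s} \<and> v = par u"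
  unfolding up_def by auto

lemma up_rtrancl_in_V': "(u, v) \<in> up\<^sup>* \<Longrightarrow> v \<in> V \<Longrightarrow> u \<in> V"
  by (induction rule: converse_rtrancl_induct) (auto simp: up_iff)

lemma par_neq: "v \<in> V - {s} \<Longrightarrow> par v \<noteq> v"
  using acyclic_up unfolding acyclic_def by (metis r_into_trancl up_iff)

lemma up_rtrancl_root: "(s, v) \<in> up\<^sup>* \<Longrightarrow> v = s"
  by (erule converse_rtranclE) (auto simp: up_iff)

lemma up_antisym: "(u, v) \<in> up\<^sup>* \<Longrightarrow> (v, u) \<in> up\<^sup>* \<Longrightarrow> u = v"
  using acyclic_up by (meson acyclic_def rtranclD rtrancl_into_trancl2 rtrancl_trancl_trancl)

lemma to_root: "v \<in> V \<Longrightarrow> (v, s) \<in> up\<^sup>*"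
proof (induction v rule: wf_induct_rule[OF wf_up_converse])
  case (1 v)
  show ?case
  proof (cases "v = s")
    case False
    then have "(v, par v) \<in> up" using 1(2) by (simp add: up_iff)
    then show ?thesis using 1 False par_in_V by (meson Diff_iff converse_iff converse_rtrancl_into_rtrancl empty_iff insert_iff)
  qed simp
qed

lemma edge_inj: "inj_on (\<lambda>v. {v, par v}) (V - {s})"
proof (rule inj_onI)
  fix u v assume u: "u \<in> V - {s}" and v: "v \<in> V - {s}" and eq: "{u, par u} = {v, par v}"
  show "u = v"
  proof (rule ccontr)
    assume "u \<noteq> v"
    then have "u = par v" "v = par u" using eq by (metis doubleton_eq_iff)+
    then have "(u, v) \<in> up" "(v, u) \<in> up" using u v unfolding up_iff by blast+
    then show False using up_antisym[OF r_into_rtrancl r_into_rtrancl] \<open>u \<noteq> v\<close> by blast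
  qed
qed

lemma upK_sub_up: "K \<subseteq> V - {s} \<Longrightarrow> upK K \<subseteq> up"
  unfolding upK_def up_def by auto

lemma cls_self: "t \<in> cls K t"
  unfolding cls_def by simp

lemma cls_sub_V: "K \<subseteq> V - {s} \<Longrightarrow> t \<in> V \<Longrightarrow> cls K t \<subseteq> V"
  unfolding cls_def using rtrancl_mono[OF upK_sub_up[of K]] up_rtrancl_in_V'[of _ t] by blast

lemma cls_step: "v \<in> cls K t \<Longrightarrow> v \<noteq> t \<Longrightarrow> v \<in> K \<and> par v \<in> cls K t"
  unfolding cls_def mem_Collect_eq by (erule converse_rtranclE) (auto simp: upK_def)

lemma cls_par: "v \<in> K \<Longrightarrow> par v \<in> cls K t \<Longrightarrow> v \<in> cls K t"
  unfolding cls_def mem_Collect_eq by (rule converse_rtrancl_into_rtrancl) (auto simp: upK_def)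

text \<open>Parents are unique, so there is only one way up from \<open>v\<close> inside
  \<open>K\<close>, and it stops at the first vertex outside \<open>K\<close>.\<close>

lemma cls_unique: "v \<in> cls K t \<Longrightarrow> v \<in> cls K t' \<Longrightarrow> t \<notin> K \<Longrightarrow> t' \<notin> K \<Longrightarrow> t = t'"
  unfolding cls_def mem_Collect_eq
proof (induction rule: converse_rtrancl_induct)
  case base
  from base(1) base(2) show ?case by (cases rule: converse_rtranclE) (auto simp: upK_def)
next
  case (step y z)
  have "y \<in> K" "z = par y" using step.hyps(1) by (auto simp: upK_def)
  from step.prems(1) have "(z, t') \<in> (upK K)\<^sup>*"
    by (cases rule: converse_rtranclE) (use \<open>y \<in> K\<close> \<open>z = par y\<close> step.prems in \<open>auto simp: upK_def\<close>)
  with step show ?case by blast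
qed

lemma cls_exists:
  assumes K: "K \<subseteq> V - {s}"
  shows "v \<in> V \<Longrightarrow> \<exists>t\<in>V - K. v \<in> cls K t"
proof (induction v rule: wf_induct_rule[OF wf_up_converse])
  case (1 v)
  show ?case
  proof (cases "v \<in> K")
    case True
    then have "(v, par v) \<in> up" "par v \<in> V" using K par_in_V by (auto simp: up_iff)
    then obtain t where "t \<in> V - K" "par v \<in> cls K t" using 1(1)[of "par v"] by auto
    then show ?thesis using cls_par[OF True] by blast
  next
    case False
    then show ?thesis using 1(2) cls_self by (intro bexI[of _ v]) auto
  qed
qed

lemma cls_insert:
  "cls (insert v K) t = (if par v \<in> cls K t then cls K t \<union> cls K v else cls K t)"
proof -
  have "upK (insert v K) = insert (v, par v) (upK K)" unfolding upK_def by auto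
  then show ?thesis unfolding cls_def by (auto simp: rtrancl_insert)
qed

lemma cls_empty: "cls {} t = {t}"
  unfolding cls_def upK_def by simp

lemma cls_all: "cls (V - {s}) s = V"
proof -
  have "upK (V - {s}) = up" unfolding upK_def up_def by simp
  then show ?thesis unfolding cls_def using to_root up_rtrancl_in_V' root_in_V by auto
qed

lemma up_walk:
  "v \<in> cls K t \<Longrightarrow> \<exists>r. r \<noteq> [] \<and> hd r = v \<and> last r = t \<and> set r \<subseteq> cls K t \<and>
     (\<forall>u\<in>set r. (v, u) \<in> (upK K)\<^sup>*) \<and> successively (\<lambda>x y. (x, y) \<in> upK K) r"
  unfolding cls_def mem_Collect_eq
proof (induction rule: converse_rtrancl_induct)
  case base
  show ?case by (rule exI[of _ "[t]"]) auto
next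
  case (step y z)
  then obtain r where "r \<noteq> []" "hd r = z" "last r = t" "set r \<subseteq> {v. (v, t) \<in> (upK K)\<^sup>*}"
    "\<forall>u\<in>set r. (z, u) \<in> (upK K)\<^sup>*" "successively (\<lambda>x y. (x, y) \<in> upK K) r" by auto
  then show ?case using step.hyps
    by (intro exI[of _ "y # r"])
      (auto simp: successively_Cons intro: converse_rtrancl_into_rtrancl[OF step.hyps(1)])
qed

lemma fin_iff: "v \<in> fin K \<longleftrightarrow> v \<in> V - {s} \<and> chld v \<subseteq> K \<inter> fin K"
proof
  assume v: "v \<in> fin K"
  show "v \<in> V - {s} \<and> chld v \<subseteq> K \<inter> fin K"
  proof
    show "v \<in> V - {s}" using v unfolding fin_def by blast
    show "chld v \<subseteq> K \<inter> fin K"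
    proof
      fix u assume "u \<in> chld v"
      then have u: "(u, v) \<in> up" "u \<in> V - {s}" by (auto simp: chld_def up_iff)
      then show "u \<in> K \<inter> fin K"
        using v unfolding fin_def by (auto intro: trancl_into_trancl)
    qed
  qed
next
  assume v: "v \<in> V - {s} \<and> chld v \<subseteq> K \<inter> fin K"
  have "u \<in> K" if u: "(u, v) \<in> up\<^sup>+" for u
  proof -
    obtain y where y: "(u, y) \<in> up\<^sup>*" "(y, v) \<in> up" using u tranclD2 by metis
    then have "y \<in> K \<inter> fin K" using v unfolding chld_def by (auto simp: up_iff)
    then show ?thesis using y(1) unfolding fin_def by (auto simp: rtrancl_eq_or_trancl)
  qed
  then show "v \<in> fin K" using v unfolding fin_def by blast
qed

text \<open>The recursion over children is well-founded, hence determines the set. Peeling is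
  verified through this equation: whenever the program stops, it suffices that the equation holds
  everywhere.\<close>

lemma fin_unique:
  assumes K: "K \<subseteq> V - {s}" and J: "J \<subseteq> V - {s}"
    and J_iff: "\<And>u. u \<in> V - {s} \<Longrightarrow> u \<in> J \<longleftrightarrow> u \<in> K \<and> chld u \<subseteq> J"
  shows "J = K \<inter> fin K"
proof -
  have "u \<in> V - {s} \<longrightarrow> (u \<in> J \<longleftrightarrow> u \<in> K \<inter> fin K)" for u
  proof (induction u rule: wf_induct_rule[OF wf_up])
    case (1 u)
    have "chld u \<subseteq> J \<longleftrightarrow> chld u \<subseteq> K \<inter> fin K"
      using 1 by (auto simp: chld_def up_iff)
    then show ?case using J_iff[of u] fin_iff[of u K] by blast
  qed
  then show ?thesis using J K by blast
qed

text \<open>Acyclicity keeps \<open>t\<close> from lying strictly below a vertex of its component,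
  and every other vertex of the component is in \<open>K\<close>.\<close>

lemma inner_cls:
  assumes K: "K \<subseteq> V - {s}" and t: "t \<in> V - K"
  shows "inner (cls K t) = fin K \<inter> cls K t"
proof
  have KU: "(upK K)\<^sup>* \<subseteq> up\<^sup>*" using upK_sub_up[OF K] by (rule rtrancl_mono)
  show "inner (cls K t) \<subseteq> fin K \<inter> cls K t"
  proof
    fix v assume v: "v \<in> inner (cls K t)"
    then have vC: "v \<in> cls K t" and sub: "\<And>u. (u, v) \<in> up\<^sup>* \<Longrightarrow> u \<in> cls K t"
      unfolding inner_def by auto
    have "u \<in> K" if "(u, v) \<in> up\<^sup>+" for u
    proof -
      have "u \<noteq> t"
      proof
        assume "u = t"
        moreover have "(v, t) \<in> up\<^sup>*" using vC KU unfolding cls_def by auto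
        ultimately have "(u, u) \<in> up\<^sup>+" using that by (meson trancl_rtrancl_trancl)
        then show False using acyclic_up unfolding acyclic_def by blast
      qed
      then show ?thesis using cls_step sub that by (meson trancl_into_rtrancl)
    qed
    then show "v \<in> fin K \<inter> cls K t" using v vC unfolding fin_def inner_def by blast
  qed
  show "fin K \<inter> cls K t \<subseteq> inner (cls K t)"
  proof
    fix v assume v: "v \<in> fin K \<inter> cls K t"
    have "u \<in> cls K t" if "(u, v) \<in> up\<^sup>*" for u
      using that
    proof (induction rule: converse_rtrancl_induct)
      case base
      show ?case using v by blast
    next
      case (step y z)
      have "(y, v) \<in> up\<^sup>+" using step.hyps by (rule rtrancl_into_trancl2)
      with step.hyps(1) have "y \<in> K" "z = par y" using v unfolding fin_def up_iff by auto
      then show ?case using step cls_par by blast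
    qed
    then show "v \<in> inner (cls K t)" using v unfolding inner_def fin_def by blast
  qed
qed

lemma par_notin_cls:
  assumes "K \<subseteq> V - {s}" "x \<in> V - {s}"
  shows "par x \<notin> cls K x"
proof
  assume "par x \<in> cls K x"
  then have "(par x, x) \<in> up\<^sup>*"
    unfolding cls_def using rtrancl_mono[OF upK_sub_up[OF assms(1)]] by auto
  moreover have "(x, par x) \<in> up" using assms(2) by (simp add: up_iff)
  ultimately show False using up_antisym par_neq assms(2) by (meson r_into_rtrancl)
qed

lemma finite_inner: "finite (inner C)"
  unfolding inner_def using finite_V by simp

lemma inner_mono: "A \<subseteq> B \<Longrightarrow> inner A \<subseteq> inner B"
  unfolding inner_def by auto

lemma inner_sub: "inner A \<subseteq> A"
  unfolding inner_def by auto

end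

section \<open>Lower bound\<close>

context rooted_tree
begin

definition bad :: "('v set \<Rightarrow> nat) \<Rightarrow> ('v \<Rightarrow> nat) \<Rightarrow> nat \<Rightarrow> 'v set \<Rightarrow> bool" where
  "bad w vw x Q \<longleftrightarrow> (\<forall>v\<in>V - {s}. (v \<in> Q) \<noteq> (par v \<in> Q) \<longrightarrow> x + sum vw (inner Q) < w {v, par v})"

text \<open>The subtree of \<open>y\<close> can be entered only at \<open>y\<close>, since every
  other vertex of it has its parent inside.\<close>

lemma visit_through:
  assumes 0: "pos 0 = s" and y: "y \<noteq> s"
    and step: "\<And>t. t < N \<Longrightarrow> pos (Suc t) = pos t \<or> adj (pos t) (pos (Suc t))"
  shows "(pos t, y) \<in> up\<^sup>* \<Longrightarrow> t \<le> N \<Longrightarrow> \<exists>t'\<le>t. pos t' = y"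
proof (induction t)
  case 0
  then show ?case using up_rtrancl_root y \<open>pos 0 = s\<close> by auto
next
  case (Suc t)
  show ?case
  proof (cases "(pos t, y) \<in> up\<^sup>*")
    case True
    then show ?thesis using Suc by (auto intro: le_SucI)
  next
    case False
    then have "pos (Suc t) \<noteq> pos t" using Suc.prems by auto
    then have "adj (pos t) (pos (Suc t))" using step[of t] Suc.prems by auto
    moreover have "(pos t, pos (Suc t)) \<notin> up"
      using False Suc.prems by (meson converse_rtrancl_into_rtrancl)
    ultimately have up: "(pos (Suc t), pos t) \<in> up" unfolding adj_def by blast
    have "pos (Suc t) = y"
    proof (rule ccontr)
      assume "pos (Suc t) \<noteq> y"
      with Suc.prems(1) obtain z where "(pos (Suc t), z) \<in> up" "(z, y) \<in> up\<^sup>*"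
        by (meson converse_rtranclE)
      with up False show False by (simp add: up_iff)
    qed
    then show ?thesis by auto
  qed
qed

end

text \<open>At time \<open>N\<close> the agents settled at \<open>v\<close> all stand at
  \<open>v\<close>, so the sets for different vertices are disjoint and their sizes add up.\<close>

lemma disjoint_settled:
  assumes val: "valid_strategy T k N pos" and T: "weighted_tree T"
  obtains S where "\<And>v. v \<in> verts T \<Longrightarrow> S v \<subseteq> {..<k}"
    "\<And>v. v \<in> verts T \<Longrightarrow> card (S v) = vweight T v"
    "\<And>v. v \<in> verts T \<Longrightarrow> first_visit k pos v \<le> N"
    "\<And>v a t. v \<in> verts T \<Longrightarrow> a \<in> S v \<Longrightarrow> first_visit k pos v \<le> t \<Longrightarrow> t \<le> N \<Longrightarrow> pos t a = v"
    "card (\<Union>v\<in>verts T. S v) = (\<Sum>v\<in>verts T. vweight T v)"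
proof -
  have vis: "\<And>v. v \<in> verts T \<Longrightarrow> \<exists>t\<le>N. present k pos t v \<noteq> {}"
    using val unfolding valid_strategy_def by blast
  have "\<exists>S. \<forall>v\<in>verts T. S v \<subseteq> present k pos (first_visit k pos v) v \<and> card (S v) = vweight T v \<and>
        (\<forall>a\<in>S v. \<forall>t. first_visit k pos v \<le> t \<and> t \<le> N \<longrightarrow> pos t a = v)"
    using val unfolding valid_strategy_def by (elim conjE)
  then obtain S where S0: "\<forall>v\<in>verts T. S v \<subseteq> present k pos (first_visit k pos v) v \<and>
      card (S v) = vweight T v \<and> (\<forall>a\<in>S v. \<forall>t. first_visit k pos v \<le> t \<and> t \<le> N \<longrightarrow> pos t a = v)" ..
  then have S: "\<And>v. v \<in> verts T \<Longrightarrow> S v \<subseteq> present k pos (first_visit k pos v) v"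
    "\<And>v. v \<in> verts T \<Longrightarrow> card (S v) = vweight T v"
    "\<And>v a t. v \<in> verts T \<Longrightarrow> a \<in> S v \<Longrightarrow> first_visit k pos v \<le> t \<Longrightarrow> t \<le> N \<Longrightarrow> pos t a = v"
    by blast+
  have sub: "S v \<subseteq> {..<k}" if "v \<in> verts T" for v
    using S(1)[OF that] unfolding present_def by auto
  have fv: "first_visit k pos v \<le> N" if "v \<in> verts T" for v
    using vis[OF that] unfolding first_visit_def by (meson Least_le le_trans)
  have disj: "S v \<inter> S v' = {}" if "v \<in> verts T" "v' \<in> verts T" "v \<noteq> v'" for v v'
    using S(3)[OF that(1) _ fv[OF that(1)]] S(3)[OF that(2) _ fv[OF that(2)]] that(3) by blast
  have "finite (verts T)" using T unfolding weighted_tree_def by blast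
  then have "card (\<Union>v\<in>verts T. S v) = (\<Sum>v\<in>verts T. card (S v))"
    using sub disj by (intro card_UN_disjoint) (auto intro: finite_subset)
  also have "\<dots> = (\<Sum>v\<in>verts T. vweight T v)" using S(2) by simp
  finally show ?thesis using that[OF sub S(2) fv S(3)] by blast
qed

text \<open>\<open>g\<close> maps every vertex to its piece. Consider the last step in which some
  agent changes its piece, and let \<open>Q\<close> be the piece entered. A crossing agent that
  settles does so later, hence in \<open>Q\<close>, and at a vertex whose whole subtree lies in
  \<open>Q\<close> because it is visited even later. So at most \<open>D Q\<close> of the crossing
  agents settle, and at most \<open>k - W\<close> agents never settle: too few for the edge.\<close>

lemma bad_pieces_lower_bound:
  fixes T :: "'v weighted_graph"
  assumes T: "weighted_tree T" and rt: "rooted_tree (verts T) (start T) par"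
    and E: "edges T = (\<lambda>v. {v, par v}) ` (verts T - {start T})"
    and w: "\<And>e. w e = max 1 (eweight T e)"
    and val: "valid_strategy T k N pos"
    and g: "\<And>v. v \<in> verts T \<Longrightarrow> v \<in> g v \<and> g v \<subseteq> verts T \<and> g v \<noteq> verts T \<and> (\<forall>u\<in>g v. g u = g v)"
    and bad: "\<And>v. v \<in> verts T \<Longrightarrow> rooted_tree.bad (verts T) (start T) par w (vweight T)
      (k - (\<Sum>v\<in>verts T. vweight T v)) (g v)"
  shows False
proof -
  define V where "V = verts T"
  define s where "s = start T"
  define W where "W = (\<Sum>v\<in>V. vweight T v)"
  interpret rooted_tree V s par using rt unfolding V_def s_def .
  obtain S where S: "\<And>v. v \<in> V \<Longrightarrow> S v \<subseteq> {..<k}" "\<And>v. v \<in> V \<Longrightarrow> card (S v) = vweight T v"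
    and fv: "\<And>v. v \<in> V \<Longrightarrow> first_visit k pos v \<le> N"
    and stay: "\<And>v a t. v \<in> V \<Longrightarrow> a \<in> S v \<Longrightarrow> first_visit k pos v \<le> t \<Longrightarrow> t \<le> N \<Longrightarrow> pos t a = v"
    and SW: "card (\<Union>v\<in>V. S v) = W"
    by (rule disjoint_settled[OF val T, folded V_def, folded W_def]) (rule that; assumption)
  have start: "\<And>a. a < k \<Longrightarrow> pos 0 a = s"
    and move: "\<And>t a. t < N \<Longrightarrow> a < k \<Longrightarrow> pos (Suc t) a = pos t a \<or> {pos t a, pos (Suc t) a} \<in> edges T"
    using val unfolding valid_strategy_def s_def by simp_all
  have strong: "\<And>t u v. t < N \<Longrightarrow> {u, v} \<in> edges T \<Longrightarrow> traversing k pos t u v \<noteq> {} \<Longrightarrow>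
        eweight T {u, v} \<le> card (traversing k pos t u v)"
    and vis: "\<And>v. v \<in> V \<Longrightarrow> \<exists>t\<le>N. present k pos t v \<noteq> {}"
    using val unfolding valid_strategy_def V_def by blast+
  have adj_edge: "adj u v" if "{u, v} \<in> edges T" for u v
    using that unfolding E[folded V_def s_def] adj_def up_iff by (auto simp: doubleton_eq_iff)
  have inV: "pos t a \<in> V" if "t \<le> N" "a < k" for t a
    using that
  proof (induction t)
    case 0
    then show ?case using start root_in_V by simp
  next
    case (Suc t)
    then have "pos (Suc t) a = pos t a \<or> adj (pos t a) (pos (Suc t) a)" 
      using move[of t a] adj_edge by auto
    then show ?case using Suc par_in_V unfolding adj_def up_iff by auto
  qed
  define I where "I = {t. t < N \<and> (\<exists>a<k. g (pos t a) \<noteq> g (pos (Suc t) a))}"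
  have const: "g (pos t' a) = g (pos t a)" if "t \<le> t'" "t' \<le> N" "a < k" "\<And>i. i \<in> I \<Longrightarrow> i < t" for t t' a
    using that(1,2)
  proof (induction t' rule: dec_induct)
    case (step i)
    then have "i \<notin> I" using that(4)[of i] by auto
    with step that(3) show ?case unfolding I_def by auto
  qed simp
  \<comment> \<open>The piece of the start is not the whole tree, so somebody has to leave
    it.\<close>
  have "I \<noteq> {}"
  proof
    assume "I = {}"
    obtain v where v: "v \<in> V" "v \<notin> g s" using g[of s] root_in_V unfolding V_def by blast
    then obtain t a where "t \<le> N" "a < k" "pos t a = v" using vis unfolding present_def by blast
    then have "g v = g s" using const[of 0 t a] \<open>I = {}\<close> start by auto
    then show False using v g unfolding V_def by blast
  qed
  moreover have "finite I" unfolding I_def by simp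
  ultimately have MI: "Max I \<in> I" "\<And>i. i \<in> I \<Longrightarrow> i < Suc (Max I)"
    by (auto simp: less_Suc_eq_le)
  define t where "t = Max I"
  obtain b where tN: "t < N" and b: "b < k" and gne: "g (pos t b) \<noteq> g (pos (Suc t) b)"
    using MI(1) unfolding t_def I_def by blast
  define u where "u = pos t b"
  define v where "v = pos (Suc t) b"
  define Q where "Q = g v"
  define M where "M = traversing k pos t u v"
  have uV: "u \<in> V" and vV: "v \<in> V" unfolding u_def v_def using inV b tN by auto
  have uv: "u \<noteq> v" using gne unfolding u_def v_def by auto
  have e: "{u, v} \<in> edges T"
    using move[OF tN b] uv unfolding u_def v_def by auto
  have bM: "b \<in> M" unfolding M_def traversing_def u_def v_def using b by simp
  have finM: "finite M" unfolding M_def traversing_def by simp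
  have "eweight T {u, v} \<le> card M" using strong[OF tN e] bM unfolding M_def by blast
  moreover have "1 \<le> card M" using bM finM by (auto simp: Suc_le_eq card_gt_0_iff)
  ultimately have wM: "w {u, v} \<le> card M" using w by simp
  have vQ: "v \<in> Q" and uQ: "u \<notin> Q"
    using g[folded V_def, OF vV] g[folded V_def, OF uV] gne
    unfolding Q_def u_def[symmetric] v_def[symmetric] by blast+
  have badQ: "bad w (vweight T) (k - W) Q"
    using bad vV unfolding Q_def V_def W_def s_def by blast
  have "k - W + sum (vweight T) (inner Q) < w {u, v}"
    using adj_edge[OF e] badQ vQ uQ unfolding adj_def bad_def up_iff by (metis insert_commute)
  then have less: "k - W + sum (vweight T) (inner Q) < card M" using wM by simp
  have settle: "y \<in> inner Q" if a: "a \<in> M" "a \<in> S y" "y \<in> V" for a y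
  proof -
    have a': "a < k" "pos t a = u" "pos (Suc t) a = v" using a unfolding M_def traversing_def by auto
    \<comment> \<open>Settled agents do not move any more, but \<open>a\<close> moves in step
      \<open>t\<close>.\<close>
    have later: "Suc t \<le> first_visit k pos y"
    proof (rule ccontr)
      assume "\<not> Suc t \<le> first_visit k pos y"
      then have "pos t a = y" "pos (Suc t) a = y" using stay a tN by auto
      with a' uv show False by simp
    qed
    have ys: "y \<noteq> s"
    proof
      assume "y = s"
      then have "first_visit k pos y = 0"
        unfolding first_visit_def using start[OF a'(1)] a'(1)
        by (intro Least_eq_0) (auto simp: present_def)
      with later show False by simp
    qed
    have "pos (first_visit k pos y) a = y" using stay a fv by blast
    then have gy: "g y = Q"
      using const[OF later fv[OF a(3)] a'(1)] MI(2) a'(3) unfolding t_def Q_def by auto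
    \<comment> \<open>Whoever reaches \<open>d\<close> has passed \<open>y\<close> on the way, not
      before the first visit of \<open>y\<close> and thus after the last change of pieces.\<close>
    have "d \<in> Q" if d: "(d, y) \<in> up\<^sup>*" for d
    proof -
      have dV: "d \<in> V" using up_rtrancl_in_V' d a(3) by blast
      then obtain \<tau> c where c: "\<tau> \<le> N" "c < k" "pos \<tau> c = d" using vis unfolding present_def by blast
      have "\<exists>t'\<le>\<tau>. pos t' c = y"
      proof (rule visit_through[of "\<lambda>t. pos t c" y N \<tau>, OF start[OF c(2)] ys])
        show "pos (Suc t) c = pos t c \<or> adj (pos t c) (pos (Suc t) c)" if "t < N" for t
          using move[OF that c(2)] adj_edge by blast
      qed (use c d in auto)
      then obtain t' where t': "t' \<le> \<tau>" "pos t' c = y" by blast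
      then have "first_visit k pos y \<le> t'"
        unfolding first_visit_def using c by (intro Least_le) (auto simp: present_def)
      then have "g (pos \<tau> c) = g (pos t' c)"
        using const[of t' \<tau> c] t' c MI(2) later unfolding t_def by force
      then have "g d = Q" using c(3) t'(2) gy by simp
      then show ?thesis using g[folded V_def, OF dV] by blast
    qed
    then show ?thesis unfolding inner_def using a(3) ys by blast
  qed
  have "M \<subseteq> (\<Union>y\<in>inner Q. S y) \<union> ({..<k} - (\<Union>y\<in>V. S y))"
  proof
    fix a assume a: "a \<in> M"
    then have "a < k" unfolding M_def traversing_def by simp
    with settle[OF a] show "a \<in> (\<Union>y\<in>inner Q. S y) \<union> ({..<k} - (\<Union>y\<in>V. S y))" by blast
  qed
  moreover have iV: "inner Q \<subseteq> V" unfolding inner_def by blast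
  moreover have "finite (S y)" if "y \<in> V" for y using S(1)[OF that] finite_subset by blast
  ultimately have "card M \<le> card (\<Union>y\<in>inner Q. S y) + card ({..<k} - (\<Union>y\<in>V. S y))"
    using finite_inner by (intro order_trans[OF card_mono card_Un_le]) auto
  also have "card (\<Union>y\<in>inner Q. S y) \<le> (\<Sum>y\<in>inner Q. card (S y))"
    by (rule card_UN_le[OF finite_inner])
  also have "\<dots> = sum (vweight T) (inner Q)" using S(2) iV by (intro sum.cong) auto
  also have "card ({..<k} - (\<Union>y\<in>V. S y)) = k - W"
    using S(1) SW by (subst card_Diff_subset) (auto intro: finite_subset)
  finally show False using less by linarith
qed

section \<open>Tours of components\<close>

lemma remdups_append_superset: "set xs \<subseteq> set ys \<Longrightarrow> remdups (xs @ ys) = remdups ys"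
  by (induction xs) auto

lemma filter_remdups_append:
  "\<forall>x\<in>set xs. P x \<longrightarrow> x \<notin> set ys \<Longrightarrow>
    filter P (remdups (xs @ ys)) = filter P (remdups xs) @ filter P (remdups ys)"
  by (induction xs) auto

section \<open>Certificates for the excess of a component\<close>

locale weighted_rooted_tree = rooted_tree V s par
  for V :: "'v set" and s :: 'v and par :: "'v \<Rightarrow> 'v" +
  fixes w :: "'v set \<Rightarrow> nat" and vw :: "'v \<Rightarrow> nat"
begin

definition leaf :: "'v \<Rightarrow> bool" where
  "leaf v \<longleftrightarrow> v \<in> V - {s} \<and> chld v = {}"

text \<open>When the reversed walk goes from \<open>y\<close> to \<open>z\<close>, the vertices that
  do not occur any more have returned their agents. Only those in \<open>I\<close> are counted; with
  \<open>I = inner C\<close> the condition survives every continuation of the walk that avoids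
  \<open>inner C\<close>.\<close>

fun feasible :: "'v set \<Rightarrow> nat \<Rightarrow> 'v list \<Rightarrow> bool" where
  "feasible I F (y # z # r) \<longleftrightarrow> w {y, z} \<le> F + sum vw (I - set (z # r)) \<and> feasible I F (z # r)"
| "feasible I F _ \<longleftrightarrow> True"

text \<open>A tour is traversed by the agents backwards: it ends at the entrance \<open>t\<close> of \<open>C\<close>, and vertices
  are visited for the first time where they occur last. \<open>F\<close> is the number of agents in
  excess of the total vertex weight.\<close>

definition tour :: "'v \<Rightarrow> 'v set \<Rightarrow> nat \<Rightarrow> 'v list \<Rightarrow> 'v list \<Rightarrow> bool" where
  "tour t C F fl r \<longleftrightarrow> r \<noteq> [] \<and> last r = t \<and> set r = C \<and> successively adj r \<and>
     filter leaf (remdups r) = filter leaf (rev fl) \<and> feasible (inner C) F r"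

text \<open>Two certificates for the excess \<open>F\<close> of \<open>C\<close>: a tour that
  manages with \<open>F\<close>, and for every smaller excess a partition into \<open>bad\<close>
  pieces, given by the class function \<open>g\<close>. By \<open>g v \<noteq> V\<close> some edge
  between pieces must be crossed. \<open>fl\<close> lists all of \<open>C\<close>, since the program
  also uses it as the list of members, but the tour determines only the order of its leaves.\<close>

definition good :: "'v \<Rightarrow> 'v set \<Rightarrow> nat \<Rightarrow> 'v list \<Rightarrow> bool" where
  "good t C F fl \<longleftrightarrow> set fl = C \<and> distinct fl \<and> (\<exists>r. tour t C F fl r) \<and>
     (\<forall>x<F. \<exists>g. \<forall>v\<in>C. v \<in> g v \<and> g v \<subseteq> C \<and> g v \<noteq> V \<and> (\<forall>u\<in>g v. g u = g v) \<and> bad w vw x (g v))"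

lemma adj_sym: "adj u v \<Longrightarrow> adj v u"
  unfolding adj_def by blast

text \<open>A group of strength \<open>M\<close> that meets only edges up to \<open>M\<close> and
  never returns to the collected vertices \<open>A\<close> does not depend on collecting
  more.\<close>

lemma feasible_cheap:
  "successively (\<lambda>y z. w {y, z} \<le> M) (y # ys) \<Longrightarrow> A \<subseteq> I \<Longrightarrow> A \<inter> set ys = {} \<Longrightarrow> finite I \<Longrightarrow>
    M \<le> F + sum vw A \<Longrightarrow> feasible I F (y # ys)"
proof (induction ys arbitrary: y)
  case (Cons z zs)
  have "sum vw A \<le> sum vw (I - set (z # zs))"
    using Cons.prems by (intro sum_mono2) auto
  then show ?case using Cons by auto
qed simp

text \<open>As \<open>ys\<close> does not meet \<open>A\<close>, appending it does not diminish the
  counts along \<open>xs\<close>, and at the end of \<open>xs\<close> all of \<open>A\<close> is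
  available.\<close>

lemma feasible_append:
  "feasible A F' xs \<Longrightarrow> F' \<le> F \<Longrightarrow> xs \<noteq> [] \<Longrightarrow> successively (\<lambda>y z. w {y, z} \<le> M) (last xs # ys) \<Longrightarrow>
    A \<subseteq> I \<Longrightarrow> A \<inter> set ys = {} \<Longrightarrow> finite I \<Longrightarrow> M \<le> F + sum vw A \<Longrightarrow> feasible I F (xs @ ys)"
proof (induction A F' xs rule: feasible.induct)
  case (1 A F' y z r)
  have "sum vw (A - set (z # r)) \<le> sum vw (I - set (z # r @ ys))"
    using "1.prems" by (intro sum_mono2) auto
  then show ?case using 1 by auto
qed (use feasible_cheap in auto)

text \<open>A leaf is its own whole subtree, so the leaves of \<open>A\<close> are in
  \<open>inner A\<close>. Avoiding \<open>inner A\<close> therefore secures both the collected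
  weight and the places of these leaves in the order.\<close>

lemma tour_extend:
  assumes tA: "tour tA A FA flA r" and F: "FA \<le> F" "M \<le> F + sum vw (inner A)"
    and ys: "successively adj (tA # ys)" "successively (\<lambda>y z. w {y, z} \<le> M) (tA # ys)"
    and avoid: "inner A \<inter> set ys = {}"
    and C: "A \<union> set ys = C" "last (tA # ys) = t"
    and leaves: "filter leaf (remdups ys) = filter leaf (rev flB)"
  shows "tour t C F (flB @ flA) (r @ ys)"
proof -
  have r: "r \<noteq> []" "last r = tA" "set r = A" "successively adj r"
    "filter leaf (remdups r) = filter leaf (rev flA)" "feasible (inner A) FA r"
    using tA unfolding tour_def by auto
  have lA: "v \<in> inner A" if "leaf v" "v \<in> A" for v
  proof -
    have "u = v" if "(u, v) \<in> up\<^sup>*" for u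
      using that \<open>leaf v\<close> by (cases rule: rtranclE) (auto simp: leaf_def chld_def up_iff)
    then show ?thesis using that unfolding inner_def leaf_def by auto
  qed
  have "filter leaf (remdups (r @ ys)) = filter leaf (rev flA) @ filter leaf (rev flB)"
    using filter_remdups_append[of r leaf ys] lA avoid r leaves by auto
  moreover have "successively adj (r @ ys)"
    using r ys(1) by (auto simp: successively_append_iff successively_Cons)
  moreover have "feasible (inner C) F (r @ ys)"
  proof (rule feasible_append)
    show "inner A \<subseteq> inner C" using C(1) by (intro inner_mono) auto
  qed (use r ys avoid F finite_inner in auto)
  moreover have "last (r @ ys) = t" using r C(2) by (cases ys) auto
  ultimately show ?thesis using r C(1) unfolding tour_def by auto
qed

definition walk :: "nat \<Rightarrow> 'v list \<Rightarrow> bool" where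
  "walk M r \<longleftrightarrow> successively (\<lambda>y z. adj y z \<and> w {y, z} \<le> M) r"

lemma walk_adj: "walk M r \<Longrightarrow> successively adj r"
  unfolding walk_def by (erule successively_mono) auto

lemma walk_cheap: "walk M r \<Longrightarrow> successively (\<lambda>y z. w {y, z} \<le> M) r"
  unfolding walk_def by (erule successively_mono) auto

lemma walk_rev: "walk M r \<Longrightarrow> walk M (rev r)"
  unfolding walk_def successively_rev
  by (erule successively_mono) (auto simp: insert_commute intro: adj_sym)

lemma walk_append: "walk M (xs @ ys) \<longleftrightarrow> walk M xs \<and> walk M ys \<and>
    (xs = [] \<or> ys = [] \<or> adj (last xs) (hd ys) \<and> w {last xs, hd ys} \<le> M)"
  unfolding walk_def by (auto simp: successively_append_iff)

lemma walk_overlap: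
  assumes "walk M r" "walk M r'" "r \<noteq> []" "r' \<noteq> []" "last r = hd r'"
  shows "walk M (butlast r @ r')" "hd (butlast r @ r') = hd r" "last (butlast r @ r') = last r'"
proof -
  have r: "r = butlast r @ [hd r']" using assms(3,5) by (metis append_butlast_last_id)
  then show "walk M (butlast r @ r')"
    using assms(1,2) walk_append[of M "butlast r" "[hd r']"] by (auto simp: walk_append)
  show "hd (butlast r @ r') = hd r" using r by (metis append_Nil hd_append2 list.sel(1))
  show "last (butlast r @ r') = last r'" using assms(4) by simp
qed

lemma good_singleton:
  assumes "t \<in> V"
  shows "good t {t} 0 [t]"
  unfolding good_def tour_def by (intro conjI exI[of _ "[t]"]) auto

section \<open>Merging two components along the edge from \<open>v\<close> to its parent\<close>

context
  fixes K v t M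
  assumes K: "K \<subseteq> V - {s}" and v: "v \<in> V - {s}" "v \<notin> K" and t: "t \<in> V - K" "par v \<in> cls K t"
    and cheap: "\<And>u. u \<in> K \<Longrightarrow> w {u, par u} \<le> M" and M: "w {v, par v} = M"
begin

lemma tops_distinct: "t \<noteq> v"
  using par_notin_cls[OF K v(1)] t(2) by blast

lemma cls_disjoint: "cls K t \<inter> cls K v = {}"
  using cls_unique t v tops_distinct by blast

lemma cls_proper: "cls K t \<noteq> V" "cls K v \<noteq> V"
  using cls_disjoint cls_self t v by blast+

lemma up_in_cls: "x \<in> V - K \<Longrightarrow> y \<in> cls K x \<Longrightarrow> z \<in> cls K x \<Longrightarrow> (y, z) \<in> up \<Longrightarrow> y \<in> K"
  using cls_step par_notin_cls[OF K] unfolding up_iff by blast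

lemma walk_in_cls:
  assumes "x \<in> V - K" "set r \<subseteq> cls K x" "successively adj r"
  shows "walk M r"
  unfolding walk_def using assms(3)
proof (rule successively_mono)
  fix y z assume "y \<in> set r" "z \<in> set r" and adj: "adj y z"
  then have y: "y \<in> cls K x" and z: "z \<in> cls K x" using assms(2) by auto
  have "w {y, z} \<le> M"
    using adj up_in_cls[OF assms(1) y z] up_in_cls[OF assms(1) z y] cheap[of y] cheap[of z]
    unfolding adj_def up_iff by (auto simp: insert_commute)
  with adj show "adj y z \<and> w {y, z} \<le> M" by simp
qed

lemma up_walk_cheap:
  assumes "x \<in> V - K" "y \<in> cls K x"
  obtains r where "r \<noteq> []" "hd r = y" "last r = x" "set r \<subseteq> cls K x"
    "\<And>u. u \<in> set r \<Longrightarrow> (y, u) \<in> up\<^sup>*" "walk M r"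
proof -
  obtain r where r: "r \<noteq> []" "hd r = y" "last r = x" "set r \<subseteq> cls K x"
    "\<forall>u\<in>set r. (y, u) \<in> (upK K)\<^sup>*" "successively (\<lambda>x y. (x, y) \<in> upK K) r"
    using up_walk[OF assms(2)] by blast
  have "successively adj r"
    using r(6) by (rule successively_mono) (use upK_sub_up[OF K] in \<open>auto simp: adj_def\<close>)
  then have "walk M r" using walk_in_cls[OF assms(1) r(4)] by blast
  moreover have "(y, u) \<in> up\<^sup>*" if "u \<in> set r" for u
    using r(5) that rtrancl_mono[OF upK_sub_up[OF K]] by blast
  ultimately show ?thesis using r that by blast
qed

text \<open>The component merged second is entered and left at \<open>x\<close>. A walk from
  \<open>x\<close> to the beginning of its tour is put in front; it changes no last occurrence, so
  the order of the leaves is kept.\<close>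

lemma tour_closed:
  assumes x: "x \<in> V - K" and tour: "tour x (cls K x) F fl r"
  obtains X where "X \<noteq> []" "walk M X" "hd X = x" "last X = x" "set X = cls K x"
    "remdups X = remdups r"
proof -
  have r: "r \<noteq> []" "last r = x" "set r = cls K x" "successively adj r"
    using tour unfolding tour_def by auto
  then have "hd r \<in> cls K x" using hd_in_set by blast
  then obtain U where U: "U \<noteq> []" "hd U = hd r" "last U = x" "set U \<subseteq> cls K x" "walk M U"
    using up_walk_cheap[OF x] by metis
  have "walk M r" using walk_in_cls[OF x] r by auto
  moreover have "walk M (rev U)" using U walk_rev by blast
  moreover have "last (rev U) = hd r" "hd (rev U) = x" using U by (auto simp: last_rev hd_rev)
  ultimately have X: "walk M (butlast (rev U) @ r)" "hd (butlast (rev U) @ r) = x"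
    "last (butlast (rev U) @ r) = x"
    using walk_overlap[of M "rev U" r] r U(1) by auto
  have "set (butlast (rev U)) \<subseteq> set U" by (metis in_set_butlastD set_rev subsetI)
  then have "set (butlast (rev U)) \<subseteq> set r" using U(4) r(3) by blast
  then have "set (butlast (rev U) @ r) = cls K x" "remdups (butlast (rev U) @ r) = remdups r"
    using r(3) remdups_append_superset unfolding set_append by blast+
  with X r(1) show ?thesis using that append_is_Nil_conv by blast
qed

text \<open>The group finishes the upper component at \<open>t\<close>, goes down to
  \<open>par v\<close>, explores the lower component and climbs back to \<open>t\<close>. On the way
  it uses only ancestors of \<open>v\<close>; their subtrees contain \<open>v\<close>, so none of
  them was collected within \<open>cls K t\<close>.\<close>

lemma tour_from_parent:
  assumes tA: "tour t (cls K t) FA flA rA" and tB: "tour v (cls K v) FB flB rB"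
    and F: "FA \<le> F" "M \<le> F + sum vw (inner (cls K t))"
  shows "\<exists>r. tour t (cls K t \<union> cls K v) F (flB @ flA) r"
proof -
  obtain X where X: "X \<noteq> []" "walk M X" "hd X = v" "last X = v" "set X = cls K v"
    "remdups X = remdups rB"
    using tour_closed[OF _ tB] v by blast
  obtain U where U: "U \<noteq> []" "hd U = par v" "last U = t" "set U \<subseteq> cls K t"
    "\<And>u. u \<in> set U \<Longrightarrow> (par v, u) \<in> up\<^sup>*" "walk M U"
    using up_walk_cheap[OF t] by metis
  obtain P where rU: "rev U = t # P" using U by (metis hd_rev list.exhaust_sel rev_is_Nil_conv)
  have vU: "(v, u) \<in> up\<^sup>+" if "u \<in> set U" for u
    using U(5)[OF that] v(1) by (meson rtrancl_into_trancl2 up_iff)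
  have avoid: "u \<notin> inner (cls K t)" if "u \<in> set U" for u
    using vU[OF that] cls_disjoint cls_self unfolding inner_def by (blast dest: trancl_into_rtrancl)
  have nonleaf: "\<not> leaf u" if u: "u \<in> set U" for u
  proof -
    obtain z where "(z, u) \<in> up" using vU[OF u] by (meson tranclD2)
    then show ?thesis unfolding leaf_def chld_def up_iff by blast
  qed
  define ys where "ys = P @ X @ U"
  have vt: "adj v (par v)" "adj (par v) v" unfolding adj_def using v by (auto simp: up_iff)
  have "t # ys = rev U @ X @ U" unfolding rU ys_def by simp
  moreover have "walk M (rev U @ X @ U)"
    using U X vt M walk_rev[OF U(6)] by (simp add: walk_append last_rev insert_commute)
  ultimately have ysw: "walk M (t # ys)" by simp
  have PU: "set (P) \<subseteq> set U" using rU by (metis set_rev set_subset_Cons)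
  have fU: "filter leaf (remdups xs) = []" if "set xs \<subseteq> set U" for xs
    using nonleaf that by (auto simp: filter_empty_conv)
  have "filter leaf (remdups ys) = filter leaf (remdups X)"
    unfolding ys_def using nonleaf PU fU[of "P"] fU[of U] cls_disjoint U(4) X(5)
    by (subst filter_remdups_append, blast, subst filter_remdups_append, blast) (simp add: fU)
  also have "\<dots> = filter leaf (rev flB)" using X(6) tB unfolding tour_def by simp
  finally have lv: "filter leaf (remdups ys) = filter leaf (rev flB)" .
  have "tour t (cls K t \<union> cls K v) F (flB @ flA) (rA @ ys)"
  proof (rule tour_extend[OF tA F walk_adj[OF ysw] walk_cheap[OF ysw] _ _ _ lv])
    show "inner (cls K t) \<inter> set ys = {}"
      using avoid PU X(5) cls_disjoint inner_sub[of "cls K t"] unfolding ys_def by auto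
    show "cls K t \<union> set ys = cls K t \<union> cls K v"
      using PU X(5) U(4) unfolding ys_def by auto
    show "last (t # ys) = t" using U unfolding ys_def by simp
  qed
  then show ?thesis by blast
qed

text \<open>The group finishes the lower component at \<open>v\<close>, climbs through
  \<open>par v\<close> to \<open>t\<close> and makes a closed tour from there, without ever
  returning to the lower component.\<close>

lemma tour_from_child:
  assumes tA: "tour v (cls K v) FA flA rA" and tB: "tour t (cls K t) FB flB rB"
    and F: "FA \<le> F" "M \<le> F + sum vw (inner (cls K v))"
  shows "\<exists>r. tour t (cls K t \<union> cls K v) F (flB @ flA) r"
proof -
  obtain X where X: "X \<noteq> []" "walk M X" "hd X = t" "last X = t" "set X = cls K t"
    "remdups X = remdups rB"
    using tour_closed[OF t(1) tB] by blast
  obtain U where U: "U \<noteq> []" "hd U = par v" "last U = t" "set U \<subseteq> cls K t" "walk M U"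
    using up_walk_cheap[OF t] by metis
  \<comment> \<open>\<open>t\<close> ends \<open>U\<close> and begins \<open>X\<close>;
    \<open>butlast\<close> keeps it from occurring twice in a row, which \<open>adj\<close> would
    forbid.\<close>
  define ys where "ys = butlast U @ X"
  have ys: "walk M ys" "hd ys = par v" "last ys = t" "ys \<noteq> []"
    unfolding ys_def using walk_overlap[OF U(5) X(2) U(1) X(1)] U X by auto
  have "adj v (par v)" unfolding adj_def using v by (auto simp: up_iff)
  then have ysw: "walk M (v # ys)" using ys M walk_append[of M "[v]" ys] by (auto simp: walk_def)
  have sub: "set (butlast U) \<subseteq> set X" using U X by (auto dest: in_set_butlastD)
  have lv: "filter leaf (remdups ys) = filter leaf (rev flB)"
    unfolding ys_def remdups_append_superset[OF sub] using X(6) tB unfolding tour_def by simp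
  have setys: "set ys = cls K t" using sub X(5) unfolding ys_def by auto
  have "tour t (cls K t \<union> cls K v) F (flB @ flA) (rA @ ys)"
  proof (rule tour_extend[OF tA F walk_adj[OF ysw] walk_cheap[OF ysw] _ _ _ lv])
    show "inner (cls K v) \<inter> set ys = {}" using cls_disjoint inner_sub setys by blast
  qed (use setys ys in auto)
  then show ?thesis by blast
qed

text \<open>If \<open>y\<close> is at least \<open>F\<close>, the component itself is a bad piece:
  edges leaving it are not in \<open>K\<close> and hence weigh at least \<open>M\<close>.\<close>

lemma good_lower:
  assumes x: "x \<in> V - K" "cls K x \<noteq> V" and good: "good x (cls K x) F fl"
    and expensive: "\<And>u. u \<in> V - {s} \<Longrightarrow> u \<notin> K \<Longrightarrow> M \<le> w {u, par u}"
    and y: "y < max F (M - sum vw (inner (cls K x)))"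
  shows "\<exists>g. \<forall>v\<in>cls K x. v \<in> g v \<and> g v \<subseteq> cls K x \<and> g v \<noteq> V \<and> (\<forall>u\<in>g v. g u = g v) \<and> bad w vw y (g v)"
proof (cases "y < F")
  case True
  then show ?thesis using good unfolding good_def by blast
next
  case False
  then have yM: "y + sum vw (inner (cls K x)) < M" using y by auto
  have "bad w vw y (cls K x)"
    unfolding bad_def
  proof (intro ballI impI)
    fix u assume u: "u \<in> V - {s}" "(u \<in> cls K x) \<noteq> (par u \<in> cls K x)"
    then have "u \<notin> K" using cls_step cls_par x(1) by blast
    then show "y + sum vw (inner (cls K x)) < w {u, par u}" using expensive[OF u(1)] yM by simp
  qed
  then show ?thesis using x by (intro exI[of _ "\<lambda>_. cls K x"]) auto
qed

text \<open>The component in which the reversed walk starts is visited last by the agents, so its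
  list comes second. For an excess below both \<open>G1\<close> and \<open>G2\<close>, the
  partitions of the two sides are put together.\<close>

lemma good_merge:
  assumes expensive: "\<And>u. u \<in> V - {s} \<Longrightarrow> u \<notin> K \<Longrightarrow> M \<le> w {u, par u}"
    and good1: "good v (cls K v) F1 fl1" and good2: "good t (cls K t) F2 fl2"
  defines "G1 \<equiv> max F1 (M - sum vw (inner (cls K v)))"
    and "G2 \<equiv> max F2 (M - sum vw (inner (cls K t)))"
  shows "G1 \<le> G2 \<Longrightarrow> good t (cls K t \<union> cls K v) G1 (fl2 @ fl1)"
    and "G2 \<le> G1 \<Longrightarrow> good t (cls K t \<union> cls K v) G2 (fl1 @ fl2)"
proof -
  have vK: "v \<in> V - K" using v by blast
  have lower: "\<exists>g. \<forall>x\<in>cls K t \<union> cls K v. x \<in> g x \<and> g x \<subseteq> cls K t \<union> cls K v \<and> g x \<noteq> V \<and>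
      (\<forall>u\<in>g x. g u = g x) \<and> bad w vw y (g x)" if y: "y < G1" "y < G2" for y
  proof -
    obtain g1 where g1: "\<forall>u\<in>cls K v. u \<in> g1 u \<and> g1 u \<subseteq> cls K v \<and> g1 u \<noteq> V \<and>
        (\<forall>u'\<in>g1 u. g1 u' = g1 u) \<and> bad w vw y (g1 u)"
      using good_lower[OF vK cls_proper(2) good1 expensive] y(1) unfolding G1_def by blast
    obtain g2 where g2: "\<forall>u\<in>cls K t. u \<in> g2 u \<and> g2 u \<subseteq> cls K t \<and> g2 u \<noteq> V \<and>
        (\<forall>u'\<in>g2 u. g2 u' = g2 u) \<and> bad w vw y (g2 u)"
      using good_lower[OF t(1) cls_proper(1) good2 expensive] y(2) unfolding G2_def by blast
    define G where "G u = (if u \<in> cls K v then g1 u else g2 u)" for u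
    have G1: "G u = g1 u" if "u \<in> cls K v" for u using that unfolding G_def by simp
    have G2: "G u = g2 u" if "u \<in> cls K t" for u using that cls_disjoint unfolding G_def by auto
    have "u \<in> G u \<and> G u \<subseteq> cls K t \<union> cls K v \<and> G u \<noteq> V \<and> (\<forall>u'\<in>G u. G u' = G u) \<and> bad w vw y (G u)"
      if "u \<in> cls K t \<union> cls K v" for u
    proof (cases "u \<in> cls K v")
      case True
      then have *: "u \<in> g1 u" "g1 u \<subseteq> cls K v" "g1 u \<noteq> V" "\<And>u'. u' \<in> g1 u \<Longrightarrow> g1 u' = g1 u" "bad w vw y (g1 u)"
        using g1 by blast+
      moreover have "G u' = g1 u" if "u' \<in> g1 u" for u' using *(2,4) G1 that by blast
      ultimately show ?thesis unfolding G1[OF True] by blast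
    next
      case False
      then have ut: "u \<in> cls K t" using that by blast
      then have *: "u \<in> g2 u" "g2 u \<subseteq> cls K t" "g2 u \<noteq> V" "\<And>u'. u' \<in> g2 u \<Longrightarrow> g2 u' = g2 u" "bad w vw y (g2 u)"
        using g2 by blast+
      moreover have "G u' = g2 u" if "u' \<in> g2 u" for u' using *(2,4) G2 that by blast
      ultimately show ?thesis unfolding G2[OF ut] by blast
    qed
    then show ?thesis by (intro exI[of _ G] ballI)
  qed
  obtain r1 where r1: "tour v (cls K v) F1 fl1 r1" using good1 unfolding good_def by blast
  obtain r2 where r2: "tour t (cls K t) F2 fl2 r2" using good2 unfolding good_def by blast
  have fl: "set fl1 = cls K v" "set fl2 = cls K t" "distinct fl1" "distinct fl2"
    using good1 good2 unfolding good_def by auto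
  show "good t (cls K t \<union> cls K v) G1 (fl2 @ fl1)" if le: "G1 \<le> G2"
    unfolding good_def
  proof (intro conjI allI impI)
    show "\<exists>r. tour t (cls K t \<union> cls K v) G1 (fl2 @ fl1) r"
      by (rule tour_from_child[OF r1 r2]) (auto simp: G1_def)
  qed (use fl cls_disjoint lower le in auto)
  show "good t (cls K t \<union> cls K v) G2 (fl1 @ fl2)" if le: "G2 \<le> G1"
    unfolding good_def
  proof (intro conjI allI impI)
    show "\<exists>r. tour t (cls K t \<union> cls K v) G2 (fl1 @ fl2) r"
      by (rule tour_from_parent[OF r2 r1]) (auto simp: G2_def)
  qed (use fl cls_disjoint lower le in auto)
qed

end

end

section \<open>Strategies from tours\<close>

definition first_index :: "'a list \<Rightarrow> 'a \<Rightarrow> nat" where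
  "first_index q v = length (takeWhile (\<lambda>u. u \<noteq> v) q)"

lemma first_index_props:
  assumes "v \<in> set q"
  shows "first_index q v < length q" "q ! first_index q v = v" "v \<notin> set (take (first_index q v) q)"
proof -
  show l: "first_index q v < length q"
    unfolding first_index_def using assms by (induction q) auto
  show "q ! first_index q v = v"
    using nth_length_takeWhile[of "\<lambda>u. u \<noteq> v" q] l unfolding first_index_def by simp
  have "take (first_index q v) q = takeWhile (\<lambda>u. u \<noteq> v) q"
    unfolding first_index_def by (rule takeWhile_eq_take[symmetric])
  then show "v \<notin> set (take (first_index q v) q)" by (auto dest: set_takeWhileD)
qed

lemma sorted_first_index: "sorted_wrt (\<lambda>u v. first_index q u < first_index q v) (rev (remdups (rev q)))"
proof (induction q rule: rev_induct)
  case (snoc x q)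
  have old: "first_index (q @ [x]) u = first_index q u" if "u \<in> set q" for u
    using that unfolding first_index_def by (simp add: takeWhile_append1)
  have "sorted_wrt (\<lambda>u v. first_index (q @ [x]) u < first_index (q @ [x]) v) (rev (remdups (rev q)))"
    using snoc by (rule sorted_wrt_mono_rel[rotated]) (simp add: old)
  moreover have "first_index (q @ [x]) u < first_index (q @ [x]) x" if "x \<notin> set q" "u \<in> set q" for u
  proof -
    have "takeWhile (\<lambda>u. u \<noteq> x) (q @ [x]) = q"
      using that(1) by (subst takeWhile_append2) auto
    then show ?thesis using old[OF that(2)] first_index_props(1)[OF that(2)] by (simp add: first_index_def)
  qed
  ultimately show ?case by (auto simp: sorted_wrt_append)
qed simp

text \<open>All unsettled agents march along \<open>q\<close> together, and agents settle in the
  order of their numbers: each new vertex \<open>v\<close> takes the next \<open>vweight T v\<close>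
  of them.\<close>

lemma march_strategy:
  assumes q: "q \<noteq> []" "hd q = start T" "set q = verts T" and T: "weighted_tree T"
    and edge: "\<And>i. Suc i < length q \<Longrightarrow> {q ! i, q ! Suc i} \<in> edges T"
    and k: "1 \<le> k" "(\<Sum>v\<in>verts T. vweight T v) \<le> k"
    and enough: "\<And>i. Suc i < length q \<Longrightarrow>
      max 1 (eweight T {q ! i, q ! Suc i}) + (\<Sum>v\<in>set (take (Suc i) q). vweight T v) \<le> k"
  shows "\<exists>N pos. valid_strategy T k N pos \<and> (\<forall>v\<in>verts T. first_visit k pos v = first_index q v)"
proof -
  \<comment> \<open>\<open>c t\<close> agents are settled at the vertices among the first
    \<open>t\<close> entries of \<open>q\<close>. Agent \<open>a\<close> stops for good as soon as
    \<open>a < c (Suc t)\<close>.\<close>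
  define c where "c t = (\<Sum>v\<in>set (take t q). vweight T v)" for t
  define pos where "pos = rec_nat (\<lambda>a. start T) (\<lambda>t p a. if a < c (Suc t) then p a else q ! Suc t)"
  have pos0: "pos 0 a = start T" for a unfolding pos_def by simp
  have posS: "pos (Suc t) a = (if a < c (Suc t) then pos t a else q ! Suc t)" for t a
    unfolding pos_def by simp
  define N where "N = length q - 1"
  have lenq: "length q = Suc N" using q(1) unfolding N_def by (cases q) auto
  have c_mono: "c i \<le> c j" if "i \<le> j" for i j
    unfolding c_def using that by (intro sum_mono2) (auto dest: set_take_subset_set_take)
  have c_le: "c t \<le> k" for t
  proof -
    have "c t \<le> (\<Sum>v\<in>set q. vweight T v)" unfolding c_def by (intro sum_mono2) (auto dest: in_set_takeD)
    then show ?thesis using k(2) q(3) by simp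
  qed
  have march: "pos t a = q ! t" if "c t \<le> a" for t a
    using that q(1,2) pos0 posS by (cases t) (auto simp: hd_conv_nth)
  have settled: "pos t' a = pos t a" if "t \<le> t'" "a < c (Suc t)" for t t' a
    using that(1)
  proof (induction t' rule: dec_induct)
    case (step i)
    then have "a < c (Suc i)" using that(2) c_mono[of "Suc t" "Suc i"] by simp
    with step show ?case by (simp add: posS)
  qed simp
  have visited: "pos t a \<in> set (take (Suc t) q)" if "t \<le> N" for t a
    using that
  proof (induction t)
    case 0
    then show ?case using q by (cases q) (auto simp: pos0)
  next
    case (Suc t)
    then have "pos t a \<in> set (take (Suc (Suc t)) q)"
      using set_take_subset_set_take[of "Suc t" "Suc (Suc t)" q] by auto
    moreover have "q ! Suc t \<in> set (take (Suc (Suc t)) q)"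
      using Suc lenq by (simp add: take_Suc_conv_app_nth)
    ultimately show ?case by (simp add: posS)
  qed
  \<comment> \<open>Somebody is still marching at every time up to \<open>N\<close>, because
    \<open>enough\<close> counts each edge with weight at least 1.\<close>
  have last: "c t < k" if "t \<le> N" for t
  proof (cases t)
    case 0
    then show ?thesis using k(1) by (simp add: c_def)
  next
    case (Suc i)
    then show ?thesis using enough[of i] that lenq unfolding c_def by simp
  qed
  have present: "present k pos t (q ! t) \<noteq> {}" if "t \<le> N" for t
    using last[OF that] march[of t "c t"] unfolding present_def by auto
  have fv: "first_visit k pos v = first_index q v" if "v \<in> verts T" for v
    unfolding first_visit_def
  proof (rule Least_equality)
    note fi = first_index_props[of v q]
    have vq: "v \<in> set q" using that q(3) by simp
    show "present k pos (first_index q v) v \<noteq> {}"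
      using present[of "first_index q v"] fi(1,2)[OF vq] lenq by simp
    fix t assume t: "present k pos t v \<noteq> {}"
    show "first_index q v \<le> t"
    proof (rule ccontr)
      assume less: "\<not> first_index q v \<le> t"
      then have "t \<le> N" using fi(1)[OF vq] lenq by simp
      then have "v \<in> set (take (Suc t) q)" using t visited unfolding present_def by auto
      then have "v \<in> set (take (first_index q v) q)"
        using set_take_subset_set_take[of "Suc t" "first_index q v" q] less by auto
      with fi(3)[OF vq] show False by simp
    qed
  qed
  have no_loop: "u \<noteq> v" if "{u, v} \<in> edges T" for u v
    using T that unfolding weighted_tree_def by fastforce
  have "valid_strategy T k N pos"
    unfolding valid_strategy_def
  proof (intro conjI allI impI ballI)
    fix t a assume "t < N" "a < k"
    then show "pos (Suc t) a = pos t a \<or> {pos t a, pos (Suc t) a} \<in> edges T"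
      using march[of t a] c_mono[of t "Suc t"] edge[of t] lenq by (auto simp: posS)
  next
    fix t u v assume t: "t < N" and uv: "{u, v} \<in> edges T \<and> traversing k pos t u v \<noteq> {}"
    then obtain a where a: "a < k" "pos t a = u" "pos (Suc t) a = v"
      unfolding traversing_def by blast
    then have "c (Suc t) \<le> a" using posS[of t a] no_loop uv by (metis not_less)
    then have "u = q ! t" "v = q ! Suc t"
      using a march[of t a] march[of "Suc t" a] c_mono[of t "Suc t"] by auto
    then have "{c (Suc t)..<k} \<subseteq> traversing k pos t u v"
      using march[of t] march[of "Suc t"] c_mono[of t "Suc t"] unfolding traversing_def by auto
    moreover have "finite (traversing k pos t u v)" unfolding traversing_def by simp
    ultimately have "k - c (Suc t) \<le> card (traversing k pos t u v)"
      using card_mono[of "traversing k pos t u v" "{c (Suc t)..<k}"] by simp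
    moreover have "eweight T {u, v} + c (Suc t) \<le> k"
      using enough[of t] t lenq \<open>u = q ! t\<close> \<open>v = q ! Suc t\<close> unfolding c_def by simp
    ultimately show "eweight T {u, v} \<le> card (traversing k pos t u v)" by linarith
  next
    fix v assume "v \<in> verts T"
    then show "\<exists>t\<le>N. present k pos t v \<noteq> {}"
      using present q(3) lenq by (metis in_set_conv_nth less_Suc_eq_le)
  next
    show "\<exists>S. \<forall>v\<in>verts T. S v \<subseteq> present k pos (first_visit k pos v) v \<and> card (S v) = vweight T v \<and>
      (\<forall>a\<in>S v. \<forall>t. first_visit k pos v \<le> t \<and> t \<le> N \<longrightarrow> pos t a = v)"
    proof (intro exI[of _ "\<lambda>v. {c (first_index q v)..<c (Suc (first_index q v))}"] ballI conjI allI impI)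
      fix v assume v: "v \<in> verts T"
      define i where "i = first_index q v"
      have i: "i < length q" "q ! i = v" "v \<notin> set (take i q)"
        using first_index_props[of v q] v q(3) unfolding i_def by auto
      have "c (Suc i) = vweight T v + c i"
        unfolding c_def using i by (simp add: take_Suc_conv_app_nth)
      then show "card {c (first_index q v)..<c (Suc (first_index q v))} = vweight T v"
        unfolding i_def by simp
      have pi: "pos t a = v" if "i \<le> t" "a \<in> {c i..<c (Suc i)}" for t a
        using that settled[of i t a] march[of i a] i by auto
      show "{c (first_index q v)..<c (Suc (first_index q v))} \<subseteq> present k pos (first_visit k pos v) v"
        using pi[of i] c_le[of "Suc i"] fv[OF v] unfolding present_def i_def by auto
      fix a t assume "a \<in> {c (first_index q v)..<c (Suc (first_index q v))}"
        "first_visit k pos v \<le> t \<and> t \<le> N"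
      then show "pos t a = v" using pi fv[OF v] unfolding i_def by simp
    qed
  qed (use pos0 in auto)
  with fv show ?thesis by blast
qed

context weighted_rooted_tree
begin

lemma feasible_nth:
  "feasible I F r \<Longrightarrow> Suc i < length r \<Longrightarrow> w {r ! i, r ! Suc i} \<le> F + sum vw (I - set (drop (Suc i) r))"
proof (induction I F r arbitrary: i rule: feasible.induct)
  case (1 I F y z r)
  show ?case
  proof (cases i)
    case (Suc j)
    then show ?thesis using 1(1)[of j] "1.prems" by simp
  qed (use 1 in simp)
qed auto

end

text \<open>A vertex other than the start lies on its parent edge and on one edge per child.\<close>

lemma leaves_iff_leaf:
  fixes T :: "'v weighted_graph"
  assumes rt: "rooted_tree (verts T) (start T) par"
    and E: "edges T = (\<lambda>v. {v, par v}) ` (verts T - {start T})"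
  shows "weighted_rooted_tree.leaf (verts T) (start T) par v \<longleftrightarrow> v \<in> leaves T"
proof -
  define V where "V = verts T"
  define s where "s = start T"
  interpret weighted_rooted_tree V s par "\<lambda>_. 0" "vweight T"
    using rt unfolding V_def s_def weighted_rooted_tree_def .
  have EV: "edges T = (\<lambda>v. {v, par v}) ` (V - {s})" using E unfolding V_def s_def .
  have chld_card: "card {e \<in> edges T. v \<in> e} = card (chld v) + 1" if "v \<in> V - {s}" for v
  proof -
    have "{e \<in> edges T. v \<in> e} = (\<lambda>v. {v, par v}) ` (insert v (chld v))"
      unfolding EV chld_def using that by auto
    moreover have "inj_on (\<lambda>v. {v, par v}) (insert v (chld v))"
      using edge_inj by (rule inj_on_subset) (use that in \<open>auto simp: chld_def\<close>)
    moreover have "v \<notin> chld v" using par_neq that unfolding chld_def by blast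
    moreover have "finite (chld v)" using finite_V unfolding chld_def by simp
    ultimately show ?thesis by (simp add: card_image)
  qed
  have "finite (chld v)" using finite_V unfolding chld_def by simp
  then show ?thesis
    using chld_card unfolding leaves_def leaf_def V_def[symmetric] s_def[symmetric] by auto
qed

text \<open>The reversed tour is a walk for \<open>march_strategy\<close>, and the partitions for
  smaller excess rule out fewer agents. The \<open>max 1\<close> covers the single vertex of weight
  0, which still has to be reached.\<close>

lemma good_optimal:
  fixes T :: "'v weighted_graph"
  assumes T: "weighted_tree T" and rt: "rooted_tree (verts T) (start T) par"
    and E: "edges T = (\<lambda>v. {v, par v}) ` (verts T - {start T})"
    and good: "weighted_rooted_tree.good (verts T) (start T) par (\<lambda>e. max 1 (eweight T e)) (vweight T)
      (start T) (verts T) F fl"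
  defines "k \<equiv> max 1 (sum (vweight T) (verts T) + F)"
  shows "min_agents T k" "optimal_leaf_order T (filter (\<lambda>v. v \<in> leaves T) fl)"
proof -
  define V where "V = verts T"
  define s where "s = start T"
  define w where "w e = max 1 (eweight T e)" for e
  define W where "W = sum (vweight T) V"
  interpret weighted_rooted_tree V s par w "vweight T"
    using rt unfolding V_def s_def weighted_rooted_tree_def .
  have good': "good s V F fl" using good unfolding V_def s_def w_def .
  have EV: "edges T = (\<lambda>v. {v, par v}) ` (V - {s})" using E unfolding V_def s_def .
  have kW: "k = max 1 (W + F)" unfolding k_def W_def V_def ..
  have leaf_iff: "v \<in> leaves T \<longleftrightarrow> leaf v" for v
    using leaves_iff_leaf[OF rt E] unfolding V_def s_def by simp
  obtain r where r: "r \<noteq> []" "last r = s" "set r = V" "successively adj r"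
    "filter leaf (remdups r) = filter leaf (rev fl)" "feasible (inner V) F r"
    using good' unfolding good_def tour_def by auto
  have fl: "set fl = V" "distinct fl" using good' unfolding good_def by auto
  define q where "q = rev r"
  have iV: "inner V = V - {s}" unfolding inner_def using up_rtrancl_in_V' by auto
  have step: "{q ! i, q ! Suc i} \<in> edges T"
    "w {q ! i, q ! Suc i} + (\<Sum>v\<in>set (take (Suc i) q). vweight T v) \<le> W + F"
    if i: "Suc i < length q" for i
  proof -
    define j where "j = length r - Suc (Suc i)"
    have j: "Suc j < length r" "q ! i = r ! Suc j" "q ! Suc i = r ! j"
      "set (take (Suc i) q) = set (drop (Suc j) r)"
      using i unfolding j_def q_def by (auto simp: rev_nth Suc_diff_Suc take_rev)
    have "adj (r ! j) (r ! Suc j)" using r(4) j(1) by (simp add: successively_conv_nth)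
    then show "{q ! i, q ! Suc i} \<in> edges T"
      unfolding EV adj_def up_iff j(2,3) by (auto simp: insert_commute)
    let ?X = "set (drop (Suc j) r)"
    \<comment> \<open>The start ends the tour, so it belongs to the vertices already filled in
      forward direction; its absence from \<open>inner V\<close> does not change the
      balance.\<close>
    have "s \<in> ?X" using r(1,2) j(1) by (metis drop_eq_Nil last_drop last_in_set not_le)
    then have "V - {s} - ?X = V - ?X" by blast
    moreover have "?X \<subseteq> V" using r(3) by (auto dest: in_set_dropD)
    ultimately have "sum (vweight T) (V - {s} - ?X) + sum (vweight T) ?X = W"
      unfolding W_def using sum.subset_diff[of ?X V "vweight T"] finite_V by simp
    moreover have "w {r ! j, r ! Suc j} \<le> F + sum (vweight T) (V - {s} - ?X)"
      using feasible_nth[OF r(6) j(1)] iV by simp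
    ultimately show "w {q ! i, q ! Suc i} + (\<Sum>v\<in>set (take (Suc i) q). vweight T v) \<le> W + F"
      unfolding j by (simp add: insert_commute)
  qed
  have "\<exists>N pos. valid_strategy T k N pos \<and> (\<forall>v\<in>verts T. first_visit k pos v = first_index q v)"
  proof (rule march_strategy[OF _ _ _ T step(1)])
    show "hd q = start T" using r unfolding q_def s_def by (simp add: hd_rev)
    show "max 1 (eweight T {q ! i, q ! Suc i}) + (\<Sum>v\<in>set (take (Suc i) q). vweight T v) \<le> k"
      if "Suc i < length q" for i
      using step(2)[OF that] unfolding w_def kW by simp
  qed (use r in \<open>auto simp: q_def kW W_def V_def\<close>)
  then obtain N pos where val: "valid_strategy T k N pos"
    and fv: "\<And>v. v \<in> V \<Longrightarrow> first_visit k pos v = first_index q v" unfolding V_def by blast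
  have lower: "k \<le> k'" if val': "valid_strategy T k' N' pos'" for k' N' pos'
  proof (rule ccontr)
    assume "\<not> k \<le> k'"
    moreover have "1 \<le> k'"
    proof -
      have "\<exists>t\<le>N'. present k' pos' t s \<noteq> {}"
        using val' root_in_V unfolding valid_strategy_def V_def by blast
      then show ?thesis unfolding present_def by auto
    qed
    moreover have "W \<le> k'"
    proof (rule disjoint_settled[OF val' T])
      fix S assume "\<And>v. v \<in> verts T \<Longrightarrow> S v \<subseteq> {..<k'}"
        and W: "card (\<Union>v\<in>verts T. S v) = (\<Sum>v\<in>verts T. vweight T v)"
      then have "(\<Union>v\<in>verts T. S v) \<subseteq> {..<k'}" by blast
      from card_mono[OF _ this] show "W \<le> k'" unfolding W_def V_def W[symmetric] by simp
    qed
    \<comment> \<open>\<open>W \<le> k'\<close> makes the truncated subtraction exact, and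
      \<open>1 \<le> k'\<close> excludes the case where \<open>k\<close> is raised to 1.\<close>
    ultimately have "k' - W < F" unfolding kW by auto
    then obtain g where g: "\<forall>v\<in>V. v \<in> g v \<and> g v \<subseteq> V \<and> g v \<noteq> V \<and> (\<forall>u\<in>g v. g u = g v) \<and>
      bad w (vweight T) (k' - W) (g v)"
      using good' unfolding good_def by blast
    show False
    proof (rule bad_pieces_lower_bound[OF T rt E _ val'])
      show "w e = max 1 (eweight T e)" for e by (rule w_def)
      show "v \<in> g v \<and> g v \<subseteq> verts T \<and> g v \<noteq> verts T \<and> (\<forall>u\<in>g v. g u = g v)" if "v \<in> verts T" for v
        using bspec[OF g[unfolded V_def] that] by (elim conjE, intro conjI)
      show "rooted_tree.bad (verts T) (start T) par w (vweight T) (k' - sum (vweight T) (verts T)) (g v)"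
        if "v \<in> verts T" for v
        using bspec[OF g[unfolded V_def W_def s_def] that] by (elim conjE)
    qed
  qed
  show min: "min_agents T k"
    unfolding min_agents_def
  proof (intro conjI allI impI)
    show "\<exists>N pos. valid_strategy T k N pos" by (rule exI[of _ N], rule exI[of _ pos], rule val)
  qed (rule lower)
  have "filter leaf fl = filter leaf (rev (remdups r))"
    using r(5) by (metis rev_filter rev_rev_ident)
  moreover have "sorted_wrt (\<lambda>u v. first_visit k pos u < first_visit k pos v) (rev (remdups r))"
    using sorted_first_index[of q] unfolding q_def rev_rev_ident
    by (rule sorted_wrt_mono_rel[rotated]) (simp add: fv r(3) q_def)
  ultimately have "sorted_wrt (\<lambda>u v. first_visit k pos u < first_visit k pos v) (filter leaf fl)"
    by (simp add: sorted_wrt_filter)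
  moreover have "leaves T \<subseteq> V" unfolding leaves_def V_def by blast
  then have "set (filter leaf fl) = leaves T" using fl(1) leaf_iff by auto
  ultimately show "optimal_leaf_order T (filter (\<lambda>v. v \<in> leaves T) fl)"
    unfolding optimal_leaf_order_def leaf_iff
    using fl(2) min val by (intro conjI exI[of _ k] exI[of _ N] exI[of _ pos]) auto
qed

section \<open>Weakest preconditions and the program\<close>

text \<open>The postcondition also receives the running time, so one assertion covers result, memory
  and cost. The rules below are equations: rewriting with them is symbolic execution.\<close>

definition wp :: "expr list \<Rightarrow> nat list \<Rightarrow> expr \<Rightarrow> memory \<Rightarrow> (nat \<Rightarrow> memory \<Rightarrow> nat \<Rightarrow> bool) \<Rightarrow> bool" where
  "wp P \<rho> e m Q \<longleftrightarrow> (\<exists>x m' t. eval P \<rho> e m x m' t \<and> Q x m' t)"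

definition wps :: "expr list \<Rightarrow> nat list \<Rightarrow> expr list \<Rightarrow> memory \<Rightarrow> (nat list \<Rightarrow> memory \<Rightarrow> nat \<Rightarrow> bool) \<Rightarrow> bool" where
  "wps P \<rho> es m Q \<longleftrightarrow> (\<exists>xs m' t. evals P \<rho> es m xs m' t \<and> Q xs m' t)"

lemma wp_mono: "wp P \<rho> e m Q \<Longrightarrow> (\<And>x m' t. Q x m' t \<Longrightarrow> R x m' t) \<Longrightarrow> wp P \<rho> e m R"
  unfolding wp_def by blast

text \<open>Without these congruence rules, postconditions would be simplified before the memory is known.\<close>

lemma wp_cong [cong]: "\<rho> = \<rho>' \<Longrightarrow> e = e' \<Longrightarrow> m = m' \<Longrightarrow> wp P \<rho> e m Q \<longleftrightarrow> wp P \<rho>' e' m' Q"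
  by simp

lemma wps_cong [cong]: "\<rho> = \<rho>' \<Longrightarrow> es = es' \<Longrightarrow> m = m' \<Longrightarrow> wps P \<rho> es m Q \<longleftrightarrow> wps P \<rho>' es' m' Q"
  by simp

inductive_cases eval_LitE: "eval P \<rho> (Lit c) m x m' t"
inductive_cases eval_VarE: "eval P \<rho> (Var i) m x m' t"
inductive_cases eval_AddE: "eval P \<rho> (Add a b) m x m' t"
inductive_cases eval_SubE: "eval P \<rho> (Sub a b) m x m' t"
inductive_cases eval_ReadE: "eval P \<rho> (Read a) m x m' t"
inductive_cases eval_WriteE: "eval P \<rho> (Write a b) m x m' t"
inductive_cases eval_IfLessE: "eval P \<rho> (IfLess a b c d) m x m' t"
inductive_cases eval_LetE: "eval P \<rho> (Let a b) m x m' t"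
inductive_cases eval_CallE: "eval P \<rho> (Call f es) m x m' t"
inductive_cases evals_NilE: "evals P \<rho> [] m xs m' t"
inductive_cases evals_ConsE: "evals P \<rho> (e # es) m xs m' t"

lemma wp_Lit: "wp P \<rho> (Lit c) m Q \<longleftrightarrow> Q c m 1"
  unfolding wp_def by (auto elim: eval_LitE intro: eval_evals.intros(1)[unfolded One_nat_def])

lemma wp_Var: "wp P \<rho> (Var i) m Q \<longleftrightarrow> i < length \<rho> \<and> Q (\<rho> ! i) m 1"
  unfolding wp_def by (auto elim: eval_VarE intro: eval_evals.intros(2)[unfolded One_nat_def])

lemma wp_Add: "wp P \<rho> (Add a b) m Q \<longleftrightarrow>
    wp P \<rho> a m (\<lambda>x m1 t1. wp P \<rho> b m1 (\<lambda>y m2 t2. Q (x + y) m2 (t1 + t2 + 1)))"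
  unfolding wp_def
  apply (rule iffI)
   apply (elim exE conjE, erule eval_AddE, simp, blast)
  apply (elim exE conjE, rule exI, rule exI, rule exI, rule conjI, erule (1) eval_evals.intros(3), assumption)
  done

lemma wp_Sub: "wp P \<rho> (Sub a b) m Q \<longleftrightarrow>
    wp P \<rho> a m (\<lambda>x m1 t1. wp P \<rho> b m1 (\<lambda>y m2 t2. Q (x - y) m2 (t1 + t2 + 1)))"
  unfolding wp_def
  apply (rule iffI)
   apply (elim exE conjE, erule eval_SubE, simp, blast)
  apply (elim exE conjE, rule exI, rule exI, rule exI, rule conjI, erule (1) eval_evals.intros(4), assumption)
  done

lemma wp_Read: "wp P \<rho> (Read a) m Q \<longleftrightarrow> wp P \<rho> a m (\<lambda>x m1 t1. Q (m1 x) m1 (t1 + 1))"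
  unfolding wp_def
  apply (rule iffI)
   apply (elim exE conjE, erule eval_ReadE, simp, blast)
  apply (elim exE conjE, rule exI, rule exI, rule exI, rule conjI, erule eval_evals.intros(5), assumption)
  done

lemma wp_Write: "wp P \<rho> (Write a b) m Q \<longleftrightarrow>
    wp P \<rho> a m (\<lambda>x m1 t1. wp P \<rho> b m1 (\<lambda>y m2 t2. Q y (m2(x := y)) (t1 + t2 + 1)))"
  unfolding wp_def
  apply (rule iffI)
   apply (elim exE conjE, erule eval_WriteE, simp, blast)
  apply (elim exE conjE, rule exI, rule exI, rule exI, rule conjI, erule (1) eval_evals.intros(6), assumption)
  done

lemma wp_IfLess: "wp P \<rho> (IfLess a b c d) m Q \<longleftrightarrow>
    wp P \<rho> a m (\<lambda>x m1 t1. wp P \<rho> b m1 (\<lambda>y m2 t2.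
      wp P \<rho> (if x < y then c else d) m2 (\<lambda>z m3 t3. Q z m3 (t1 + t2 + t3 + 1))))"
  unfolding wp_def
  apply (rule iffI)
   apply (elim exE conjE)
   apply (erule eval_IfLessE)
    apply (simp; blast)
   apply (simp; blast)
  apply (elim exE conjE)
  subgoal for x m1 t1 y m2 t2 z m3 t3
    apply (cases "x < y"; simp only: if_True if_False)
     apply (rule exI, rule exI, rule exI, rule conjI, rule eval_evals.intros(7); assumption)
    apply (rule exI, rule exI, rule exI, rule conjI, rule eval_evals.intros(8); assumption)
    done
  done

lemma wp_Let: "wp P \<rho> (Let a b) m Q \<longleftrightarrow>
    wp P \<rho> a m (\<lambda>x m1 t1. wp P (x # \<rho>) b m1 (\<lambda>y m2 t2. Q y m2 (t1 + t2 + 1)))"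
  unfolding wp_def
  apply (rule iffI)
   apply (elim exE conjE, erule eval_LetE, simp, blast)
  apply (elim exE conjE, rule exI, rule exI, rule exI, rule conjI, erule (1) eval_evals.intros(9), assumption)
  done

lemma wps_Nil: "wps P \<rho> [] m Q \<longleftrightarrow> Q [] m 0"
  unfolding wps_def by (auto elim: evals_NilE intro: eval_evals.intros(11))

lemma wps_Cons: "wps P \<rho> (e # es) m Q \<longleftrightarrow>
    wp P \<rho> e m (\<lambda>x m1 t1. wps P \<rho> es m1 (\<lambda>xs m2 t2. Q (x # xs) m2 (t1 + t2)))"
  unfolding wps_def wp_def by (blast elim: evals_ConsE intro: eval_evals.intros(12))

lemma wp_Call: "f < length P \<Longrightarrow> wp P \<rho> (Call f es) m Q \<longleftrightarrow>
    wps P \<rho> es m (\<lambda>xs m1 t1. wp P xs (P ! f) m1 (\<lambda>x m2 t2. Q x m2 (t1 + t2 + 1)))"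
  unfolding wp_def wps_def
  apply (rule iffI)
   apply (elim exE conjE, erule eval_CallE, simp, blast)
  apply (elim exE conjE, rule exI, rule exI, rule exI, rule conjI, erule (2) eval_evals.intros(10), assumption)
  done

text \<open>
  Field \<open>j\<close> of record \<open>v\<close>, behind the input. Fields 0 and 1 of a vertex: label of its component, next
  vertex in the list of the component. Fields 2 to 6 of a label: first and last vertex of that list,
  number of vertices, excess \<open>F\<close>, collected weight \<open>D\<close>. Fields 7 to 9 of a vertex: number and sum
  of its neighbours that are not yet peeled off, leaf flag; two extra neighbours are counted for the
  start, so that it is never peeled off. Field 10 of an edge: next edge in the sorted order.
\<close>

definition fld :: "nat \<Rightarrow> nat \<Rightarrow> nat \<Rightarrow> nat" where
  "fld n j v = 16 * (n + v) + j"

lemma fld_eq_iff [simp]: "j < 16 \<Longrightarrow> j' < 16 \<Longrightarrow> fld n j v = fld n j' v' \<longleftrightarrow> j = j' \<and> v = v'"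
proof
  assume j: "j < 16" "j' < 16" and eq: "fld n j v = fld n j' v'"
  then have "(16 * (n + v) + j) mod 16 = (16 * (n + v') + j') mod 16" unfolding fld_def by argo
  then have "j = j'" using j by (simp only: mod_mult_self4 mod_less)
  then show "j = j' \<and> v = v'" using eq unfolding fld_def by simp
qed simp

lemma fld_ge: "16 * n \<le> fld n j v"
  unfolding fld_def by simp

lemma fld_neq [simp]: "a < 16 * n \<Longrightarrow> fld n j v \<noteq> a" "a < 16 * n \<Longrightarrow> a \<noteq> fld n j v"
  using fld_ge[of n j v] by auto

text \<open>Without multiplication the factor 16 takes four doublings; 16 is the power of two above
  the 11 fields in use. Address 0 holds \<open>n\<close>, and the input ends before address
  \<open>16 * n\<close>.\<close>

definition Fld :: "nat \<Rightarrow> expr \<Rightarrow> expr" where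
  "Fld j e = Let (Add e (Read (Lit 0))) (Let (Add (Var 0) (Var 0)) (Let (Add (Var 0) (Var 0))
     (Let (Add (Var 0) (Var 0)) (Add (Add (Var 0) (Var 0)) (Lit j)))))"

abbreviation "Rd j e \<equiv> Read (Fld j e)"
abbreviation "Wr j e e' \<equiv> Write (Fld j e) e'"
text \<open>No value is below 0, so always \<open>b\<close> is chosen and \<open>a\<close> is
  evaluated for its effect only.\<close>

abbreviation "Seq a b \<equiv> IfLess a (Lit 0) (Lit 0) b"

definition Maximum :: "expr \<Rightarrow> expr \<Rightarrow> expr" where
  "Maximum a b = IfLess a b b a"

text \<open>Two numbers and \<open>n\<close> vertex weights precede the edges, which take three
  entries each. The expression \<open>e\<close> is evaluated three times, hence it is always a
  variable.\<close>

definition Arg :: "nat \<Rightarrow> expr \<Rightarrow> expr" where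
  "Arg j e = Read (Add (Add (Lit (2 + j)) (Read (Lit 0))) (Add e (Add e e)))"

lemma wp_Fld: "wp P \<rho> (Fld j e) m Q \<longleftrightarrow> wp P \<rho> e m (\<lambda>x m1 t. Q (fld (m1 0) j x) m1 (t + 21))"
proof -
  have "x + n + (x + n) + (x + n + (x + n)) + (x + n + (x + n) + (x + n + (x + n))) +
      (x + n + (x + n) + (x + n + (x + n)) + (x + n + (x + n) + (x + n + (x + n)))) + j = fld n j x" for x n
    unfolding fld_def by simp
  then show ?thesis
    unfolding Fld_def by (simp add: wp_Let wp_Add wp_Read wp_Lit wp_Var numeral_eq_Suc cong del: wp_cong)
qed

definition arg :: "nat \<Rightarrow> nat \<Rightarrow> nat \<Rightarrow> nat" where
  "arg n j e = 2 + n + 3 * e + j"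

lemma arg_low: "e < n - 1 \<Longrightarrow> j < 3 \<Longrightarrow> arg n j e < 16 * n"
  unfolding arg_def by simp

lemma wp_Arg: "wp P \<rho> (Arg j (Var i)) m Q \<longleftrightarrow> i < length \<rho> \<and> Q (m (arg (m 0) j (\<rho> ! i))) m 11"
proof -
  have "2 + j + n + (x + (x + x)) = arg n j x" for x n
    unfolding arg_def by simp
  then show ?thesis
    unfolding Arg_def by (simp add: wp_Let wp_Add wp_Read wp_Lit wp_Var numeral_eq_Suc cong del: wp_cong)
qed

lemma wp_Maximum: "wp P \<rho> (Maximum (Lit c) (Var i)) m Q \<longleftrightarrow> i < length \<rho> \<and> Q (max c (\<rho> ! i)) m 4"
  unfolding Maximum_def by (auto simp: wp_IfLess wp_Lit wp_Var max_def numeral_eq_Suc)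

text \<open>The two outcomes of the comparison differ in cost; a common bound avoids a case
  distinction in the caller.\<close>

lemma wp_Maximum_diff:
  assumes "i < length \<rho>" "j < length \<rho>" and "\<And>t. t \<le> 200 \<Longrightarrow>
    Q (max (m (fld (m 0) 5 (\<rho> ! i))) (\<rho> ! j - m (fld (m 0) 6 (\<rho> ! i)))) m t"
  shows "wp P \<rho> (Maximum (Rd 5 (Var i)) (Sub (Var j) (Rd 6 (Var i)))) m Q"
  unfolding Maximum_def
  using assms(1,2) assms(3)[of 74] assms(3)[of 72]
  by (cases "m (fld (m 0) 5 (\<rho> ! i)) < \<rho> ! j - m (fld (m 0) 6 (\<rho> ! i))")
    (simp_all add: wp_IfLess wp_Var wp_Sub wp_Read wp_Fld max.absorb1 max.absorb2)

lemmas wp_simps = wp_Maximum wp_Lit wp_Var wp_Add wp_Sub wp_Read wp_Write wp_IfLess wp_Let wps_Nil wps_Cons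
  wp_Fld wp_Arg

section \<open>The procedures of the program\<close>

definition init_body :: expr where
  "init_body = IfLess (Var 0) (Lit 1) (Lit 0) (Let (Sub (Var 0) (Lit 1))
     (Seq (Wr 0 (Var 0) (Var 0)) (Seq (Wr 2 (Var 0) (Var 0)) (Seq (Wr 3 (Var 0) (Var 0))
     (Seq (Wr 4 (Var 0) (Lit 1)) (Add (Read (Add (Lit 2) (Var 0))) (Call 1 [Var 0])))))))"

definition count_body :: expr where
  "count_body = IfLess (Var 0) (Lit 1) (Lit 0) (Let (Sub (Var 0) (Lit 1))
     (Let (Arg 0 (Var 0)) (Let (Arg 1 (Var 1))
     (Seq (Wr 7 (Var 1) (Add (Rd 7 (Var 1)) (Lit 1))) (Seq (Wr 8 (Var 1) (Add (Rd 8 (Var 1)) (Var 0)))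
     (Seq (Wr 7 (Var 0) (Add (Rd 7 (Var 0)) (Lit 1))) (Seq (Wr 8 (Var 0) (Add (Rd 8 (Var 0)) (Var 1)))
     (Call 2 [Var 2]))))))))"

definition leaf_body :: expr where
  "leaf_body = IfLess (Var 0) (Lit 1) (Lit 0) (Let (Sub (Var 0) (Lit 1))
     (Seq (IfLess (Rd 7 (Var 0)) (Lit 2)
       (Seq (Wr 9 (Var 0) (Lit 1)) (Wr 6 (Var 0) (Read (Add (Lit 2) (Var 0))))) (Lit 0))
     (Call 3 [Var 0])))"

text \<open>Halving by repeated subtraction takes linear time, no more than the merge that follows
  in each call of the sorting procedure.\<close>

definition half_body :: expr where
  "half_body = IfLess (Var 0) (Lit 2) (Lit 0) (Add (Lit 1) (Call 4 [Sub (Var 0) (Lit 2)]))"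

definition merge_body :: expr where
  "merge_body = IfLess (Var 1) (Lit 1) (Var 2) (IfLess (Var 3) (Lit 1) (Var 0)
     (IfLess (Arg 2 (Var 2)) (Arg 2 (Var 0))
       (Seq (Wr 10 (Var 2) (Call 5 [Var 0, Var 1, Rd 10 (Var 2), Sub (Var 3) (Lit 1)])) (Var 2))
       (Seq (Wr 10 (Var 0) (Call 5 [Rd 10 (Var 0), Sub (Var 1) (Lit 1), Var 2, Var 3])) (Var 0))))"

definition msort_body :: expr where
  "msort_body = IfLess (Var 1) (Lit 2) (Var 0) (Let (Call 4 [Var 1]) (Let (Call 6 [Var 1, Var 0])
     (Let (Call 6 [Add (Var 2) (Var 1), Sub (Var 3) (Var 1)])
     (Call 5 [Var 1, Var 2, Var 0, Sub (Var 4) (Var 2)]))))"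

definition relabel_body :: expr where
  "relabel_body = IfLess (Var 0) (Lit 1) (Lit 0)
     (Seq (Wr 0 (Var 1) (Var 2)) (Call 7 [Sub (Var 0) (Lit 1), Rd 1 (Var 1), Var 2]))"

definition absorb :: "expr \<Rightarrow> expr \<Rightarrow> expr" where
  "absorb a b = Seq (Wr 4 a (Add (Rd 4 a) (Rd 4 b))) (Seq (Wr 6 a (Add (Rd 6 a) (Rd 6 b))) (Wr 5 a (Var 2)))"

text \<open>The order of the two lists comes from the merging rule, the surviving label from their
  lengths. So the surviving label has to take over either the first or the last vertex of the other
  list.\<close>

definition link_body :: expr where
  "link_body = Seq (Wr 1 (Rd 3 (Var 0)) (Rd 2 (Var 1))) (IfLess (Rd 4 (Var 0)) (Rd 4 (Var 1))
     (Seq (Call 7 [Rd 4 (Var 0), Rd 2 (Var 0), Var 1]) (Seq (Wr 2 (Var 1) (Rd 2 (Var 0))) (absorb (Var 1) (Var 0))))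
     (Seq (Call 7 [Rd 4 (Var 1), Rd 2 (Var 1), Var 0]) (Seq (Wr 3 (Var 0) (Rd 3 (Var 1))) (absorb (Var 0) (Var 1)))))"

text \<open>The argument is peeled off: it is removed from the counters of its parent, the only
  neighbour left in its field 8. If this leaves the parent one neighbour, the weight of the parent
  is collected; if moreover both have the same label, the edge between them is merged already and
  the parent is peeled off next. The sum of both truncated differences tests equality of
  labels.\<close>

definition climb_body :: expr where
  "climb_body = Let (Rd 8 (Var 0)) (Seq (Wr 7 (Var 0) (Sub (Rd 7 (Var 0)) (Lit 1)))
     (Seq (Wr 8 (Var 0) (Sub (Rd 8 (Var 0)) (Var 1))) (IfLess (Rd 7 (Var 0)) (Lit 2)
       (Let (Rd 0 (Var 0)) (Seq (Wr 6 (Var 0) (Add (Rd 6 (Var 0)) (Read (Add (Lit 2) (Var 1)))))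
         (Let (Rd 0 (Rd 8 (Var 1)))
           (IfLess (Add (Sub (Var 1) (Var 0)) (Sub (Var 0) (Var 1))) (Lit 1) (Call 9 [Var 2]) (Lit 0)))))
       (Lit 0))))"

definition kruskal_body :: expr where
  "kruskal_body = IfLess (Var 0) (Lit 1) (Lit 0)
     (Seq (Call 12 [Var 1]) (Call 10 [Sub (Var 0) (Lit 1), Rd 10 (Var 1)]))"

definition out_body :: expr where
  "out_body = IfLess (Var 0) (Lit 1) (Lit 0) (IfLess (Rd 9 (Var 1)) (Lit 1)
     (Call 11 [Sub (Var 0) (Lit 1), Rd 1 (Var 1), Var 2])
     (Seq (Write (Var 2) (Var 1))
       (Add (Lit 1) (Call 11 [Sub (Var 0) (Lit 1), Rd 1 (Var 1), Add (Var 2) (Lit 1)]))))"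

text \<open>Both candidates for the new excess are computed before linking changes the records. Of
  the two ends of the edge only the child can have a single neighbour left, so the two tests find
  the child without knowing the orientation.\<close>

definition step_body :: expr where
  "step_body = Let (Arg 0 (Var 0)) (Let (Arg 1 (Var 1)) (Let (Arg 2 (Var 2)) (Let (Maximum (Lit 1) (Var 0))
     (Let (Rd 0 (Var 3)) (Let (Rd 0 (Var 3))
     (Let (Maximum (Rd 5 (Var 1)) (Sub (Var 2) (Rd 6 (Var 1))))
     (Let (Maximum (Rd 5 (Var 1)) (Sub (Var 3) (Rd 6 (Var 1))))
     (Seq (IfLess (Var 0) (Var 1) (Call 8 [Var 3, Var 2, Var 0]) (Call 8 [Var 2, Var 3, Var 1]))
     (IfLess (Rd 7 (Var 7)) (Lit 2) (Call 9 [Var 7])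
       (IfLess (Rd 7 (Var 6)) (Lit 2) (Call 9 [Var 6]) (Lit 0)))))))))))"

text \<open>At the end a single component is left, so vertex 0 serves to look up its label. The
  result is stored at \<open>fld n 0 n\<close>, right behind the records of all vertices.\<close>

definition main_body :: expr where
  "main_body = Let (Call 1 [Read (Lit 0)]) (Seq (Call 2 [Sub (Read (Lit 0)) (Lit 1)])
     (Seq (Wr 7 (Read (Lit 1)) (Add (Rd 7 (Read (Lit 1))) (Lit 2))) (Seq (Call 3 [Read (Lit 0)])
     (Seq (Call 10 [Sub (Read (Lit 0)) (Lit 1), Call 6 [Lit 0, Sub (Read (Lit 0)) (Lit 1)]])
     (Let (Rd 0 (Lit 0)) (Let (Add (Var 1) (Rd 5 (Var 0))) (Let (Fld 0 (Read (Lit 0)))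
     (Seq (Write (Var 0) (Maximum (Lit 1) (Var 1)))
     (Seq (Write (Add (Var 0) (Lit 1)) (Call 11 [Read (Lit 0), Rd 2 (Var 2), Add (Var 0) (Lit 2)]))
     (Var 0))))))))))"

definition prog :: "expr list" where
  "prog = [main_body, init_body, count_body, leaf_body, half_body, merge_body, msort_body,
     relabel_body, link_body, climb_body, kruskal_body, out_body, step_body]"

lemma prog_nth:
  "prog ! 0 = main_body" "prog ! Suc 0 = init_body" "prog ! 1 = init_body" "prog ! 2 = count_body" "prog ! 3 = leaf_body"
  "prog ! 4 = half_body" "prog ! 5 = merge_body" "prog ! 6 = msort_body" "prog ! 7 = relabel_body"
  "prog ! 8 = link_body" "prog ! 9 = climb_body" "prog ! 10 = kruskal_body" "prog ! 11 = out_body"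
  "prog ! 12 = step_body"
  by (simp_all add: prog_def)

lemma wp_call_prog: "f < 13 \<Longrightarrow> wp prog \<rho> (Call f es) m Q \<longleftrightarrow>
    wps prog \<rho> es m (\<lambda>xs m1 t1. wp prog xs (prog ! f) m1 (\<lambda>x m2 t2. Q x m2 (t1 + t2 + 1)))"
  by (rule wp_Call) (simp add: prog_def)

text \<open>Lists come with a length instead of an end mark, so the link stored at the last element
  may hold anything.\<close>

fun follow :: "(nat \<Rightarrow> nat) \<Rightarrow> nat \<Rightarrow> nat \<Rightarrow> nat list" where
  "follow f a 0 = []"
| "follow f a (Suc c) = a # follow f (f a) c"

lemma length_follow [simp]: "length (follow f a c) = c"
  by (induction f a c rule: follow.induct) auto

lemma follow_cong: "(\<And>x. x \<in> set (follow f a c) \<Longrightarrow> f x = g x) \<Longrightarrow> follow g a c = follow f a c"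
  by (induction f a c rule: follow.induct) auto

definition frame :: "nat \<Rightarrow> nat set \<Rightarrow> memory \<Rightarrow> memory \<Rightarrow> bool" where
  "frame n J m m' \<longleftrightarrow> (\<forall>a. (\<forall>j\<in>J. \<forall>v. a \<noteq> fld n j v) \<longrightarrow> m' a = m a)"

lemma frame_fld: "frame n J m m' \<Longrightarrow> j < 16 \<Longrightarrow> \<forall>i\<in>J. i < 16 \<and> i \<noteq> j \<Longrightarrow> m' (fld n j v) = m (fld n j v)"
  unfolding frame_def by (metis fld_eq_iff)

lemma frame_low: "frame n J m m' \<Longrightarrow> a < 16 * n \<Longrightarrow> m' a = m a"
  unfolding frame_def by (metis fld_neq(2))

lemma frame_refl: "frame n J m m"
  unfolding frame_def by simp

lemma frame_trans: "frame n J m m' \<Longrightarrow> frame n J m' m'' \<Longrightarrow> frame n J m m''"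
  unfolding frame_def by simp

lemma frame_mono: "frame n J m m' \<Longrightarrow> J \<subseteq> J' \<Longrightarrow> frame n J' m m'"
  unfolding frame_def by blast

lemma frame_upd: "j \<in> J \<Longrightarrow> frame n J m (m'(fld n j v := x)) \<longleftrightarrow> frame n J m m'"
  unfolding frame_def by auto

section \<open>Specifications of initialization, output and sorting\<close>

context
  fixes n :: nat
  assumes n: "0 < n"
begin

lemma fld_pos [simp]: "fld n j v \<noteq> 0" "0 \<noteq> fld n j v" "fld n j v \<noteq> Suc 0" "Suc 0 \<noteq> fld n j v"
    "fld n j v \<noteq> 1" "1 \<noteq> fld n j v"
  using n unfolding fld_def by auto

lemma frame_0: "frame n J m m' \<Longrightarrow> m' 0 = m 0"
  using frame_low[of n J m m' 0] n by simp

lemma init_spec: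
  "c \<le> n \<Longrightarrow> m 0 = n \<Longrightarrow> (\<And>v. v < c \<Longrightarrow> m (Suc (Suc v)) = wv v) \<Longrightarrow>
   wp prog [c] init_body m (\<lambda>x m' t. x = (\<Sum>v<c. wv v) \<and>
     (\<forall>v<c. m' (fld n 0 v) = v \<and> m' (fld n 2 v) = v \<and> m' (fld n 3 v) = v \<and> m' (fld n 4 v) = 1) \<and>
     (\<forall>v\<ge>c. \<forall>j<16. m' (fld n j v) = m (fld n j v)) \<and>
     frame n {0, 2, 3, 4} m m' \<and> t \<le> 200 * (c + 1))"
proof (induction c arbitrary: m)
  case 0
  show ?case by (simp add: init_body_def wp_simps frame_refl)
next
  case (Suc c)
  have low: "fld n j v \<noteq> Suc (Suc u)" if "u \<le> c" for u v j
    using that Suc.prems by simp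
  show ?case
    unfolding init_body_def
    apply (simp add: wp_simps wp_call_prog prog_nth Suc.prems low low[symmetric] del: One_nat_def)
    apply (rule wp_mono[OF Suc.IH])
    subgoal using Suc.prems by simp
    subgoal using Suc.prems by simp
    subgoal using Suc.prems(3) low[symmetric] by simp
    subgoal for x m' t
      apply (elim conjE, intro conjI)
      subgoal using Suc.prems(3)[of c] by (simp add: Suc.prems(2) low low[symmetric])
      subgoal by (simp add: less_Suc_eq)
      subgoal by simp
      subgoal by (simp add: frame_def)
      subgoal by simp
      done
    done
qed

lemma half_spec: "wp prog [c] half_body m (\<lambda>x m' t. x = c div 2 \<and> m' = m \<and> t \<le> 20 * (c + 1))"
proof (induction c rule: less_induct)
  case (less c)
  show ?case
  proof (cases "c < 2")
    case True
    then show ?thesis by (simp add: half_body_def wp_simps)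
  next
    case False
    then have c: "c - 2 < c" "c div 2 = Suc ((c - 2) div 2)" by (auto simp: div_if)
    show ?thesis
      unfolding half_body_def
      apply (simp add: wp_simps wp_call_prog prog_nth False del: One_nat_def)
      apply (rule wp_mono[OF less.IH[OF c(1)]])
      using c False by auto
  qed
qed

lemma relabel_spec:
  "m 0 = n \<Longrightarrow> xs = follow (\<lambda>v. m (fld n 1 v)) v c \<Longrightarrow>
   wp prog [c, v, l] relabel_body m (\<lambda>x m' t.
     (\<forall>u. m' (fld n 0 u) = (if u \<in> set xs then l else m (fld n 0 u))) \<and> frame n {0} m m' \<and> t \<le> 100 * (c + 1))"
proof (induction c arbitrary: m v xs)
  case 0
  then show ?case by (simp add: relabel_body_def wp_simps frame_refl)
next
  case (Suc c)
  have xs: "xs = v # follow (\<lambda>v. m (fld n 1 v)) (m (fld n 1 v)) c" using Suc.prems by simp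
  show ?case
    unfolding relabel_body_def
    apply (simp add: wp_simps wp_call_prog prog_nth Suc.prems(1) del: One_nat_def)
    apply (rule wp_mono[OF Suc.IH[OF _ refl]])
    using Suc.prems(1) unfolding xs by (auto simp: frame_def)
qed

lemma count_spec:
  "c \<le> n - 1 \<Longrightarrow> m 0 = n \<Longrightarrow>
   (\<And>e. e < c \<Longrightarrow> m (arg n 0 e) = eu e \<and> m (arg n 1 e) = ev e \<and> eu e \<noteq> ev e) \<Longrightarrow>
   wp prog [c] count_body m (\<lambda>x m' t.
     (\<forall>v. m' (fld n 7 v) = m (fld n 7 v) + (\<Sum>e<c. of_bool (v = eu e) + of_bool (v = ev e))) \<and>
     (\<forall>v. m' (fld n 8 v) = m (fld n 8 v) +
       (\<Sum>e<c. (if v = eu e then ev e else 0) + (if v = ev e then eu e else 0))) \<and>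
     frame n {7, 8} m m' \<and> t \<le> 400 * (c + 1))"
proof (induction c arbitrary: m)
  case 0
  show ?case by (simp add: count_body_def wp_simps frame_refl)
next
  case (Suc c)
  obtain u v where uv: "eu c = u" "ev c = v" by blast
  have addr: "m (arg n 0 c) = u" "m (arg n 1 c) = v" and neq: "u \<noteq> v" "v \<noteq> u"
    using Suc.prems(3)[of c] uv by simp_all
  have low: "fld n j v \<noteq> arg n 0 e" "fld n j v \<noteq> arg n 1 e" if "e < c" for e v j
    using that Suc.prems(1) arg_low[of e n] by simp_all
  define R where "R m' \<longleftrightarrow>
     (\<forall>v. m' (fld n 7 v) = m (fld n 7 v) + (\<Sum>e<Suc c. of_bool (v = eu e) + of_bool (v = ev e))) \<and>
     (\<forall>v. m' (fld n 8 v) = m (fld n 8 v) +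
       (\<Sum>e<Suc c. (if v = eu e then ev e else 0) + (if v = ev e then eu e else 0))) \<and>
     frame n {7, 8} m m'" for m'
  have "wp prog [Suc c] count_body m (\<lambda>x m' t. R m' \<and> t \<le> 400 * (Suc c + 1))"
    unfolding count_body_def
    apply (simp add: wp_simps wp_call_prog prog_nth Suc.prems(2) addr neq del: One_nat_def)
    apply (rule wp_mono[OF Suc.IH])
    subgoal using Suc.prems by simp
    subgoal using Suc.prems by simp
    subgoal for e using Suc.prems(3)[of e] low[of e, symmetric] low[of e, symmetric, unfolded One_nat_def] by simp
    subgoal for x m' t
      unfolding R_def
      apply (elim conjE, intro conjI allI)
      subgoal for y by (cases "y = u"; cases "y = v") (simp_all add: uv neq Suc.prems(2) addr)
      subgoal for y by (cases "y = u"; cases "y = v") (simp_all add: uv neq Suc.prems(2) addr)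
      subgoal by (simp add: frame_def)
      subgoal by (simp add: wp_simps)
      done
    done
  then show ?case unfolding R_def conj_assoc .
qed

lemma leaf_spec:
  "c \<le> n \<Longrightarrow> m 0 = n \<Longrightarrow> (\<And>v. v < c \<Longrightarrow> m (Suc (Suc v)) = wv v) \<Longrightarrow> wp prog [c] leaf_body m (\<lambda>x m' t.
     (\<forall>v. m' (fld n 9 v) = (if v < c \<and> m (fld n 7 v) < 2 then 1 else m (fld n 9 v))) \<and>
     (\<forall>v. m' (fld n 6 v) = (if v < c \<and> m (fld n 7 v) < 2 then wv v else m (fld n 6 v))) \<and>
     frame n {6, 9} m m' \<and> t \<le> 200 * (c + 1))"
proof (induction c arbitrary: m)
  case 0
  show ?case by (simp add: leaf_body_def wp_simps frame_refl)
next
  case (Suc c)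
  have low: "fld n j v \<noteq> Suc (Suc u)" if "u \<le> c" for u v j
    using that Suc.prems by simp
  show ?case
  proof (cases "m (fld n 7 c) < 2")
    case True
    show ?thesis
      unfolding leaf_body_def
      apply (simp add: wp_simps wp_call_prog prog_nth Suc.prems(1,2) True low low[symmetric] del: One_nat_def)
      apply (rule wp_mono[OF Suc.IH])
      subgoal using Suc.prems by simp
      subgoal using Suc.prems by simp
      subgoal using Suc.prems(3) low[symmetric] by simp
      subgoal for x m' t
        using Suc.prems(3)[of c] True by (auto simp: frame_def less_Suc_eq)
      done
  next
    case False
    show ?thesis
      unfolding leaf_body_def
      apply (simp add: wp_simps wp_call_prog prog_nth Suc.prems(1,2) False del: One_nat_def)
      apply (rule wp_mono[OF Suc.IH])
      subgoal using Suc.prems by simp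
      subgoal using Suc.prems by simp
      subgoal using Suc.prems(3) by simp
      subgoal for x m' t
        using False by (auto simp: frame_def less_Suc_eq)
      done
  qed
qed

lemma out_spec:
  "m 0 = n \<Longrightarrow> 32 * n \<le> q \<Longrightarrow> xs = follow (\<lambda>v. m (fld n 1 v)) v c \<Longrightarrow> set xs \<subseteq> {..<n} \<Longrightarrow>
   ls = filter (\<lambda>v. 0 < m (fld n 9 v)) xs \<Longrightarrow>
   wp prog [c, v, q] out_body m (\<lambda>x m' t. x = length ls \<and> (\<forall>i<length ls. m' (q + i) = ls ! i) \<and>
     (\<forall>a<q. m' a = m a) \<and> t \<le> 200 * (c + 1))"
proof (induction c arbitrary: m v xs q ls)
  case 0
  then show ?case by (simp add: out_body_def wp_simps)
next
  case (Suc c)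
  let ?ys = "follow (\<lambda>v. m (fld n 1 v)) (m (fld n 1 v)) c"
  have xs: "xs = v # ?ys" using Suc.prems by simp
  have v: "v < n" "set ?ys \<subseteq> {..<n}" using Suc.prems(4) unfolding xs by auto
  have below: "fld n j u < q" if "u < n" "j < 16" for u j
    using that Suc.prems(2) unfolding fld_def by simp
  show ?case
  proof (cases "m (fld n 9 v) = 0")
    case True
    show ?thesis
      unfolding out_body_def
      apply (simp add: wp_simps wp_call_prog prog_nth Suc.prems(1) True del: One_nat_def)
      apply (rule wp_mono[OF Suc.IH[OF _ _ refl _ refl]])
      subgoal using Suc.prems by simp
      subgoal using Suc.prems by simp
      subgoal using v by simp
      subgoal for x m' t
        using True Suc.prems(5) unfolding xs by auto
      done
  next
    case False
    let ?m = "m(q := v)"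
    have q0: "0 < q" using Suc.prems(2) n by simp
    \<comment> \<open>The list and the leaf flags lie below \<open>q\<close>, so the output does not
      disturb them.\<close>
    have fol: "follow (\<lambda>v. ?m (fld n 1 v)) (m (fld n 1 v)) c = ?ys"
      by (rule follow_cong) (use v below[of _ 1] in auto)
    have fil: "filter (\<lambda>v. 0 < ?m (fld n 9 v)) ?ys = filter (\<lambda>v. 0 < m (fld n 9 v)) ?ys"
      by (rule filter_cong) (use v below[of _ 9] in auto)
    define lss where "lss = filter (\<lambda>v. 0 < m (fld n 9 v)) ?ys"
    have ls: "ls = v # lss"
      using Suc.prems(5) False unfolding xs lss_def by simp
    have nq: "fld n 1 v \<noteq> q" using below[of v 1] v by simp
    have IH: "wp prog [c, m (fld n 1 v), q + 1] out_body ?m (\<lambda>x m' t. x = length lss \<and>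
      (\<forall>i<length lss. m' (q + 1 + i) = lss ! i) \<and> (\<forall>a<q + 1. m' a = ?m a) \<and> t \<le> 200 * (c + 1))"
    proof (rule Suc.IH[OF _ _ fol[symmetric] v(2)])
      show "lss = filter (\<lambda>v. 0 < ?m (fld n 9 v)) ?ys" unfolding fil lss_def ..
    qed (use Suc.prems q0 in auto)
    show ?thesis
      unfolding out_body_def
      apply (simp add: wp_simps wp_call_prog prog_nth Suc.prems(1) False nq nq[symmetric] del: One_nat_def)
      using q0 Suc.prems(1) nq
      apply (simp add: wp_simps wp_call_prog prog_nth del: One_nat_def)
      apply (rule wp_mono[OF IH])
      subgoal for x m' t
      proof (elim conjE)
        assume x: "x = length lss" and out: "\<forall>i<length lss. m' (q + 1 + i) = lss ! i"
          and fr: "\<forall>a<q + 1. m' a = (m(q := v)) a" and t: "t \<le> 200 * (c + 1)"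
        have "m' q = v" "\<forall>a<q. m' a = m a" using fr by auto
        then show ?thesis using x out t by (auto simp: ls less_Suc_eq_0_disj)
      qed
      done
  qed
qed

text \<open>After the recursive call only the link of the chosen first edge is set. That edge is in
  neither of the remaining lists, so their merged list stays readable.\<close>

lemma merge_spec:
  "m 0 = n \<Longrightarrow> xs = follow (\<lambda>e. m (fld n 10 e)) a ca \<Longrightarrow> ys = follow (\<lambda>e. m (fld n 10 e)) b cb \<Longrightarrow>
   distinct (xs @ ys) \<Longrightarrow> (\<And>e. e \<in> set (xs @ ys) \<Longrightarrow> e < n - 1 \<and> m (arg n 2 e) = key e) \<Longrightarrow>
   sorted (map key xs) \<Longrightarrow> sorted (map key ys) \<Longrightarrow>
   wp prog [a, ca, b, cb] merge_body m (\<lambda>x m' t.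
     set (follow (\<lambda>e. m' (fld n 10 e)) x (ca + cb)) = set (xs @ ys) \<and>
     sorted (map key (follow (\<lambda>e. m' (fld n 10 e)) x (ca + cb))) \<and>
     (\<forall>e. e \<notin> set (xs @ ys) \<longrightarrow> m' (fld n 10 e) = m (fld n 10 e)) \<and> frame n {10} m m' \<and>
     t \<le> 200 * (ca + cb + 1))"
proof (induction "ca + cb" arbitrary: m a ca b cb xs ys)
  case 0
  then show ?case by (simp add: merge_body_def wp_simps frame_refl)
next
  case (Suc c)
  let ?nx = "\<lambda>e. m (fld n 10 e)"
  show ?case
  proof (cases "ca = 0 \<or> cb = 0")
    case True
    then show ?thesis using Suc.prems Suc.hyps(2) by (auto simp: merge_body_def wp_simps frame_refl)
  next
    case False
    then obtain ca' cb' where c: "ca = Suc ca'" "cb = Suc cb'" by (meson not0_implies_Suc)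
    define xs' where "xs' = follow ?nx (?nx a) ca'"
    define ys' where "ys' = follow ?nx (?nx b) cb'"
    have xs: "xs = a # xs'" and ys: "ys = b # ys'" using Suc.prems(2,3) c unfolding xs'_def ys'_def by auto
    have addr: "m (arg n 2 a) = key a" "m (arg n 2 b) = key b"
      using Suc.prems(5)[of a] Suc.prems(5)[of b] unfolding xs ys by simp_all
    show ?thesis
    proof (cases "key b < key a")
      case True
      have IH: "wp prog [a, ca, ?nx b, cb'] merge_body m (\<lambda>x m' t.
         set (follow (\<lambda>e. m' (fld n 10 e)) x (ca + cb')) = set (xs @ ys') \<and>
         sorted (map key (follow (\<lambda>e. m' (fld n 10 e)) x (ca + cb'))) \<and>
         (\<forall>e. e \<notin> set (xs @ ys') \<longrightarrow> m' (fld n 10 e) = m (fld n 10 e)) \<and> frame n {10} m m' \<and>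
         t \<le> 200 * (ca + cb' + 1))"
        by (rule Suc.hyps(1)[OF _ _ Suc.prems(2) ys'_def])
          (use Suc.prems Suc.hyps(2) in \<open>auto simp: c ys\<close>)
      show ?thesis
        unfolding merge_body_def
        apply (simp add: wp_simps wp_call_prog prog_nth Suc.prems(1) c addr True del: One_nat_def follow.simps fun_upd_apply)
        apply (rule wp_mono[OF IH[unfolded c]])
        subgoal for x m' t
        proof (elim conjE)
          assume r: "set (follow (\<lambda>e. m' (fld n 10 e)) x (Suc ca' + cb')) = set (xs @ ys')"
            "sorted (map key (follow (\<lambda>e. m' (fld n 10 e)) x (Suc ca' + cb')))"
            "\<forall>e. e \<notin> set (xs @ ys') \<longrightarrow> m' (fld n 10 e) = m (fld n 10 e)"
            and fr: "frame n {10} m m'" and t: "t \<le> 200 * (Suc ca' + cb' + 1)"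
          have b: "b \<notin> set (xs @ ys')" using Suc.prems(4) unfolding ys by auto
          let ?m = "m'(fld n 10 b := x)"
          have fol: "follow (\<lambda>e. ?m (fld n 10 e)) x (Suc ca' + cb') = follow (\<lambda>e. m' (fld n 10 e)) x (Suc ca' + cb')"
            by (rule follow_cong) (use r(1) b in auto)
          have fol': "follow (\<lambda>e. ?m (fld n 10 e)) b (Suc (Suc (ca' + cb'))) =
              b # follow (\<lambda>e. m' (fld n 10 e)) x (Suc ca' + cb')"
            using fol by simp
          have "key b \<le> key e" if "e \<in> set (xs @ ys')" for e
            using that True Suc.prems(6,7) unfolding xs ys by auto
          then have srt: "sorted (map key (follow (\<lambda>e. ?m (fld n 10 e)) b (Suc (Suc (ca' + cb')))))"
            unfolding fol' using r(1,2) by auto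
          have st: "set (follow (\<lambda>e. ?m (fld n 10 e)) b (Suc (Suc (ca' + cb')))) = set (xs @ ys)"
            unfolding fol' using r(1) unfolding ys by auto
          have "\<forall>e. e \<notin> set (xs @ ys) \<longrightarrow> ?m (fld n 10 e) = m (fld n 10 e)"
            using r(3) unfolding ys by auto
          moreover have "frame n {10} m ?m" using fr by (simp add: frame_upd)
          ultimately show ?thesis
            using srt st t frame_0[OF fr] Suc.prems(1) by (simp add: wp_simps c del: follow.simps fun_upd_apply)
        qed
        done
    next
      case False
      have IH: "wp prog [?nx a, ca', b, cb] merge_body m (\<lambda>x m' t.
         set (follow (\<lambda>e. m' (fld n 10 e)) x (ca' + cb)) = set (xs' @ ys) \<and>
         sorted (map key (follow (\<lambda>e. m' (fld n 10 e)) x (ca' + cb))) \<and>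
         (\<forall>e. e \<notin> set (xs' @ ys) \<longrightarrow> m' (fld n 10 e) = m (fld n 10 e)) \<and> frame n {10} m m' \<and>
         t \<le> 200 * (ca' + cb + 1))"
        by (rule Suc.hyps(1)[OF _ _ xs'_def Suc.prems(3)])
          (use Suc.prems Suc.hyps(2) in \<open>auto simp: c xs\<close>)
      show ?thesis
        unfolding merge_body_def
        apply (simp add: wp_simps wp_call_prog prog_nth Suc.prems(1) c addr False del: One_nat_def follow.simps fun_upd_apply)
        apply (rule wp_mono[OF IH[unfolded c]])
        subgoal for x m' t
        proof (elim conjE)
          assume r: "set (follow (\<lambda>e. m' (fld n 10 e)) x (ca' + Suc cb')) = set (xs' @ ys)"
            "sorted (map key (follow (\<lambda>e. m' (fld n 10 e)) x (ca' + Suc cb')))"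
            "\<forall>e. e \<notin> set (xs' @ ys) \<longrightarrow> m' (fld n 10 e) = m (fld n 10 e)"
            and fr: "frame n {10} m m'" and t: "t \<le> 200 * (ca' + Suc cb' + 1)"
          have a: "a \<notin> set (xs' @ ys)" using Suc.prems(4) unfolding xs by auto
          let ?m = "m'(fld n 10 a := x)"
          have fol: "follow (\<lambda>e. ?m (fld n 10 e)) x (ca' + Suc cb') = follow (\<lambda>e. m' (fld n 10 e)) x (ca' + Suc cb')"
            by (rule follow_cong) (use r(1) a in auto)
          have fol': "follow (\<lambda>e. ?m (fld n 10 e)) a (Suc (Suc (ca' + cb'))) =
              a # follow (\<lambda>e. m' (fld n 10 e)) x (ca' + Suc cb')"
            using fol by simp
          have "key a \<le> key e" if "e \<in> set (xs' @ ys)" for e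
            using that False Suc.prems(6,7) unfolding xs ys by auto
          then have srt: "sorted (map key (follow (\<lambda>e. ?m (fld n 10 e)) a (Suc (Suc (ca' + cb')))))"
            unfolding fol' using r(1,2) by auto
          have st: "set (follow (\<lambda>e. ?m (fld n 10 e)) a (Suc (Suc (ca' + cb')))) = set (xs @ ys)"
            unfolding fol' using r(1) unfolding xs by auto
          have "\<forall>e. e \<notin> set (xs @ ys) \<longrightarrow> ?m (fld n 10 e) = m (fld n 10 e)"
            using r(3) unfolding xs by auto
          moreover have "frame n {10} m ?m" using fr by (simp add: frame_upd)
          ultimately show ?thesis
            using srt st t frame_0[OF fr] Suc.prems(1) by (simp add: wp_simps c del: follow.simps fun_upd_apply)
        qed
        done
    qed
  qed
qed

text \<open>\<open>L\<close> bounds the depth of the recursion, and every level costs a constant per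
  edge. Links outside the range are kept, which preserves the sorted first half while the second is
  being sorted.\<close>

lemma msort_spec:
  "1 \<le> c \<Longrightarrow> i + c \<le> n - 1 \<Longrightarrow> c \<le> 2 ^ L \<Longrightarrow> m 0 = n \<Longrightarrow> (\<And>e. e < n - 1 \<Longrightarrow> m (arg n 2 e) = key e) \<Longrightarrow>
   wp prog [i, c] msort_body m (\<lambda>x m' t.
     set (follow (\<lambda>e. m' (fld n 10 e)) x c) = {i..<i + c} \<and>
     sorted (map key (follow (\<lambda>e. m' (fld n 10 e)) x c)) \<and>
     (\<forall>e. e \<notin> {i..<i + c} \<longrightarrow> m' (fld n 10 e) = m (fld n 10 e)) \<and> frame n {10} m m' \<and>
     t \<le> 400 * (c * (L + 1)))"
proof (induction L arbitrary: i c m)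
  case 0
  have "c = 1" using 0(1,3) by simp
  then show ?case by (simp add: msort_body_def wp_simps frame_refl)
next
  case (Suc L)
  show ?case
  proof (cases "c < 2")
    case True
    then have "c = 1" using Suc.prems(1) by simp
    then show ?thesis by (simp add: msort_body_def wp_simps frame_refl)
  next
    case False
    define h where "h = c div 2"
    have h: "1 \<le> h" "h \<le> 2 ^ L" "i + h \<le> n - 1"
      using False Suc.prems(1-3) unfolding h_def by auto
    have h': "1 \<le> c - h" "c - h \<le> 2 ^ L" "i + h + (c - h) \<le> n - 1" "h + (c - h) = c"
      using False Suc.prems(1-3) unfolding h_def by auto
    have low: "arg n 2 e < 16 * n" if "e < n - 1" for e
      using that by (simp add: arg_low)
    show ?thesis
      unfolding msort_body_def
      apply (simp add: wp_simps wp_call_prog prog_nth False del: One_nat_def)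
      apply (rule wp_mono[OF half_spec])
      subgoal for xh mh th
      proof (elim conjE)
        assume xh: "xh = c div 2" "mh = m" and th: "th \<le> 20 * (c + 1)"
        show ?thesis
          unfolding xh h_def[symmetric]
          apply (simp add: wp_simps wp_call_prog prog_nth del: One_nat_def)
          apply (rule wp_mono[OF Suc.IH[OF h(1,3,2) Suc.prems(4,5)]], assumption)
          subgoal for a m1 t1
          proof (elim conjE)
            assume A: "set (follow (\<lambda>e. m1 (fld n 10 e)) a h) = {i..<i + h}"
              "sorted (map key (follow (\<lambda>e. m1 (fld n 10 e)) a h))"
              "\<forall>e. e \<notin> {i..<i + h} \<longrightarrow> m1 (fld n 10 e) = m (fld n 10 e)"
              "frame n {10} m m1" "t1 \<le> 400 * (h * (L + 1))"
            have m1: "m1 0 = n" "\<And>e. e < n - 1 \<Longrightarrow> m1 (arg n 2 e) = key e"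
              using frame_0[OF A(4)] frame_low[OF A(4) low] Suc.prems(4,5) by auto
            show ?thesis
              apply (simp add: wp_simps wp_call_prog prog_nth del: One_nat_def)
              apply (rule wp_mono[OF Suc.IH[OF h'(1,3,2) m1]], assumption)
              subgoal for b m2 t2
              proof (elim conjE)
                let ?xs = "follow (\<lambda>e. m2 (fld n 10 e)) a h"
                let ?ys = "follow (\<lambda>e. m2 (fld n 10 e)) b (c - h)"
                assume B: "set ?ys = {i + h..<i + h + (c - h)}" "sorted (map key ?ys)"
                  "\<forall>e. e \<notin> {i + h..<i + h + (c - h)} \<longrightarrow> m2 (fld n 10 e) = m1 (fld n 10 e)"
                  "frame n {10} m1 m2" "t2 \<le> 400 * ((c - h) * (L + 1))"
                have m2: "m2 0 = n" "\<And>e. e < n - 1 \<Longrightarrow> m2 (arg n 2 e) = key e"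
                  using frame_0[OF B(4)] frame_low[OF B(4) low] m1 by auto
                have fol: "?xs = follow (\<lambda>e. m1 (fld n 10 e)) a h"
                  by (rule follow_cong) (use A(1) B(3) in auto)
                have xs: "set ?xs = {i..<i + h}" "sorted (map key ?xs)" using A(1,2) unfolding fol by auto
                \<comment> \<open>Distinctness is not part of the specification; it follows because
                  a list has as many entries as its set has elements.\<close>
                have "card (set ?xs) = length ?xs" "card (set ?ys) = length ?ys" unfolding xs(1) B(1) by simp_all
                then have "distinct ?xs" "distinct ?ys" by (auto intro: card_distinct)
                then have dist: "distinct (?xs @ ?ys)" using xs(1) B(1) by auto
                have sub: "set (?xs @ ?ys) = {i..<i + c}" using xs(1) B(1) h'(4) by auto
                have key: "e < n - 1 \<and> m2 (arg n 2 e) = key e" if "e \<in> set (?xs @ ?ys)" for e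
                  using that m2(2) Suc.prems(2) unfolding sub by auto
                have time: "h * (L + 1) + (c - h) * (L + 1) = c * (L + 1)"
                  using h'(4) by (metis add_mult_distrib)
                show ?thesis
                  apply (simp add: wp_simps wp_call_prog prog_nth del: One_nat_def)
                  apply (rule wp_mono[OF merge_spec[OF m2(1) refl refl dist key xs(2) B(2)]], assumption)
                  unfolding sub h'(4)
                  using A(3,4,5) B(3,4,5) th time False frame_trans[OF frame_trans[OF A(4) B(4)]] h'(4)
                  by (auto simp: algebra_simps)
              qed
              done
          qed
          done
      qed
      done
  qed
qed

end

section \<open>Concatenating and relabelling component lists\<close>

lemma take_follow: "take c (follow f a (c + d)) = follow f a c"
  by (induction f a c rule: follow.induct) auto

text \<open>By distinctness, the traversal uses the redirected link only at the end of
  \<open>xs\<close>.\<close>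

lemma follow_link:
  assumes xs: "follow f a c = xs" and ys: "follow f b d = ys" and dist: "distinct (xs @ ys)" "xs \<noteq> []"
    and g: "g (last xs) = b" "\<And>x. x \<noteq> last xs \<Longrightarrow> g x = f x"
  shows "follow g a (c + d) = xs @ ys"
proof -
  have "follow g a (c + d) = xs @ ys" if "follow f a c = xs" "distinct (xs @ ys)" "xs \<noteq> []"
    "g (last xs) = b" "\<And>x. x \<noteq> last xs \<Longrightarrow> g x = f x" for c xs a
    using that
  proof (induction c arbitrary: a xs)
    case (Suc c)
    show ?case
    proof (cases c)
      case 0
      then have x: "xs = [a]" using Suc.prems by simp
      have "g y = f y" if "y \<in> set ys" for y
      proof -
        have "y \<noteq> last xs" using Suc.prems(2) x that by auto
        then show ?thesis by (rule Suc.prems(5))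
      qed
      then have "follow g b d = follow f b d"
        using ys by (intro follow_cong) simp
      then show ?thesis using x 0 Suc.prems ys by simp
    next
      case (Suc c')
      define xs' where "xs' = follow f (f a) c"
      have x: "xs = a # xs'" "xs' \<noteq> []" using Suc.prems Suc unfolding xs'_def by auto
      then have la: "last xs = last xs'" by simp
      have "a \<notin> set xs'" using Suc.prems(2) x(1) by simp
      then have "a \<noteq> last xs" using la x(2) last_in_set by metis
      then have "g a = f a" using Suc.prems(5) by blast
      moreover have "follow g (f a) (c + d) = xs' @ ys"
        by (rule Suc.IH[OF xs'_def[symmetric]]) (use Suc.prems x la in auto)
      ultimately show ?thesis using x by simp
    qed
  qed simp
  then show ?thesis using assms by blast
qed

text \<open>Which of the labels \<open>p\<close> and \<open>q\<close> survives is left open: it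
  depends on the lengths of the lists, whereas the new list is \<open>lp @ lq\<close> in any
  case.\<close>

definition linked ::
    "nat \<Rightarrow> nat \<Rightarrow> nat \<Rightarrow> nat \<Rightarrow> nat list \<Rightarrow> nat list \<Rightarrow> memory \<Rightarrow> memory \<Rightarrow> bool" where
  "linked n p q f lp lq m m' \<longleftrightarrow> (\<exists>l\<in>{p, q}.
    follow (\<lambda>v. m' (fld n 1 v)) (m' (fld n 2 l)) (m' (fld n 4 l)) = lp @ lq \<and>
    m' (fld n 3 l) = last lq \<and> m' (fld n 5 l) = f \<and>
    m' (fld n 6 l) = m (fld n 6 p) + m (fld n 6 q) \<and>
    (\<forall>u. m' (fld n 0 u) = (if u \<in> set (lp @ lq) then l else m (fld n 0 u))) \<and>
    (\<forall>v. v \<noteq> last lp \<longrightarrow> m' (fld n 1 v) = m (fld n 1 v)) \<and>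
    (\<forall>l'. l' \<notin> {p, q} \<longrightarrow> (\<forall>j\<in>{2, 3, 4, 5, 6}. m' (fld n j l') = m (fld n j l'))) \<and>
    frame n {0, 1, 2, 3, 4, 5, 6} m m')"

context
  fixes n :: nat
  assumes n: "0 < n"
begin

lemma link_spec:
  assumes m: "m 0 = n"
    and lp: "follow (\<lambda>v. m (fld n 1 v)) (m (fld n 2 p)) (m (fld n 4 p)) = lp" "lp \<noteq> []"
    and lq: "follow (\<lambda>v. m (fld n 1 v)) (m (fld n 2 q)) (m (fld n 4 q)) = lq" "lq \<noteq> []"
    and dist: "distinct (lp @ lq)"
    and last: "m (fld n 3 p) = last lp" "m (fld n 3 q) = last lq"
    and lab: "\<And>u. u \<in> set lp \<Longrightarrow> m (fld n 0 u) = p" "\<And>u. u \<in> set lq \<Longrightarrow> m (fld n 0 u) = q"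
  shows "wp prog [p, q, f] link_body m (\<lambda>x m' t. linked n p q f lp lq m m' \<and>
    t \<le> 1000 + 100 * min (length lp) (length lq))"
proof -
  define m1 where "m1 = m(fld n 1 (last lp) := m (fld n 2 q))"
  have m1: "m1 0 = n" unfolding m1_def using m n by simp
  have m1_fld: "m1 (fld n j v) = m (fld n j v)" if "j < 16" "j \<noteq> 1" for j v
    unfolding m1_def using that by simp
  have len: "m (fld n 4 p) = length lp" "m (fld n 4 q) = length lq"
    using lp(1) lq(1) by (metis length_follow)+
  have fol: "follow (\<lambda>v. m1 (fld n 1 v)) (m (fld n 2 p)) (m (fld n 4 p) + m (fld n 4 q)) = lp @ lq"
    by (rule follow_link[OF lp(1) lq(1) dist lp(2)]) (auto simp: m1_def)
  \<comment> \<open>Relabelling happens when the lists are already linked; the stored lengths still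
    delimit both parts.\<close>
  have folp: "follow (\<lambda>v. m1 (fld n 1 v)) (m (fld n 2 p)) (m (fld n 4 p)) = lp"
  proof -
    have "take (m (fld n 4 p)) (lp @ lq) = lp" using len by simp
    then show ?thesis using take_follow fol by metis
  qed
  have folq: "follow (\<lambda>v. m1 (fld n 1 v)) (m (fld n 2 q)) (m (fld n 4 q)) = lq"
  proof -
    have "u \<noteq> last lp" if "u \<in> set lq" for u
      using that dist lp(2) by (metis disjoint_iff distinct_append last_in_set)
    then have "follow (\<lambda>v. m1 (fld n 1 v)) (m (fld n 2 q)) (m (fld n 4 q)) =
        follow (\<lambda>v. m (fld n 1 v)) (m (fld n 2 q)) (m (fld n 4 q))"
      by (intro follow_cong) (simp add: lq(1)[unfolded One_nat_def] m1_def)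
    then show ?thesis using lq(1) by simp
  qed
  note sim = wp_simps wp_call_prog prog_nth absorb_def m last
  show ?thesis
  proof (cases "m (fld n 4 p) < m (fld n 4 q)")
    case True
    show ?thesis
      unfolding link_body_def
      apply (simp add: sim True n m1_def[symmetric] m1_fld m1 del: One_nat_def fun_upd_apply)
      apply (rule wp_mono[OF relabel_spec[OF n m1 folp[symmetric]]])
      subgoal for x m' t
      proof (elim conjE)
        assume A: "\<forall>u. m' (fld n 0 u) = (if u \<in> set lp then q else m1 (fld n 0 u))"
          "frame n {0} m1 m'" "t \<le> 100 * (m (fld n 4 p) + 1)"
        have m': "m' 0 = n" using frame_0[OF n A(2)] m1 by simp
        have fld: "m' (fld n j v) = m1 (fld n j v)" if "j < 16" "j \<noteq> 0" for j v
          using frame_fld[OF A(2)] that by simp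
        have fr: "frame n {0, 1, 2, 3, 4, 5, 6} m m'"
          using frame_mono[OF A(2), of "{0, 1, 2, 3, 4, 5, 6}"] unfolding m1_def frame_def by auto
        define M where "M = m'(fld n 2 q := m (fld n 2 p),
          fld n 4 q := m (fld n 4 q) + m (fld n 4 p),
          fld n 6 q := m (fld n 6 q) + m (fld n 6 p), fld n 5 q := f)"
        have M1: "M (fld n 1 v) = m1 (fld n 1 v)" for v unfolding M_def by (simp add: fld)
        have M234: "M (fld n 2 q) = m (fld n 2 p)" "M (fld n 3 q) = last lq"
          "M (fld n 4 q) = m (fld n 4 p) + m (fld n 4 q)"
          unfolding M_def by (simp_all add: fld m1_fld last)
        have "linked n p q f lp lq m M"
          unfolding linked_def
        proof (intro bexI[of _ q] conjI allI impI ballI)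
          show "follow (\<lambda>v. M (fld n 1 v)) (M (fld n 2 q)) (M (fld n 4 q)) = lp @ lq"
            unfolding M1 M234 by (rule fol)
          show "M (fld n 0 u) = (if u \<in> set (lp @ lq) then q else m (fld n 0 u))" for u
            using A(1) lab unfolding M_def by (simp add: m1_fld)
          show "M (fld n 1 v) = m (fld n 1 v)" if "v \<noteq> last lp" for v
            unfolding M1 unfolding m1_def using that by simp
          show "M (fld n j l') = m (fld n j l')" if "l' \<notin> {p, q}" "j \<in> {2, 3, 4, 5, 6}" for l' j
            using that unfolding M_def by (auto simp: fld m1_fld)
          show "frame n {0, 1, 2, 3, 4, 5, 6} m M" unfolding M_def by (simp add: frame_upd fr[simplified])
        qed (simp_all add: M234, simp_all add: M_def fld m1_fld)
        moreover have "t \<le> 100 + 100 * min (length lp) (length lq)"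
          using A(3) True len by simp
        ultimately show ?thesis
          by (simp add: wp_simps m' n fld m1_fld last M_def[symmetric] del: One_nat_def)
      qed
      done
  next
    case False
    show ?thesis
      unfolding link_body_def
      apply (simp add: sim False n m1_def[symmetric] m1_fld m1 del: One_nat_def fun_upd_apply)
      apply (rule wp_mono[OF relabel_spec[OF n m1 folq[symmetric]]])
      subgoal for x m' t
      proof (elim conjE)
        assume A: "\<forall>u. m' (fld n 0 u) = (if u \<in> set lq then p else m1 (fld n 0 u))"
          "frame n {0} m1 m'" "t \<le> 100 * (m (fld n 4 q) + 1)"
        have m': "m' 0 = n" using frame_0[OF n A(2)] m1 by simp
        have fld: "m' (fld n j v) = m1 (fld n j v)" if "j < 16" "j \<noteq> 0" for j v
          using frame_fld[OF A(2)] that by simp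
        have fr: "frame n {0, 1, 2, 3, 4, 5, 6} m m'"
          using frame_mono[OF A(2), of "{0, 1, 2, 3, 4, 5, 6}"] unfolding m1_def frame_def by auto
        define M where "M = m'(fld n 3 p := last lq,
          fld n 4 p := m (fld n 4 p) + m (fld n 4 q),
          fld n 6 p := m (fld n 6 p) + m (fld n 6 q), fld n 5 p := f)"
        have M1: "M (fld n 1 v) = m1 (fld n 1 v)" for v unfolding M_def by (simp add: fld)
        have M234: "M (fld n 2 p) = m (fld n 2 p)" "M (fld n 3 p) = last lq"
          "M (fld n 4 p) = m (fld n 4 p) + m (fld n 4 q)"
          unfolding M_def by (simp_all add: fld m1_fld last)
        have "linked n p q f lp lq m M"
          unfolding linked_def
        proof (intro bexI[of _ p] conjI allI impI ballI)
          show "follow (\<lambda>v. M (fld n 1 v)) (M (fld n 2 p)) (M (fld n 4 p)) = lp @ lq"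
            unfolding M1 M234 by (rule fol)
          show "M (fld n 0 u) = (if u \<in> set (lp @ lq) then p else m (fld n 0 u))" for u
            using A(1) lab unfolding M_def by (simp add: m1_fld)
          show "M (fld n 1 v) = m (fld n 1 v)" if "v \<noteq> last lp" for v
            unfolding M1 unfolding m1_def using that by simp
          show "M (fld n j l') = m (fld n j l')" if "l' \<notin> {p, q}" "j \<in> {2, 3, 4, 5, 6}" for l' j
            using that unfolding M_def by (auto simp: fld m1_fld)
          show "frame n {0, 1, 2, 3, 4, 5, 6} m M" unfolding M_def by (simp add: frame_upd fr[simplified])
        qed (simp_all add: M234, simp_all add: M_def fld m1_fld)
        moreover have "t \<le> 100 + 100 * min (length lp) (length lq)"
          using A(3) False len by simp
        ultimately show ?thesis
          by (simp add: wp_simps m' n fld m1_fld last M_def[symmetric] del: One_nat_def)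
      qed
      done
  qed
qed

end

text \<open>\<open>ch e\<close> is the lower end of edge number \<open>e\<close>. It occurs in the
  proof only; the program sees the ends \<open>eu e\<close> and \<open>ev e\<close> in the order in
  which the input gives them.\<close>

locale run = weighted_rooted_tree "{..<n}" s par w vw
  for n :: nat and s :: nat and par :: "nat \<Rightarrow> nat" and w :: "nat set \<Rightarrow> nat" and vw :: "nat \<Rightarrow> nat" +
  fixes eu ev wt ch :: "nat \<Rightarrow> nat"
  assumes ch_bij: "bij_betw ch {..<n - 1} ({..<n} - {s})"
    and ends: "e < n - 1 \<Longrightarrow> eu e = ch e \<and> ev e = par (ch e) \<or> eu e = par (ch e) \<and> ev e = ch e"
    and wt: "e < n - 1 \<Longrightarrow> w {ch e, par (ch e)} = max 1 (wt e)"
begin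

lemma n: "0 < n"
  using root_in_V by auto

abbreviation "V \<equiv> {..<n}"

section \<open>Meaning of the memory, and the peeling of completed subtrees\<close>

definition inp :: "memory \<Rightarrow> bool" where
  "inp m \<longleftrightarrow> m 0 = n \<and> m 1 = s \<and> (\<forall>v<n. m (Suc (Suc v)) = vw v) \<and>
     (\<forall>e<n - 1. m (arg n 0 e) = eu e \<and> m (arg n 1 e) = ev e \<and> m (arg n 2 e) = wt e)"

text \<open>The vertices that should be peeled off once the edges \<open>K\<close> are merged:
  everything below them and the edge above them is in \<open>K\<close>.\<close>

definition acc :: "nat set \<Rightarrow> nat set" where
  "acc K = K \<inter> fin K"

text \<open>\<open>J\<close> is the set of vertices peeled off so far. If all children of a vertex
  other than the start are in \<open>J\<close>, field 8 is exactly its parent. The 2 for the start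
  keeps its counter from ever looking like that of a vertex with one neighbour.\<close>

definition peel :: "nat set \<Rightarrow> memory \<Rightarrow> bool" where
  "peel J m \<longleftrightarrow> (\<forall>v<n. m (fld n 7 v) = (if v = s then 2 else 1) + card (chld v - J)) \<and>
     (\<forall>v<n. v \<noteq> s \<longrightarrow> m (fld n 8 v) = par v + \<Sum>(chld v - J))"

definition labels :: "nat set \<Rightarrow> memory \<Rightarrow> bool" where
  "labels K m \<longleftrightarrow> (\<forall>t\<in>V - K. \<forall>u\<in>cls K t. m (fld n 0 u) = m (fld n 0 t)) \<and>
     inj_on (\<lambda>t. m (fld n 0 t)) (V - K)"

text \<open>\<open>J\<close> is independent of \<open>K\<close> because a new edge enters
  \<open>K\<close> at once, while the vertices above it are peeled off one by one.\<close>

definition collected :: "nat set \<Rightarrow> nat set \<Rightarrow> memory \<Rightarrow> bool" where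
  "collected K J m \<longleftrightarrow> (\<forall>t\<in>V - K. m (fld n 6 (m (fld n 0 t))) =
     sum vw {u \<in> cls K t. u \<noteq> s \<and> chld u \<subseteq> J})"

lemma inp_frame: "inp m \<Longrightarrow> frame n J m m' \<Longrightarrow> inp m'"
  unfolding inp_def using frame_low[of n J m m'] n arg_low[of _ n] by auto

lemma labels_eq_iff:
  assumes "K \<subseteq> V - {s}" "labels K m" "t \<in> V - K" "t' \<in> V - K" "u \<in> cls K t" "u' \<in> cls K t'"
  shows "m (fld n 0 u) = m (fld n 0 u') \<longleftrightarrow> t = t'"
  using assms unfolding labels_def inj_on_def by metis

lemma acc_iff:
  assumes "K \<subseteq> V - {s}" "u \<in> V - {s}"
  shows "u \<in> acc K \<longleftrightarrow> u \<in> K \<and> chld u \<subseteq> acc K"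
  using fin_iff[of u K] assms unfolding acc_def by blast

lemma acc_unique:
  "K \<subseteq> V - {s} \<Longrightarrow> J \<subseteq> V - {s} \<Longrightarrow> (\<And>u. u \<in> V - {s} \<Longrightarrow> u \<in> J \<longleftrightarrow> u \<in> K \<and> chld u \<subseteq> J) \<Longrightarrow> J = acc K"
  unfolding acc_def by (rule fin_unique)

lemma finite_chld: "finite (chld v)"
  unfolding chld_def by simp

lemma peel_insert:
  assumes peel: "peel J m" and x: "x \<in> V - {s}" "x \<notin> J"
  shows "peel (insert x J) (m(fld n 7 (par x) := m (fld n 7 (par x)) - 1, fld n 8 (par x) := m (fld n 8 (par x)) - x))"
proof -
  have eq: "chld v - insert x J = chld v - J" if "v \<noteq> par x" for v
    using that unfolding chld_def by auto
  have px: "x \<in> chld (par x) - J" using x unfolding chld_def by simp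
  have fin: "finite (chld (par x) - J)" using finite_chld by simp
  have "chld (par x) - insert x J = (chld (par x) - J) - {x}" by blast
  then have c: "card (chld (par x) - J) = Suc (card (chld (par x) - insert x J))"
    and s: "\<Sum>(chld (par x) - J) = x + \<Sum>(chld (par x) - insert x J)"
    using card.remove[OF fin px] sum.remove[OF fin px, of "\<lambda>x. x"] by simp_all
  show ?thesis
    using peel unfolding peel_def by (auto simp: eq c s)
qed

text \<open>The set \<open>J\<close> satisfies the equation that characterizes \<open>acc K\<close>
  everywhere except at \<open>x\<close>. Adding \<open>x\<close> moves the defect to the parent or
  removes it, and then \<open>acc_unique\<close> identifies \<open>J\<close>. Each call adds one
  vertex to \<open>J\<close>, so the cost is charged to the growth of \<open>card J\<close>.\<close>

lemma climb_spec:
  assumes K: "K \<subseteq> V - {s}"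
  shows "inp m \<Longrightarrow> labels K m \<Longrightarrow> peel J m \<Longrightarrow> collected K J m \<Longrightarrow> J \<subseteq> V - {s} \<Longrightarrow> x \<in> K \<Longrightarrow> x \<notin> J \<Longrightarrow>
    chld x \<subseteq> J \<Longrightarrow> (\<And>u. u \<in> V - {s} \<Longrightarrow> u \<noteq> x \<Longrightarrow> u \<in> J \<longleftrightarrow> u \<in> K \<and> chld u \<subseteq> J) \<Longrightarrow>
    wp prog [x] climb_body m (\<lambda>y m' t. peel (acc K) m' \<and> collected K (acc K) m' \<and>
      frame n {6, 7, 8} m m' \<and> t + 500 * card J \<le> 500 * card (acc K))"
proof (induction x arbitrary: m J rule: wf_induct_rule[OF wf_up_converse])
  case (1 x)
  note prems = "1.prems"
  define p where "p = par x"
  define J' where "J' = insert x J"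
  define m1 where "m1 = m(fld n 7 p := m (fld n 7 p) - 1, fld n 8 p := m (fld n 8 p) - x)"
  have xV: "x \<in> V - {s}" using prems(6) K by blast
  have pV: "p \<in> V" unfolding p_def using par_in_V xV by blast
  have m0: "m 0 = n" using prems(1) unfolding inp_def by simp
  have p: "m (fld n 8 x) = p"
  proof -
    have "chld x - J = {}" using prems(8) by blast
    moreover have "m (fld n 8 x) = par x + \<Sum>(chld x - J)"
      using prems(3) xV unfolding peel_def by simp
    ultimately show ?thesis unfolding p_def by (simp only: sum.empty)
  qed
  have peel1: "peel J' m1"
    unfolding J'_def m1_def p_def using peel_insert[OF prems(3) xV prems(7)] .
  have m1_0: "m1 0 = n" unfolding m1_def using m0 n by simp
  have inp1: "inp m1" unfolding m1_def
    by (rule inp_frame[OF prems(1), of "{7, 8}"]) (simp add: frame_upd frame_refl)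
  have m1_fld: "m1 (fld n j v) = m (fld n j v)" if "j < 16" "j \<noteq> 7" "j \<noteq> 8" for j v
    unfolding m1_def using that by simp
  have fr1: "frame n {6, 7, 8} m m1" unfolding m1_def by (simp add: frame_upd frame_refl)
  have m1_7: "m1 (fld n 7 p) = m (fld n 7 p) - 1" unfolding m1_def by simp
  have xp: "x \<in> chld p" unfolding p_def chld_def using xV by simp
  have deg: "m1 (fld n 7 p) < 2 \<longleftrightarrow> p \<noteq> s \<and> chld p \<subseteq> J'"
    using peel1 pV finite_chld unfolding peel_def by auto
  have J'V: "J' \<subseteq> V - {s}" using prems(5) xV unfolding J'_def by blast
  have card: "card J' = Suc (card J)"
    unfolding J'_def using prems(5,7) by (simp add: finite_subset[of J "V - {s}"])
  have other: "chld u \<subseteq> J' \<longleftrightarrow> chld u \<subseteq> J" if "u \<noteq> p" for u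
    using that unfolding J'_def chld_def p_def by auto
  have sat: "u \<in> J' \<longleftrightarrow> u \<in> K \<and> chld u \<subseteq> J'" if "u \<in> V - {s}" "u \<noteq> p" for u
    using prems(9)[OF that(1)] prems(6,8) other[OF that(2)] unfolding J'_def by auto
  have pJ': "p \<notin> J'" if "p \<noteq> s"
  proof -
    have "p \<noteq> x" unfolding p_def using par_neq xV by blast
    moreover have "p \<notin> J" using prems(9)[of p] pV that xp prems(7) calculation by blast
    ultimately show ?thesis unfolding J'_def by blast
  qed
  \<comment> \<open>If the climb ends at \<open>p\<close>, the equation holds at \<open>p\<close> as
    well.\<close>
  have fixed: "J' = acc K" if "\<not> (p \<noteq> s \<and> p \<in> K \<and> chld p \<subseteq> J')"
  proof (rule acc_unique[OF K J'V])
    fix u assume u: "u \<in> V - {s}"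
    show "u \<in> J' \<longleftrightarrow> u \<in> K \<and> chld u \<subseteq> J'"
      using sat[OF u] u that pJ' by (cases "u = p") auto
  qed
  show ?case
  proof (cases "m1 (fld n 7 p) < 2")
    case False
    have "collected K J' m1"
      unfolding collected_def
    proof
      fix t assume t: "t \<in> V - K"
      have "chld u \<subseteq> J' \<longleftrightarrow> chld u \<subseteq> J" if "u \<noteq> s" for u
        using other[of u] False deg xp prems(7) that by (cases "u = p") blast+
      then have "{u \<in> cls K t. u \<noteq> s \<and> chld u \<subseteq> J'} = {u \<in> cls K t. u \<noteq> s \<and> chld u \<subseteq> J}"
        by (intro Collect_cong) blast
      then show "m1 (fld n 6 (m1 (fld n 0 t))) = sum vw {u \<in> cls K t. u \<noteq> s \<and> chld u \<subseteq> J'}"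
        using prems(4) t unfolding collected_def by (simp add: m1_fld)
    qed
    moreover have "J' = acc K" using fixed False deg by blast
    ultimately have post: "peel (acc K) m1 \<and> collected K (acc K) m1 \<and> frame n {6, 7, 8} m m1 \<and>
        t + 500 * card J \<le> 500 * card (acc K)" if "t \<le> 500" for t
      using peel1 fr1 card that by simp
    show ?thesis
      unfolding climb_body_def
      apply (simp add: wp_simps m0 p n m1_def[symmetric] m1_0 False False[unfolded m1_7]
          False[unfolded m1_7 One_nat_def] del: One_nat_def)
      apply (rule post)
      apply simp
      done
  next
    case True
    define l where "l = m (fld n 0 p)"
    define m2 where "m2 = m1(fld n 6 l := m1 (fld n 6 l) + vw p)"
    have ps: "p \<noteq> s" "chld p \<subseteq> J'" using True deg by blast+
    have m2_0: "m2 0 = n" unfolding m2_def using m1_0 n by simp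
    have inp2: "inp m2" unfolding m2_def
      by (rule inp_frame[OF inp1, of "{6}"]) (simp add: frame_upd frame_refl)
    have peel2: "peel J' m2" using peel1 unfolding peel_def m2_def by simp
    have fr2: "frame n {6, 7, 8} m m2" unfolding m2_def using fr1 by (simp add: frame_upd)
    have m2_fld: "m2 (fld n 0 v) = m (fld n 0 v)" for v
      unfolding m2_def by (simp add: m1_fld)
    have lab2: "labels K m2" using prems(2) unfolding labels_def m2_fld .
    obtain tp where tp: "tp \<in> V - K" "p \<in> cls K tp" using cls_exists[OF K pV] by blast
    have l: "l = m (fld n 0 tp)" unfolding l_def using prems(2) tp unfolding labels_def by blast
    have col2: "collected K J' m2"
      unfolding collected_def
    proof
      fix t assume t: "t \<in> V - K"
      let ?X = "\<lambda>J. {u \<in> cls K t. u \<noteq> s \<and> chld u \<subseteq> J}"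
      show "m2 (fld n 6 (m2 (fld n 0 t))) = sum vw (?X J')"
      proof (cases "t = tp")
        case True
        \<comment> \<open>\<open>x\<close> was the last child of \<open>p\<close> that was missing,
          and no other vertex has \<open>x\<close> as a child.\<close>
        have X: "?X J' = insert p (?X J)"
        proof (intro set_eqI)
          fix u
          show "u \<in> ?X J' \<longleftrightarrow> u \<in> insert p (?X J)"
            using other[of u] ps tp True by (cases "u = p") simp_all
        qed
        have np: "p \<notin> ?X J" using xp prems(7) by blast
        have "finite (?X J)" using cls_sub_V[OF K, of t] t by (auto intro: finite_subset)
        then have "sum vw (?X J') = vw p + sum vw (?X J)" unfolding X using np by simp
        moreover have "m2 (fld n 6 (m2 (fld n 0 t))) = m (fld n 6 (m (fld n 0 t))) + vw p"
          unfolding m2_fld using l True unfolding m2_def by (simp add: m1_fld)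
        ultimately show ?thesis using prems(4) t unfolding collected_def by simp
      next
        case False
        then have "p \<notin> cls K t" using cls_unique tp t by blast
        then have "u \<noteq> p" if "u \<in> cls K t" for u using that by blast
        then have X: "?X J' = ?X J" using other by (intro Collect_cong) blast
        have "m (fld n 0 t) \<noteq> l" using False l prems(2) t tp(1) unfolding labels_def inj_on_def by blast
        then have "m2 (fld n 6 (m2 (fld n 0 t))) = m (fld n 6 (m (fld n 0 t)))"
          unfolding m2_fld unfolding m2_def by (simp add: m1_fld)
        then show ?thesis using prems(4) t X unfolding collected_def by simp
      qed
    qed
    have q: "m2 (fld n 8 p) = par p"
    proof -
      have "chld p - J' = {}" using ps by blast
      moreover have "m2 (fld n 8 p) = par p + \<Sum>(chld p - J')"
        using peel2 pV ps(1) unfolding peel_def by simp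
      ultimately show ?thesis by (simp only: sum.empty)
    qed
    have ppV: "par p \<in> V" using par_in_V pV ps(1) by blast
    have q1: "m1 (fld n 8 p) = par p" using q unfolding m2_def by simp
    \<comment> \<open>The program cannot see \<open>K\<close>, but an edge is merged exactly if its
      two ends have the same label.\<close>
    have same: "m (fld n 0 (par p)) = l \<longleftrightarrow> p \<in> K"
    proof -
      obtain t' where t': "t' \<in> V - K" "par p \<in> cls K t'" using cls_exists[OF K ppV] by blast
      have "tp = t' \<longleftrightarrow> p \<in> K"
      proof
        assume "p \<in> K"
        then have "p \<in> cls K t'" using cls_par t'(2) by blast
        then show "tp = t'" using cls_unique tp t'(1) by blast
      next
        assume "tp = t'"
        show "p \<in> K"
        proof (rule ccontr)
          assume "p \<notin> K"
          then have "p = tp" using cls_step tp(2) by blast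
          then show False using t' \<open>tp = t'\<close> par_notin_cls[OF K, of p] pV ps(1) by blast
        qed
      qed
      moreover have "l = m (fld n 0 (par p)) \<longleftrightarrow> tp = t'"
        unfolding l_def using labels_eq_iff[OF K prems(2) tp(1) t'(1) tp(2) t'(2)] .
      ultimately show ?thesis by metis
    qed
    have lq1: "m1 (fld n 0 (par p)) = m (fld n 0 (par p))" by (simp add: m1_fld)
    have vwp: "m1 (Suc (Suc p)) = vw p" using inp1 pV unfolding inp_def by simp
    have lp1: "m1 (fld n 0 p) = l" unfolding l_def by (simp add: m1_fld)
    note sim1 = wp_simps m0 p n m1_def[symmetric] m1_0 True True[unfolded m1_7]
      True[unfolded m1_7 One_nat_def] vwp lp1
    note sim2 = wp_simps m1_0 n vwp lp1 m2_def[symmetric] m2_0 q1 lq1 wp_call_prog prog_nth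
    \<comment> \<open>Execution is separated from the postcondition; 400 covers the cost of the body
      without the recursive call.\<close>
    have run: "wp prog [x] climb_body m Q" if "p \<in> K \<Longrightarrow> wp prog [p] climb_body m2 (\<lambda>y m' t. \<forall>t'\<le>t+400. Q y m' t')"
      "p \<notin> K \<Longrightarrow> \<forall>t'\<le>400. Q 0 m2 t'" for Q
    proof (cases "p \<in> K")
      case pK: True
      then have eq: "m (fld n 0 (par p)) = l" using same by simp
      show ?thesis
        unfolding climb_body_def
        apply (simp add: sim1 del: One_nat_def)
        apply (simp add: sim2 eq del: One_nat_def)
        apply (rule wp_mono[OF that(1)[OF pK]])
        apply simp
        done
    next
      case pK: False
      then consider "m (fld n 0 (par p)) < l" | "l < m (fld n 0 (par p))" using same by linarith
      then show ?thesis
      proof cases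
        case cmp: 1
        show ?thesis
          unfolding climb_body_def
          apply (simp add: sim1 del: One_nat_def)
          apply (simp add: sim2 cmp[unfolded not_le[symmetric]] del: One_nat_def)
          apply ((rule impI)?, rule that(2)[OF pK, rule_format])
          apply simp
          done
      next
        case cmp: 2
        show ?thesis
          unfolding climb_body_def
          apply (simp add: sim1 del: One_nat_def)
          apply (simp add: sim2 cmp[unfolded not_le[symmetric]] del: One_nat_def)
          apply ((rule impI)?, rule that(2)[OF pK, rule_format])
          apply simp
          done
      qed
    qed
    show ?thesis
    proof (rule run)
      assume pK: "p \<in> K"
      have "(x, p) \<in> up" unfolding p_def up_iff using xV by blast
      then have IH: "wp prog [p] climb_body m2 (\<lambda>y m' t. peel (acc K) m' \<and> collected K (acc K) m' \<and>
          frame n {6, 7, 8} m2 m' \<and> t + 500 * card J' \<le> 500 * card (acc K))"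
        by (intro "1.IH"[OF _ inp2 lab2 peel2 col2 J'V pK pJ'[OF ps(1)] ps(2) sat]) auto
      show "wp prog [p] climb_body m2 (\<lambda>y m' t. \<forall>t'\<le>t+400. peel (acc K) m' \<and> collected K (acc K) m' \<and>
          frame n {6, 7, 8} m m' \<and> t' + 500 * card J \<le> 500 * card (acc K))"
        by (rule wp_mono[OF IH]) (use card frame_trans[OF fr2] in auto)
    next
      assume pK: "p \<notin> K"
      then have "J' = acc K" using fixed by blast
      then show "\<forall>t'\<le>400. peel (acc K) m2 \<and> collected K (acc K) m2 \<and>
          frame n {6, 7, 8} m m2 \<and> t' + 500 * card J \<le> 500 * card (acc K)"
        using peel2 col2 fr2 card by auto
    qed
  qed
qed

end

section \<open>Kruskal invariant\<close>

text \<open>For an element of the smaller part the size of its component at least doubles, so the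
  logarithm grows by at least 1.\<close>

lemma floor_log_merge:
  assumes "1 \<le> a" "1 \<le> b"
  shows "a * floor_log a + b * floor_log b + min a b \<le> (a + b) * floor_log (a + b)"
proof -
  have *: "a * floor_log a + b * floor_log b + a \<le> (a + b) * floor_log (a + b)"
    if "1 \<le> a" "a \<le> b" for a b :: nat
  proof -
    have "Suc (floor_log a) = floor_log (2 * a)" using that by simp
    also have "\<dots> \<le> floor_log (a + b)" using that by (intro floor_log_le_iff) simp
    finally have "a * Suc (floor_log a) \<le> a * floor_log (a + b)" by (rule mult_le_mono2)
    moreover have "b * floor_log b \<le> b * floor_log (a + b)"
      by (intro mult_le_mono2 floor_log_le_iff) simp
    ultimately show ?thesis unfolding add_mult_distrib mult_Suc_right by linarith
  qed
  show ?thesis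
    using *[of a b] *[of b a] assms by (cases "a \<le> b") (auto simp: min_def add.commute add.left_commute)
qed

context run
begin

section \<open>The invariant between two mergings and the potential\<close>

definition lists :: "nat set \<Rightarrow> memory \<Rightarrow> bool" where
  "lists K m \<longleftrightarrow> (\<forall>t\<in>V - K. \<exists>fl.
     follow (\<lambda>v. m (fld n 1 v)) (m (fld n 2 (m (fld n 0 t)))) (m (fld n 4 (m (fld n 0 t)))) = fl \<and>
     good t (cls K t) (m (fld n 5 (m (fld n 0 t)))) fl \<and> m (fld n 3 (m (fld n 0 t))) = last fl)"

definition invar :: "nat set \<Rightarrow> memory \<Rightarrow> bool" where
  "invar K m \<longleftrightarrow> inp m \<and> labels K m \<and> peel (acc K) m \<and> collected K (acc K) m \<and> lists K m"

text \<open>Potential that pays for relabelling: a merging raises it by at least the size of the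
  smaller component, and in the end it is \<open>n * floor_log n\<close>.\<close>

definition phi :: "nat set \<Rightarrow> nat" where
  "phi K = (\<Sum>t\<in>V - K. card (cls K t) * floor_log (card (cls K t)))"

text \<open>Connects the counter maintained by peeling with the weight \<open>D\<close> in the
  merging rule of \<open>good_merge\<close>.\<close>

lemma collected_inner:
  assumes "K \<subseteq> V - {s}" "t \<in> V - K"
  shows "{u \<in> cls K t. u \<noteq> s \<and> chld u \<subseteq> acc K} = inner (cls K t)"
proof -
  have "u \<in> fin K \<longleftrightarrow> u \<noteq> s \<and> chld u \<subseteq> acc K" if "u \<in> cls K t" for u
  proof -
    have "u \<in> V" using cls_sub_V[OF assms(1)] assms(2) that by blast
    then show ?thesis using fin_iff[of u K] unfolding acc_def by blast
  qed
  then show ?thesis unfolding inner_cls[OF assms] by blast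
qed

context
  fixes K c t
  assumes K: "K \<subseteq> V - {s}" and c: "c \<in> V - {s}" "c \<notin> K" and t: "t \<in> V - K" "par c \<in> cls K t"
begin

lemma ct: "t \<noteq> c" "cls K t \<inter> cls K c = {}" "c \<in> V - K"
proof -
  show "t \<noteq> c" using par_notin_cls[OF K c(1)] t(2) by blast
  then show "cls K t \<inter> cls K c = {}" using cls_unique t c by blast
  show "c \<in> V - K" using c by blast
qed

lemma cls_merged: "cls (insert c K) t = cls K t \<union> cls K c"
  using cls_insert t by simp

lemma cls_other: "t' \<in> V - K \<Longrightarrow> t' \<noteq> t \<Longrightarrow> cls (insert c K) t' = cls K t'"
  using cls_insert cls_unique t by (metis DiffD2)

lemma finite_cls: "t' \<in> V - K \<Longrightarrow> finite (cls K t')"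
  using cls_sub_V[OF K, of t'] by (auto intro: finite_subset)

lemma phi_insert: "phi K + min (card (cls K t)) (card (cls K c)) \<le> phi (insert c K)"
proof -
  let ?g = "\<lambda>x. x * floor_log x"
  have VK: "V - K = insert c (insert t (V - K - {c, t}))" "V - insert c K = insert t (V - K - {c, t})"
    using t c ct by auto
  have "phi K = ?g (card (cls K c)) + ?g (card (cls K t)) + (\<Sum>t\<in>V - K - {c, t}. ?g (card (cls K t)))"
    unfolding phi_def by (subst VK(1)) (use ct(1) in simp)
  moreover have "phi (insert c K) = ?g (card (cls (insert c K) t)) +
      (\<Sum>t\<in>V - K - {c, t}. ?g (card (cls (insert c K) t)))"
    unfolding phi_def by (subst VK(2)) simp
  moreover have "(\<Sum>t\<in>V - K - {c, t}. ?g (card (cls (insert c K) t))) =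
      (\<Sum>t\<in>V - K - {c, t}. ?g (card (cls K t)))"
    by (rule sum.cong) (use cls_other in auto)
  moreover have "card (cls (insert c K) t) = card (cls K t) + card (cls K c)"
    unfolding cls_merged using ct(2) finite_cls[OF t(1)] finite_cls[OF ct(3)] by (rule card_Un_disjoint[rotated 2])
  moreover have "1 \<le> card (cls K t)" "1 \<le> card (cls K c)"
    using cls_self finite_cls[OF t(1)] finite_cls[OF ct(3)] by (auto simp: Suc_le_eq card_gt_0_iff)
  ultimately show ?thesis using floor_log_merge[of "card (cls K t)" "card (cls K c)"] by simp
qed

text \<open>Which list comes first is decided by the excesses and not by the position in the tree,
  hence the two cases in \<open>tops\<close>. The resulting state lies between two invariants:
  labels and lists belong to \<open>insert c K\<close> already, peeling is still that of
  \<open>acc K\<close>.\<close>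

lemma link_invar:
  assumes inv: "invar K m" and tops: "tp = t \<and> tq = c \<or> tp = c \<and> tq = t"
    and p: "p = m (fld n 0 tp)" and q: "q = m (fld n 0 tq)"
    and lp: "lp = follow (\<lambda>v. m (fld n 1 v)) (m (fld n 2 p)) (m (fld n 4 p))"
    and lq: "lq = follow (\<lambda>v. m (fld n 1 v)) (m (fld n 2 q)) (m (fld n 4 q))"
    and good: "good t (cls K t \<union> cls K c) f (lp @ lq)"
  shows "wp prog [p, q, f] link_body m (\<lambda>x m' t'. inp m' \<and> labels (insert c K) m' \<and> peel (acc K) m' \<and>
    collected (insert c K) (acc K) m' \<and> lists (insert c K) m' \<and> frame n {0, 1, 2, 3, 4, 5, 6} m m' \<and>
    t' \<le> 1000 + 100 * min (card (cls K t)) (card (cls K c)))"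
proof -
  have inv': "inp m" "labels K m" "peel (acc K) m" "collected K (acc K) m" "lists K m"
    using inv unfolding invar_def by auto
  have tpq: "tp \<in> V - K" "tq \<in> V - K" "tp \<noteq> tq" "cls K tp \<union> cls K tq = cls K t \<union> cls K c"
    "cls K tp \<inter> cls K tq = {}" "{tp, tq} = {t, c}"
    using tops t ct by auto
  have gp: "good tp (cls K tp) (m (fld n 5 p)) lp" "m (fld n 3 p) = last lp"
    using inv'(5) tpq(1) unfolding lists_def p lp by auto
  have gq: "good tq (cls K tq) (m (fld n 5 q)) lq" "m (fld n 3 q) = last lq"
    using inv'(5) tpq(2) unfolding lists_def q lq by auto
  have sets: "set lp = cls K tp" "set lq = cls K tq" "distinct lp" "distinct lq"
    using gp(1) gq(1) unfolding good_def by auto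
  have ne: "lp \<noteq> []" "lq \<noteq> []" using sets cls_self by (metis empty_iff list.set(1))+
  have lab: "m (fld n 0 u) = m (fld n 0 t')" if "t' \<in> V - K" "u \<in> cls K t'" for u t'
    using inv'(2) that unfolding labels_def by blast
  have inj: "m (fld n 0 t1) = m (fld n 0 t2) \<Longrightarrow> t1 = t2" if "t1 \<in> V - K" "t2 \<in> V - K" for t1 t2
    using inv'(2) that unfolding labels_def inj_on_def by blast
  have m0: "m 0 = n" using inv'(1) unfolding inp_def by blast
  have cards: "min (length lp) (length lq) = min (card (cls K t)) (card (cls K c))"
    using tops sets distinct_card[of lp] distinct_card[of lq] by auto
  have other: "t' \<in> V - K" "cls (insert c K) t' = cls K t'" "m (fld n 0 t') \<notin> {p, q}"
    "cls K t' \<inter> set (lp @ lq) = {}" if t': "t' \<in> V - insert c K" "t' \<noteq> t" for t'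
  proof -
    show tV: "t' \<in> V - K" using t' by blast
    show "cls (insert c K) t' = cls K t'" using cls_other tV t'(2) by blast
    have neq: "t' \<noteq> tp" "t' \<noteq> tq" using t' tpq(6) by blast+
    then show "m (fld n 0 t') \<notin> {p, q}" using inj[OF tV tpq(1)] inj[OF tV tpq(2)] unfolding p q by blast
    have "cls K t' \<inter> cls K tp = {}" "cls K t' \<inter> cls K tq = {}"
      using cls_unique neq tV tpq(1,2) by blast+
    then show "cls K t' \<inter> set (lp @ lq) = {}" using sets by auto
  qed
  have dist: "distinct (lp @ lq)" using sets tpq(5) by simp
  have labp: "\<And>u. u \<in> set lp \<Longrightarrow> m (fld n 0 u) = p" unfolding sets p using lab[OF tpq(1)] .
  have labq: "\<And>u. u \<in> set lq \<Longrightarrow> m (fld n 0 u) = q" unfolding sets q using lab[OF tpq(2)] .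
  show ?thesis
  proof (rule wp_mono[OF link_spec[OF n m0 lp[symmetric] ne(1) lq[symmetric] ne(2) dist gp(2) gq(2) labp labq]],
      assumption, assumption, unfold linked_def, elim bexE conjE)
    fix x m' t' l
    assume l: "l \<in> {p, q}"
      and fol: "follow (\<lambda>v. m' (fld n 1 v)) (m' (fld n 2 l)) (m' (fld n 4 l)) = lp @ lq"
      and la: "m' (fld n 3 l) = last lq" and F: "m' (fld n 5 l) = f"
      and D: "m' (fld n 6 l) = m (fld n 6 p) + m (fld n 6 q)"
      and lab': "\<forall>u. m' (fld n 0 u) = (if u \<in> set (lp @ lq) then l else m (fld n 0 u))"
      and nx: "\<forall>v. v \<noteq> last lp \<longrightarrow> m' (fld n 1 v) = m (fld n 1 v)"
      and keep: "\<forall>l'. l' \<notin> {p, q} \<longrightarrow> (\<forall>j\<in>{2, 3, 4, 5, 6}. m' (fld n j l') = m (fld n j l'))"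
      and fr: "frame n {0, 1, 2, 3, 4, 5, 6} m m'"
      and time: "t' \<le> 1000 + 100 * min (length lp) (length lq)"
    have merged: "cls (insert c K) t = set (lp @ lq)" unfolding cls_merged using sets tpq(4) by auto
    have labt: "m' (fld n 0 u) = l" if "u \<in> cls (insert c K) t" for u
      using lab' that unfolding merged by simp
    have labo: "m' (fld n 0 u) = m (fld n 0 t')" if "t' \<in> V - insert c K" "t' \<noteq> t" "u \<in> cls K t'" for t' u
    proof -
      have "u \<notin> set (lp @ lq)" using other(4)[OF that(1,2)] that(3) by blast
      then show ?thesis using lab' lab[OF other(1)[OF that(1,2)] that(3)] by simp
    qed
    have tt: "m' (fld n 0 t) = l" using labt cls_self by blast
    have "labels (insert c K) m'"
      unfolding labels_def
    proof (intro conjI ballI)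
      fix t' u assume t': "t' \<in> V - insert c K" "u \<in> cls (insert c K) t'"
      show "m' (fld n 0 u) = m' (fld n 0 t')"
      proof (cases "t' = t")
        case True
        then show ?thesis using labt t'(2) tt by simp
      next
        case False
        then show ?thesis using labo[OF t'(1) False] other(2)[OF t'(1) False] t'(2) cls_self by metis
      qed
    next
      show "inj_on (\<lambda>t. m' (fld n 0 t)) (V - insert c K)"
      proof (rule inj_onI)
        fix t1 t2 assume t1: "t1 \<in> V - insert c K" and t2: "t2 \<in> V - insert c K"
          and eq: "m' (fld n 0 t1) = m' (fld n 0 t2)"
        have L: "m' (fld n 0 t') = m (fld n 0 t')" "m (fld n 0 t') \<noteq> l" if "t' \<in> V - insert c K" "t' \<noteq> t" for t'
          using labo[OF that cls_self] other(3)[OF that] l by auto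
        show "t1 = t2"
        proof (cases "t1 = t"; cases "t2 = t")
          assume "t1 \<noteq> t" "t2 \<noteq> t"
          then show ?thesis using L(1)[OF t1] L(1)[OF t2] eq inj[of t1 t2] t1 t2 by auto
        next
          assume "t1 = t" "t2 \<noteq> t"
          then show ?thesis using L[OF t2] tt eq by simp
        next
          assume "t1 \<noteq> t" "t2 = t"
          then show ?thesis using L[OF t1] tt eq by simp
        qed simp
      qed
    qed
    moreover have "collected (insert c K) (acc K) m'"
      unfolding collected_def
    proof
      fix t' assume t': "t' \<in> V - insert c K"
      let ?X = "\<lambda>C. {u \<in> C. u \<noteq> s \<and> chld u \<subseteq> acc K}"
      show "m' (fld n 6 (m' (fld n 0 t'))) = sum vw (?X (cls (insert c K) t'))"
      proof (cases "t' = t")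
        case True
        have "?X (cls (insert c K) t) = ?X (cls K tp) \<union> ?X (cls K tq)"
          unfolding merged using sets by auto
        moreover have "?X (cls K tp) \<inter> ?X (cls K tq) = {}" using tpq(5) by blast
        ultimately have "sum vw (?X (cls (insert c K) t)) = sum vw (?X (cls K tp)) + sum vw (?X (cls K tq))"
          using finite_cls[OF tpq(1)] finite_cls[OF tpq(2)] by (simp add: sum.union_disjoint)
        then show ?thesis
          using True D tt inv'(4) tpq(1,2) unfolding collected_def p q by simp
      next
        case False
        have "m' (fld n 0 t') = m (fld n 0 t')" using labo[OF t' False cls_self] .
        then show ?thesis
          using keep other[OF t' False] inv'(4) unfolding collected_def by simp
      qed
    qed
    moreover have "lists (insert c K) m'"
      unfolding lists_def
    proof
      fix t' assume t': "t' \<in> V - insert c K"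
      show "\<exists>fl. follow (\<lambda>v. m' (fld n 1 v)) (m' (fld n 2 (m' (fld n 0 t')))) (m' (fld n 4 (m' (fld n 0 t')))) = fl \<and>
         good t' (cls (insert c K) t') (m' (fld n 5 (m' (fld n 0 t')))) fl \<and> m' (fld n 3 (m' (fld n 0 t'))) = last fl"
      proof (cases "t' = t")
        case True
        show ?thesis
          unfolding True tt
        proof (intro exI[of _ "lp @ lq"] conjI)
          show "good t (cls (insert c K) t) (m' (fld n 5 l)) (lp @ lq)"
            using good unfolding F cls_merged .
          show "m' (fld n 3 l) = last (lp @ lq)" using la ne by simp
        qed (rule fol)
      next
        case False
        note o = other[OF t' False]
        have lt: "m' (fld n 0 t') = m (fld n 0 t')" using labo[OF t' False cls_self] .
        have k: "m' (fld n j (m (fld n 0 t'))) = m (fld n j (m (fld n 0 t')))" if "j \<in> {2, 3, 4, 5, 6}" for j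
          using keep o(3) that by blast
        obtain fl where fl: "follow (\<lambda>v. m (fld n 1 v)) (m (fld n 2 (m (fld n 0 t')))) (m (fld n 4 (m (fld n 0 t')))) = fl"
          "good t' (cls K t') (m (fld n 5 (m (fld n 0 t')))) fl" "m (fld n 3 (m (fld n 0 t'))) = last fl"
          using inv'(5) o(1) unfolding lists_def by blast
        \<comment> \<open>Only the link of \<open>last lp\<close> was redirected, and this vertex
          belongs to the merged component.\<close>
        have "last lp \<notin> set fl" using o(4) fl(2) ne unfolding good_def by auto
        then have "follow (\<lambda>v. m' (fld n 1 v)) (m (fld n 2 (m (fld n 0 t')))) (m (fld n 4 (m (fld n 0 t')))) = fl"
          using nx fl(1) by (subst follow_cong[of "\<lambda>v. m (fld n 1 v)"]) (metis, simp)
        then show ?thesis unfolding lt o(2) using fl(2,3) k by simp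
      qed
    qed
    moreover have "peel (acc K) m'"
      using inv'(3) frame_fld[OF fr, of 7] frame_fld[OF fr, of 8] unfolding peel_def by simp
    ultimately show "inp m' \<and> labels (insert c K) m' \<and> peel (acc K) m' \<and>
      collected (insert c K) (acc K) m' \<and> lists (insert c K) m' \<and> frame n {0, 1, 2, 3, 4, 5, 6} m m' \<and>
      t' \<le> 1000 + 100 * min (card (cls K t)) (card (cls K c))"
      using inp_frame[OF inv'(1) fr] fr time unfolding cards by blast
  qed
qed

end

end

section \<open>One merging step and the loop over the sorted edges\<close>

context run
begin

lemma ch_in: "e < n - 1 \<Longrightarrow> ch e \<in> V - {s}"
  using ch_bij bij_betwE by blast

text \<open>With the edge above \<open>c\<close> added, \<open>c\<close> is the only vertex where
  the equation for \<open>acc\<close> can fail. Its parent cannot have just one neighbour left,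
  since \<open>c\<close> is not peeled off and hence still counted there.\<close>

lemma climb_phase:
  assumes K: "K \<subseteq> V - {s}" and c: "c \<in> V - {s}" "c \<notin> K"
    and inv: "inp m" "labels (insert c K) m" "peel (acc K) m" "collected (insert c K) (acc K) m" "lists (insert c K) m"
  shows "\<not> m (fld n 7 (par c)) < 2"
    and "m (fld n 7 c) < 2 \<Longrightarrow> wp prog [c] climb_body m (\<lambda>y m' t. invar (insert c K) m' \<and>
      frame n {6, 7, 8} m m' \<and> t + 500 * card (acc K) \<le> 500 * card (acc (insert c K)))"
    and "\<not> m (fld n 7 c) < 2 \<Longrightarrow> invar (insert c K) m \<and> acc (insert c K) = acc K"
proof -
  have K': "insert c K \<subseteq> V - {s}" using K c by blast
  have accK: "acc K \<subseteq> K" unfolding acc_def by blast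
  have pc: "par c \<in> V" using par_in_V c(1) by blast
  have "c \<in> chld (par c) - acc K" using c accK unfolding chld_def by blast
  then have "card (chld (par c) - acc K) \<noteq> 0" using finite_chld by auto
  then show "\<not> m (fld n 7 (par c)) < 2" using inv(3) pc unfolding peel_def by auto
  have deg: "m (fld n 7 c) < 2 \<longleftrightarrow> chld c \<subseteq> acc K"
    using inv(3) c(1) finite_chld[of c] unfolding peel_def by auto
  have sat: "u \<in> acc K \<longleftrightarrow> u \<in> insert c K \<and> chld u \<subseteq> acc K" if "u \<in> V - {s}" "u \<noteq> c" for u
    using acc_iff[OF K that(1)] that(2) by blast
  {
    assume less: "m (fld n 7 c) < 2"
    have IH: "wp prog [c] climb_body m (\<lambda>y m' t. peel (acc (insert c K)) m' \<and>
        collected (insert c K) (acc (insert c K)) m' \<and>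
        frame n {6, 7, 8} m m' \<and> t + 500 * card (acc K) \<le> 500 * card (acc (insert c K)))"
      by (rule climb_spec[OF K' inv(1-4)]) (use accK K c less deg sat in auto)
    show "wp prog [c] climb_body m (\<lambda>y m' t. invar (insert c K) m' \<and>
        frame n {6, 7, 8} m m' \<and> t + 500 * card (acc K) \<le> 500 * card (acc (insert c K)))"
    proof (rule wp_mono[OF IH], elim conjE)
      fix m' t assume A: "peel (acc (insert c K)) m'" "collected (insert c K) (acc (insert c K)) m'"
        and fr: "frame n {6, 7, 8} m m'" and t: "t + 500 * card (acc K) \<le> 500 * card (acc (insert c K))"
      have fld: "m' (fld n j v) = m (fld n j v)" if "j < 6" for j v
        using frame_fld[OF fr] that by simp
      have "labels (insert c K) m'" using inv(2) unfolding labels_def by (simp add: fld)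
      moreover have "lists (insert c K) m'" using inv(5) unfolding lists_def by (simp add: fld)
      ultimately show "invar (insert c K) m' \<and>
        frame n {6, 7, 8} m m' \<and> t + 500 * card (acc K) \<le> 500 * card (acc (insert c K))"
        using A fr t inp_frame[OF inv(1) fr] unfolding invar_def by blast
    qed
  next
    assume "\<not> m (fld n 7 c) < 2"
    then have nc: "\<not> chld c \<subseteq> acc K" using deg by blast
    have "acc K = acc (insert c K)"
    proof (rule acc_unique[OF K'])
      show "acc K \<subseteq> V - {s}" using accK K by blast
      show "u \<in> acc K \<longleftrightarrow> u \<in> insert c K \<and> chld u \<subseteq> acc K" if "u \<in> V - {s}" for u
        using sat[OF that] nc accK c(2) by (cases "u = c") blast+
    qed
    then show "invar (insert c K) m \<and> acc (insert c K) = acc K"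
      using inv unfolding invar_def by simp
  }
qed

text \<open>Amortized cost: 500 for every vertex newly peeled off, 100 for every unit of
  \<open>phi\<close> spent on relabelling, and 3000 for all the rest.\<close>

lemma step_spec:
  assumes K: "K \<subseteq> V - {s}" and e: "e < n - 1" "ch e \<notin> K" and inv: "invar K m"
    and cheap: "\<And>u. u \<in> K \<Longrightarrow> w {u, par u} \<le> w {ch e, par (ch e)}"
    and expensive: "\<And>u. u \<in> V - {s} \<Longrightarrow> u \<notin> K \<Longrightarrow> w {ch e, par (ch e)} \<le> w {u, par u}"
  shows "wp prog [e] step_body m (\<lambda>x m' t. invar (insert (ch e) K) m' \<and>
    frame n {0, 1, 2, 3, 4, 5, 6, 7, 8} m m' \<and>
    t + 500 * card (acc K) + 100 * phi K \<le> 3000 + 500 * card (acc (insert (ch e) K)) + 100 * phi (insert (ch e) K))"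
proof -
  define c where "c = ch e"
  have c: "c \<in> V - {s}" "c \<notin> K" using ch_in e unfolding c_def by auto
  then obtain t where t: "t \<in> V - K" "par c \<in> cls K t" using cls_exists[OF K par_in_V] by blast
  note ct = ct[OF K c t]
  have inv': "inp m" "labels K m" "peel (acc K) m" "collected K (acc K) m" "lists K m"
    using inv unfolding invar_def by auto
  define u where "u = eu e"
  define v where "v = ev e"
  obtain tu tv where tops: "tu = t \<and> tv = c \<or> tu = c \<and> tv = t" and uv: "u = c \<and> v = par c \<or> u = par c \<and> v = c"
    and cu: "u \<in> cls K tu" "v \<in> cls K tv"
    using ends[OF e(1)] t(2) cls_self[of c K] unfolding u_def v_def c_def by metis
  have tuv: "tu \<in> V - K" "tv \<in> V - K" using tops t ct(3) by auto
  define a where "a = m (fld n 0 tu)"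
  define b where "b = m (fld n 0 tv)"
  have au: "m (fld n 0 u) = a" "m (fld n 0 v) = b"
    using inv'(2) cu tuv unfolding labels_def a_def b_def by blast+
  define W where "W = max 1 (wt e)"
  have W: "w {c, par c} = W" unfolding W_def c_def using wt[OF e(1)] .
  define flu where "flu = follow (\<lambda>v. m (fld n 1 v)) (m (fld n 2 a)) (m (fld n 4 a))"
  define flv where "flv = follow (\<lambda>v. m (fld n 1 v)) (m (fld n 2 b)) (m (fld n 4 b))"
  define fa where "fa = max (m (fld n 5 a)) (W - m (fld n 6 a))"
  define fb where "fb = max (m (fld n 5 b)) (W - m (fld n 6 b))"
  have gu: "good tu (cls K tu) (m (fld n 5 a)) flu" "good tv (cls K tv) (m (fld n 5 b)) flv"
    using inv'(5) tuv unfolding lists_def a_def b_def flu_def flv_def by auto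
  have Dab: "m (fld n 6 a) = sum vw (inner (cls K tu))" "m (fld n 6 b) = sum vw (inner (cls K tv))"
    using inv'(4) tuv collected_inner[OF K] unfolding collected_def a_def b_def by auto
  note merge = good_merge[OF K c t cheap[folded c_def, unfolded W] W expensive[folded c_def, unfolded W]]
  have good1: "good t (cls K t \<union> cls K c) fb (flu @ flv)" if "fb \<le> fa"
    using tops
  proof (elim disjE conjE)
    assume eq: "tu = t" "tv = c"
    show ?thesis using merge(1)[OF _ _ _ gu(2)[unfolded eq] gu(1)[unfolded eq]] that
      unfolding fa_def fb_def Dab eq by auto
  next
    assume eq: "tu = c" "tv = t"
    show ?thesis using merge(2)[OF _ _ _ gu(1)[unfolded eq] gu(2)[unfolded eq]] that
      unfolding fa_def fb_def Dab eq by auto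
  qed
  have good2: "good t (cls K t \<union> cls K c) fa (flv @ flu)" if "fa \<le> fb"
    using tops
  proof (elim disjE conjE)
    assume eq: "tu = t" "tv = c"
    show ?thesis using merge(2)[OF _ _ _ gu(2)[unfolded eq] gu(1)[unfolded eq]] that
      unfolding fa_def fb_def Dab eq by auto
  next
    assume eq: "tu = c" "tv = t"
    show ?thesis using merge(1)[OF _ _ _ gu(1)[unfolded eq] gu(2)[unfolded eq]] that
      unfolding fa_def fb_def Dab eq by auto
  qed
  have tops': "tv = t \<and> tu = c \<or> tv = c \<and> tu = t" using tops by blast
  note link1 = link_invar[OF K c t inv tops a_def b_def flu_def flv_def good1]
  note link2 = link_invar[OF K c t inv tops' b_def a_def flv_def flu_def good2]
  define tail where "tail = IfLess (Rd 7 (Var 7)) (Lit 2) (Call 9 [Var 7])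
    (IfLess (Rd 7 (Var 6)) (Lit 2) (Call 9 [Var 6]) (Lit 0))"
  define RR where "RR m'' T \<longleftrightarrow> invar (insert c K) m'' \<and>
      frame n {0, 1, 2, 3, 4, 5, 6, 7, 8} m m'' \<and> T + 500 * card (acc K) \<le> 300 + 500 * card (acc (insert c K))" for m'' T
  define \<rho> where "\<rho> = [fb, fa, b, a, W, wt e, v, u, e]"
  have rest: "wp prog \<rho> tail m' (\<lambda>x m'' t'. RR m'' t')"
    if m': "inp m'" "labels (insert c K) m'" "peel (acc K) m'" "collected (insert c K) (acc K) m'"
      "lists (insert c K) m'" and fr: "frame n {0, 1, 2, 3, 4, 5, 6} m m'" for m'
  proof -
    note ph = climb_phase[OF K c m']
    have m'0: "m' 0 = n" using m'(1) unfolding inp_def by blast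
    have fr': "frame n {0, 1, 2, 3, 4, 5, 6, 7, 8} m m'" by (rule frame_mono[OF fr]) auto
    have fr'': "frame n {0, 1, 2, 3, 4, 5, 6, 7, 8} m m''" if "frame n {6, 7, 8} m' m''" for m''
      by (rule frame_trans[OF fr' frame_mono[OF that]]) auto
    show ?thesis
    proof (cases "m' (fld n 7 c) < 2")
      case True
      have *: "wp prog [c] climb_body m' (\<lambda>y m'' t'. \<forall>T\<le>t' + 300. RR m'' T)"
      proof (rule wp_mono[OF ph(2)[OF True]], intro allI impI)
        fix x m'' t' T
        assume A: "invar (insert c K) m'' \<and> frame n {6, 7, 8} m' m'' \<and>
          t' + 500 * card (acc K) \<le> 500 * card (acc (insert c K))" and T: "T \<le> t' + 300"
        then have "T + 500 * card (acc K) \<le> 300 + 500 * card (acc (insert c K))" by linarith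
        then show "RR m'' T" using A fr'' unfolding RR_def by blast
      qed
      from uv show ?thesis
      proof (elim disjE conjE)
        assume "u = c" "v = par c"
        then show ?thesis
          unfolding tail_def \<rho>_def
          apply (simp add: wp_simps wp_call_prog prog_nth m'0 True ph(1) del: One_nat_def)
          apply (rule wp_mono[OF *], erule allE, erule mp, simp)
          done
      next
        assume "u = par c" "v = c"
        then show ?thesis
          unfolding tail_def \<rho>_def
          apply (simp add: wp_simps wp_call_prog prog_nth m'0 True ph(1) del: One_nat_def)
          apply (rule wp_mono[OF *], erule allE, erule mp, simp)
          done
      qed
    next
      case False
      have *: "RR m' T" if "T \<le> 300" for T
      proof -
        have "acc (insert c K) = acc K" using ph(3)[OF False] by blast
        then have "T + 500 * card (acc K) \<le> 300 + 500 * card (acc (insert c K))" using that by simp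
        then show ?thesis unfolding RR_def using ph(3)[OF False] fr' by blast
      qed
      from uv show ?thesis
      proof (elim disjE conjE)
        assume "u = c" "v = par c"
        then show ?thesis
          unfolding tail_def \<rho>_def
          apply (simp add: wp_simps m'0 False ph(1) del: One_nat_def)
          apply (rule *, simp)
          done
      next
        assume "u = par c" "v = c"
        then show ?thesis
          unfolding tail_def \<rho>_def
          apply (simp add: wp_simps m'0 False ph(1) del: One_nat_def)
          apply (rule *, simp)
          done
      qed
    qed
  qed
  have in1: "m 0 = n" "m (arg n 0 e) = u" "m (arg n 1 e) = v" "m (arg n 2 e) = wt e"
    using inv'(1) e(1) unfolding inp_def u_def v_def by auto
  define R where "R m' T \<longleftrightarrow> invar (insert (ch e) K) m' \<and> frame n {0, 1, 2, 3, 4, 5, 6, 7, 8} m m' \<and>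
    T + 500 * card (acc K) + 100 * phi K \<le> 3000 + 500 * card (acc (insert (ch e) K)) + 100 * phi (insert (ch e) K)" for m' T
  have fin: "wp prog \<rho> tail m' (\<lambda>x m'' t''. \<forall>T\<le>1500 + t' + t''. R m'' T)"
    if "inp m' \<and> labels (insert c K) m' \<and> peel (acc K) m' \<and>
      collected (insert c K) (acc K) m' \<and> lists (insert c K) m' \<and> frame n {0, 1, 2, 3, 4, 5, 6} m m' \<and>
      t' \<le> 1000 + 100 * min (card (cls K t)) (card (cls K c))" for m' t'
    using that
    apply (elim conjE)
    apply (rule wp_mono[OF rest], assumption+)
    apply (unfold RR_def R_def c_def[symmetric])
    using phi_insert[OF K c t]
    apply (intro allI impI conjI)
      apply (elim conjE, assumption)
     apply (elim conjE, assumption)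
    apply linarith
    done
  have "wp prog [e] step_body m (\<lambda>x m' t. R m' t)"
    unfolding step_body_def tail_def[symmetric]
    apply (simp add: wp_simps in1 in1[unfolded One_nat_def] au W_def[symmetric] W_def[symmetric, unfolded One_nat_def] del: One_nat_def)
    apply (rule wp_Maximum_diff, simp, simp)
    subgoal for t1
      apply (simp add: wp_simps in1 au W_def[symmetric] fa_def[symmetric] del: One_nat_def)
      apply (rule wp_Maximum_diff, simp, simp)
      subgoal for t2
      proof (cases "fb < fa")
        case True
        assume "t1 \<le> 200" "t2 \<le> 200"
        then show ?thesis
          apply (simp add: wp_simps in1 au W_def[symmetric] fb_def[symmetric] fa_def[symmetric] True wp_call_prog prog_nth del: One_nat_def)
          apply (rule wp_mono[OF link1[OF less_imp_le[OF True]]])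
          apply (drule fin)
          apply (simp add: wp_simps \<rho>_def[symmetric] del: One_nat_def)
          apply (erule wp_mono)
          apply simp
          done
      next
        case False
        assume "t1 \<le> 200" "t2 \<le> 200"
        then show ?thesis
          apply (simp add: wp_simps in1 au W_def[symmetric] fb_def[symmetric] fa_def[symmetric] False wp_call_prog prog_nth del: One_nat_def)
          apply (rule wp_mono[OF link2[OF leI[OF False]]])
          apply (drule fin)
          apply (simp add: wp_simps \<rho>_def[symmetric] del: One_nat_def)
          apply (erule wp_mono)
          apply simp
          done
      qed
      done
    done
  then show ?thesis unfolding R_def .
qed

text \<open>The merged edges are those outside the remaining list \<open>ps\<close>. Sortedness
  gives exactly the two comparisons with the current edge that \<open>good_merge\<close> relies on;
  they carry over to weights raised to at least 1.\<close>

lemma kruskal_spec: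
  "follow (\<lambda>e. m (fld n 10 e)) e c = ps \<Longrightarrow> distinct ps \<Longrightarrow> set ps \<subseteq> {..<n - 1} \<Longrightarrow>
   K = ch ` ({..<n - 1} - set ps) \<Longrightarrow> sorted (map wt ps) \<Longrightarrow>
   (\<And>x y. x \<in> {..<n - 1} - set ps \<Longrightarrow> y \<in> set ps \<Longrightarrow> wt x \<le> wt y) \<Longrightarrow> invar K m \<Longrightarrow>
   wp prog [c, e] kruskal_body m (\<lambda>x m' t. invar (V - {s}) m' \<and>
     frame n {0, 1, 2, 3, 4, 5, 6, 7, 8} m m' \<and>
     t + 500 * card (acc K) + 100 * phi K \<le> 4000 * (c + 1) + 500 * card (acc (V - {s})) + 100 * phi (V - {s}))"
proof (induction c arbitrary: m e ps K)
  case 0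
  have "K = V - {s}" using "0.prems"(1,4) ch_bij unfolding bij_betw_def by simp
  then show ?case using "0.prems"(7) by (simp add: kruskal_body_def wp_simps frame_refl)
next
  case (Suc c)
  define ps' where "ps' = follow (\<lambda>e. m (fld n 10 e)) (m (fld n 10 e)) c"
  have ps: "ps = e # ps'" using Suc.prems(1) unfolding ps'_def by simp
  have e: "e < n - 1" "e \<notin> set ps'" using Suc.prems(2,3) unfolding ps by auto
  have inj: "inj_on ch {..<n - 1}" and img: "ch ` {..<n - 1} = V - {s}"
    using ch_bij unfolding bij_betw_def by auto
  have KV: "K \<subseteq> V - {s}" unfolding Suc.prems(4) using img by blast
  have eK: "ch e \<notin> K"
    unfolding Suc.prems(4) using inj e(1) ps by (auto dest: inj_onD)
  have K': "insert (ch e) K = ch ` ({..<n - 1} - set ps')"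
    unfolding Suc.prems(4) ps using e by auto
  have cheap: "w {u, par u} \<le> w {ch e, par (ch e)}" if "u \<in> K" for u
  proof -
    obtain x where x: "x \<in> {..<n - 1} - set ps" "u = ch x" using \<open>u \<in> K\<close> Suc.prems(4) by blast
    then have "wt x \<le> wt e" using Suc.prems(6)[OF x(1), of e] ps by simp
    then show ?thesis using wt[of x] wt[OF e(1)] x by auto
  qed
  have expensive: "w {ch e, par (ch e)} \<le> w {u, par u}" if u: "u \<in> V - {s}" "u \<notin> K" for u
  proof -
    obtain y where y: "y < n - 1" "u = ch y" using u(1) img by blast
    then have "y \<in> set ps" using u(2) Suc.prems(4) by blast
    then have "wt e \<le> wt y" using Suc.prems(5) unfolding ps by auto
    then show ?thesis using wt[OF y(1)] wt[OF e(1)] y by auto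
  qed
  note step = step_spec[OF KV e(1) eK Suc.prems(7) cheap expensive]
  show ?case
    unfolding kruskal_body_def
    apply (simp add: wp_simps wp_call_prog prog_nth del: One_nat_def)
    apply (rule wp_mono[OF step], assumption, assumption, assumption)
    subgoal for x m1 t1
    proof (elim conjE)
      assume inv: "invar (insert (ch e) K) m1" and fr: "frame n {0, 1, 2, 3, 4, 5, 6, 7, 8} m m1"
        and t1: "t1 + 500 * card (acc K) + 100 * phi K \<le> 3000 + 500 * card (acc (insert (ch e) K)) + 100 * phi (insert (ch e) K)"
      have m1: "m1 0 = n" using inv unfolding invar_def inp_def by blast
      have nx: "m1 (fld n 10 v) = m (fld n 10 v)" for v using frame_fld[OF fr] by simp
      have ps1: "follow (\<lambda>e. m1 (fld n 10 e)) (m (fld n 10 e)) c = ps'" unfolding nx ps'_def ..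
      have IH: "wp prog [c, m (fld n 10 e)] kruskal_body m1 (\<lambda>x m' t. invar (V - {s}) m' \<and>
        frame n {0, 1, 2, 3, 4, 5, 6, 7, 8} m1 m' \<and>
        t + 500 * card (acc (insert (ch e) K)) + 100 * phi (insert (ch e) K) \<le> 4000 * (c + 1) +
          500 * card (acc (V - {s})) + 100 * phi (V - {s}))"
      proof (rule Suc.IH[OF ps1 _ _ K' _ _ inv])
        show "distinct ps'" "set ps' \<subseteq> {..<n - 1}" "sorted (map wt ps')"
          using Suc.prems(2,3,5) unfolding ps by auto
        show "wt x \<le> wt y" if "x \<in> {..<n - 1} - set ps'" "y \<in> set ps'" for x y
          using that Suc.prems(5) Suc.prems(6)[of x y] unfolding ps by (cases "x = e") auto
      qed
      show ?thesis
        apply (simp add: wp_simps wp_call_prog prog_nth m1 nx del: One_nat_def)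
        apply (rule wp_mono[OF IH])
        using t1 frame_trans[OF fr] by auto
    qed
    done
qed

end

section \<open>Correctness of the program\<close>

context run
begin

text \<open>The summand is symmetric in the two ends, so the orientation in the input is irrelevant
  and each edge can be counted at its lower end.\<close>

lemma sum_ends:
  fixes g :: "nat \<Rightarrow> nat \<Rightarrow> nat"
  shows "(\<Sum>e<n - 1. g (eu e) (ev e) + g (ev e) (eu e)) = (\<Sum>x\<in>V - {s}. g x (par x) + g (par x) x)"
proof -
  have "(\<Sum>e<n - 1. g (eu e) (ev e) + g (ev e) (eu e)) = (\<Sum>e<n - 1. g (ch e) (par (ch e)) + g (par (ch e)) (ch e))"
    by (rule sum.cong) (use ends in force)+
  also have "\<dots> = (\<Sum>x\<in>V - {s}. g x (par x) + g (par x) x)"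
    by (rule sum.reindex_bij_betw[OF ch_bij])
  finally show ?thesis .
qed

lemma degree_sum:
  assumes "v < n"
  shows "(\<Sum>e<n - 1. (of_bool (v = eu e) :: nat) + of_bool (v = ev e)) = (if v = s then 0 else 1) + card (chld v)"
proof -
  have "(\<Sum>e<n - 1. (of_bool (v = eu e) :: nat) + of_bool (v = ev e)) = (\<Sum>x\<in>V - {s}. (of_bool (v = x) :: nat) + of_bool (v = par x))"
    using sum_ends[of "\<lambda>x y. of_bool (v = x)"] by simp
  also have "\<dots> = (\<Sum>x\<in>V - {s}. of_bool (v = x)) + (\<Sum>x\<in>V - {s}. (of_bool (v = par x) :: nat))"
    by (rule sum.distrib)
  also have "(\<Sum>x\<in>V - {s}. of_bool (v = x)) = (if v = s then 0 else (1::nat))"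
    using assms by (simp add: of_bool_def)
  also have "(\<Sum>x\<in>V - {s}. (of_bool (v = par x) :: nat)) = card {x \<in> V - {s}. v = par x}"
    by (simp add: of_bool_def sum.If_cases Int_def)
  also have "{x \<in> V - {s}. v = par x} = chld v" unfolding chld_def by auto
  finally show ?thesis .
qed

lemma neighbour_sum:
  assumes "v < n"
  shows "(\<Sum>e<n - 1. (if v = eu e then ev e else 0) + (if v = ev e then eu e else 0)) =
    (if v = s then 0 else par v) + \<Sum>(chld v)"
proof -
  have "(\<Sum>e<n - 1. (if v = eu e then ev e else 0) + (if v = ev e then eu e else 0)) =
      (\<Sum>x\<in>V - {s}. (if v = x then par x else 0) + (if v = par x then x else 0))"
    using sum_ends[of "\<lambda>x y. if v = x then y else 0"] by simp
  also have "\<dots> = (\<Sum>x\<in>V - {s}. if v = x then par x else 0) + (\<Sum>x\<in>V - {s}. if v = par x then x else 0)"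
    by (rule sum.distrib)
  also have "(\<Sum>x\<in>V - {s}. if v = x then par x else 0) = (if v = s then 0 else par v)"
    using assms by simp
  also have "(\<Sum>x\<in>V - {s}. if v = par x then x else 0) = \<Sum>{x \<in> V - {s}. v = par x}"
    by (rule sum.inter_filter[symmetric]) simp
  also have "{x \<in> V - {s}. v = par x} = chld v" unfolding chld_def by auto
  finally show ?thesis .
qed

text \<open>Without merged edges nothing is peeled off, so only the leaves have all their children
  peeled off, and each component of a leaf has collected the weight of that leaf.\<close>

lemma invar_initial:
  assumes "inp m" and f: "\<And>v. v < n \<Longrightarrow> m (fld n 0 v) = v" "\<And>v. v < n \<Longrightarrow> m (fld n 2 v) = v"
    "\<And>v. v < n \<Longrightarrow> m (fld n 3 v) = v" "\<And>v. v < n \<Longrightarrow> m (fld n 4 v) = 1" "\<And>v. v < n \<Longrightarrow> m (fld n 5 v) = 0"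
    "\<And>v. v < n \<Longrightarrow> m (fld n 6 v) = (if leaf v then vw v else 0)"
    and "\<And>v. v < n \<Longrightarrow> m (fld n 7 v) = (if v = s then 2 else 1) + card (chld v)"
    "\<And>v. v < n \<Longrightarrow> v \<noteq> s \<Longrightarrow> m (fld n 8 v) = par v + \<Sum>(chld v)"
  shows "invar {} m"
proof -
  have acc: "acc {} = {}" unfolding acc_def by simp
  have "labels {} m" unfolding labels_def cls_empty inj_on_def using f(1) by simp
  moreover have "peel {} m" unfolding peel_def using assms(8,9) by simp
  moreover have "collected {} {} m"
    unfolding collected_def
  proof
    fix t assume "t \<in> V - {}"
    then have t: "t < n" by simp
    have "{u \<in> cls {} t. u \<noteq> s \<and> chld u \<subseteq> {}} = (if leaf t then {t} else {})"
      unfolding cls_empty leaf_def using t by auto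
    then show "m (fld n 6 (m (fld n 0 t))) = sum vw {u \<in> cls {} t. u \<noteq> s \<and> chld u \<subseteq> {}}"
      using f(1,6) t by simp
  qed
  moreover have "lists {} m"
    unfolding lists_def cls_empty using f good_singleton by simp
  ultimately show ?thesis unfolding invar_def acc using assms(1) by blast
qed

lemma sort_edges:
  assumes "inp m"
  shows "wp prog [0, n - 1] msort_body m (\<lambda>e m' t. \<exists>ps. follow (\<lambda>e. m' (fld n 10 e)) e (n - 1) = ps \<and>
    distinct ps \<and> set ps = {..<n - 1} \<and> sorted (map wt ps) \<and> frame n {10} m m' \<and>
    t \<le> 400 * (n * (floor_log n + 2)))"
\<comment> \<open>A single vertex has no edges to sort, whereas \<open>msort_spec\<close> speaks
  about at least one.\<close>
proof (cases "n = 1")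
  case True
  then show ?thesis by (simp add: msort_body_def wp_simps frame_refl)
next
  case False
  have n2: "1 \<le> n - 1" using n False by simp
  have pow: "n - 1 \<le> 2 ^ (floor_log n + 1)" using floor_log_exp2_ge[of n] by simp
  have m: "m 0 = n" "\<And>e. e < n - 1 \<Longrightarrow> m (arg n 2 e) = wt e" using assms unfolding inp_def by auto
  have time: "400 * ((n - 1) * (floor_log n + 1 + 1)) \<le> 400 * (n * (floor_log n + 2))"
    by (intro mult_le_mono) auto
  have le: "0 + (n - 1) \<le> n - 1" by simp
  show ?thesis
  proof (rule wp_mono[OF msort_spec[OF n n2 le pow m]], assumption, elim conjE)
    fix e m' t
    let ?ps = "follow (\<lambda>e. m' (fld n 10 e)) e (n - 1)"
    assume A: "set ?ps = {0..<0 + (n - 1)}" "sorted (map wt ?ps)" "frame n {10} m m'"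
      "t \<le> 400 * ((n - 1) * (floor_log n + 1 + 1))"
    have ps: "set ?ps = {..<n - 1}" using A(1) unfolding add_0 atLeast0LessThan .
    then have "card (set ?ps) = length ?ps" by simp
    then have "distinct ?ps" by (rule card_distinct)
    then show "\<exists>ps. ?ps = ps \<and> distinct ps \<and> set ps = {..<n - 1} \<and> sorted (map wt ps) \<and>
        frame n {10} m m' \<and> t \<le> 400 * (n * (floor_log n + 2))"
      using A(2-4) ps time by (intro exI conjI) (rule refl, simp_all)
  qed
qed

definition answer :: "memory \<Rightarrow> nat \<Rightarrow> bool" where
  "answer m p \<longleftrightarrow> (\<exists>F fl. good s V F fl \<and>
     (\<forall>i<length (encode_result (max 1 (sum vw V + F)) (filter leaf fl)).
       m (p + i) = encode_result (max 1 (sum vw V + F)) (filter leaf fl) ! i))"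

lemma output_spec:
  assumes inv: "invar (V - {s}) m" and flag: "\<And>v. v < n \<Longrightarrow> 0 < m (fld n 9 v) \<longleftrightarrow> leaf v"
    and W: "W = sum vw V"
  shows "wp prog [W] (Let (Rd 0 (Lit 0)) (Let (Add (Var 1) (Rd 5 (Var 0))) (Let (Fld 0 (Read (Lit 0)))
     (Seq (Write (Var 0) (Maximum (Lit 1) (Var 1)))
     (Seq (Write (Add (Var 0) (Lit 1)) (Call 11 [Read (Lit 0), Rd 2 (Var 2), Add (Var 0) (Lit 2)]))
     (Var 0)))))) m (\<lambda>p m' t. answer m' p \<and> t \<le> 200 * n + 1000)"
proof -
  have m0: "m 0 = n" using inv unfolding invar_def inp_def by blast
  have sV: "s \<in> V - (V - {s})" using root_in_V by blast
  define l where "l = m (fld n 0 0)"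
  \<comment> \<open>All vertices are in one component now, so the label of vertex 0 is also that of
    the start.\<close>
  have "0 \<in> cls (V - {s}) s" using cls_all n by simp
  then have l: "m (fld n 0 s) = l" using inv sV unfolding l_def invar_def labels_def by metis
  define F where "F = m (fld n 5 l)"
  define fl where "fl = follow (\<lambda>v. m (fld n 1 v)) (m (fld n 2 l)) (m (fld n 4 l))"
  have "lists (V - {s}) m" using inv unfolding invar_def by blast
  then have good: "good s V F fl"
    using sV unfolding lists_def F_def fl_def l[symmetric] by (metis cls_all)
  then have fls: "set fl = V" "distinct fl" unfolding good_def by auto
  have "m (fld n 4 l) = length fl" unfolding fl_def by simp
  also have "\<dots> = n" using distinct_card[OF fls(2)] fls(1) by simp
  finally have fl: "fl = follow (\<lambda>v. m (fld n 1 v)) (m (fld n 2 l)) n" unfolding fl_def by simp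
  define p where "p = fld n 0 n"
  define k where "k = max 1 (W + F)"
  define m1 where "m1 = m(p := k)"
  have ne: "fld n j v \<noteq> p" if "v < n" "j < 16" for j v
    using that unfolding p_def by simp
  have p0: "p \<noteq> 0" unfolding p_def using n by simp
  have m1: "m1 0 = n" unfolding m1_def using m0 p0 by simp
  have "fld n 2 l \<noteq> p" unfolding p_def by simp
  then have m12: "m1 (fld n 2 l) = m (fld n 2 l)" unfolding m1_def by simp
  have fl1: "fl = follow (\<lambda>v. m1 (fld n 1 v)) (m (fld n 2 l)) n"
    unfolding fl by (rule follow_cong[symmetric]) (simp add: m1_def p_def)
  have ls: "filter leaf fl = filter (\<lambda>v. 0 < m1 (fld n 9 v)) fl"
    by (rule filter_cong) (use fls flag ne in \<open>auto simp: m1_def\<close>)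
  have q: "32 * n \<le> Suc (Suc p)" unfolding p_def fld_def by simp
  have fin: "answer (m'(p + 1 := length (filter leaf fl))) p"
    if A: "\<forall>i<length (filter leaf fl). m' (Suc (Suc p) + i) = filter leaf fl ! i" "\<forall>a<Suc (Suc p). m' a = m1 a" for m'
    unfolding answer_def
  proof (intro exI[of _ F] exI[of _ fl] conjI allI impI, rule good)
    fix i assume i: "i < length (encode_result (max 1 (sum vw V + F)) (filter leaf fl))"
    consider "i = 0" | "i = 1" | j where "i = j + 2" by (metis One_nat_def add_2_eq_Suc' not0_implies_Suc)
    then show "(m'(p + 1 := length (filter leaf fl))) (p + i) =
        encode_result (max 1 (sum vw V + F)) (filter leaf fl) ! i"
    proof cases
      case 1
      then show ?thesis using A(2) unfolding encode_result_def k_def[unfolded W, symmetric] m1_def by simp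
    next
      case 2
      then show ?thesis unfolding encode_result_def by simp
    next
      case 3
      then show ?thesis using A(1) i unfolding encode_result_def by (simp add: add.commute add.left_commute)
    qed
  qed
  note out = out_spec[OF n m1 q fl1 _ ls]
  show ?thesis
    apply (simp add: wp_simps wp_call_prog prog_nth m0 n l_def[symmetric] F_def[symmetric] p_def[symmetric]
        k_def[symmetric] m1_def[symmetric] m1 m12 del: One_nat_def fun_upd_apply)
    apply (rule wp_mono[OF out])
    subgoal using fls by simp
    subgoal for x m' t
    proof (elim conjE)
      assume x: "x = length (filter leaf fl)" and t: "t \<le> 200 * (n + 1)"
        and A: "\<forall>i<length (filter leaf fl). m' (Suc (Suc p) + i) = filter leaf fl ! i" "\<forall>a<Suc (Suc p). m' a = m1 a"
      show ?thesis
        using fin[OF A] t unfolding x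
        by (simp add: wp_simps m0 p_def[symmetric] del: One_nat_def fun_upd_apply)
    qed
    done
qed

lemma main_spec:
  assumes inp: "inp m" and zero: "\<And>j v. j < 16 \<Longrightarrow> m (fld n j v) = 0"
  shows "wp prog [] main_body m (\<lambda>p m' t. answer m' p \<and> t \<le> 10000 * ((n + 1) * (floor_log n + 1)))"
proof -
  have m0: "m 0 = n" "\<And>v. v < n \<Longrightarrow> m (Suc (Suc v)) = vw v" using inp unfolding inp_def by auto
  have s: "m1 1 = s" "m1 0 = n" if "inp m1" for m1 using that unfolding inp_def by auto
  have neq: "eu e \<noteq> ev e" if "e < n - 1" for e
    using ends[OF that] par_neq[OF ch_in[OF that]] by auto
  have edges: "m1 (arg n 0 e) = eu e \<and> m1 (arg n 1 e) = ev e \<and> eu e \<noteq> ev e" if "inp m1" "e < n - 1" for m1 e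
    using that neq unfolding inp_def by auto
  have vws: "m1 (Suc (Suc v)) = vw v" if "inp m1" "v < n" for m1 v
    using that unfolding inp_def by auto
  define tail where "tail = Let (Rd 0 (Lit 0)) (Let (Add (Var 1) (Rd 5 (Var 0))) (Let (Fld 0 (Read (Lit 0)))
     (Seq (Write (Var 0) (Maximum (Lit 1) (Var 1)))
     (Seq (Write (Add (Var 0) (Lit 1)) (Call 11 [Read (Lit 0), Rd 2 (Var 2), Add (Var 0) (Lit 2)]))
     (Var 0)))))"
  define R where "R p m' t \<longleftrightarrow> answer m' p \<and> t \<le> 10000 * ((n + 1) * (floor_log n + 1))" for p m' t
  define B where "B = n * floor_log n"
  \<comment> \<open>Of the factor 500 before \<open>B\<close>, 400 come from sorting and 100 from
    the potential \<open>phi\<close>; peeling is linear.\<close>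
  have bound: "t \<le> 10000 * ((n + 1) * (floor_log n + 1))" if "t \<le> 500 * B + 7000 * n + 5000" for t
    using that unfolding B_def by (simp add: algebra_simps)
  have phi: "phi (V - {s}) = B"
  proof -
    have "V - (V - {s}) = {s}" using root_in_V by auto
    then show ?thesis unfolding phi_def B_def using cls_all by simp
  qed
  have acc: "card (acc (V - {s})) \<le> n"
    using card_mono[of V "acc (V - {s})"] unfolding acc_def by fastforce
  have "wp prog [] main_body m R"
    unfolding main_body_def tail_def[symmetric]
    apply (simp add: wp_simps wp_call_prog prog_nth m0(1) del: One_nat_def)
    apply (rule wp_mono[OF init_spec[OF n order_refl m0]], assumption)
    subgoal for W m1 t1
    proof (elim conjE)
      assume W: "W = sum vw V" and t1: "t1 \<le> 200 * (n + 1)" and fr1: "frame n {0, 2, 3, 4} m m1"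
        and f1: "\<forall>v<n. m1 (fld n 0 v) = v \<and> m1 (fld n 2 v) = v \<and> m1 (fld n 3 v) = v \<and> m1 (fld n 4 v) = 1"
      have inp1: "inp m1" using inp_frame[OF inp fr1] .
      have z1: "m1 (fld n j v) = 0" if "j \<in> {5, 6, 7, 8, 9}" for j v
        using frame_fld[OF fr1] zero that by auto
      show ?thesis
        apply (simp add: wp_simps wp_call_prog prog_nth s[OF inp1] del: One_nat_def)
        apply (rule wp_mono[OF count_spec[OF n order_refl s(2)[OF inp1] edges[OF inp1]]], assumption)
        subgoal for x2 m2 t2
        proof (elim conjE)
          assume f7: "\<forall>v. m2 (fld n 7 v) = m1 (fld n 7 v) + (\<Sum>e<n - 1. (of_bool (v = eu e) :: nat) + of_bool (v = ev e))"
            and f8: "\<forall>v. m2 (fld n 8 v) = m1 (fld n 8 v) +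
              (\<Sum>e<n - 1. (if v = eu e then ev e else 0) + (if v = ev e then eu e else 0))"
            and fr2: "frame n {7, 8} m1 m2" and t2: "t2 \<le> 400 * (n - 1 + 1)"
          define m3 where "m3 = m2(fld n 7 s := Suc (Suc (m2 (fld n 7 s))))"
          have fr3: "frame n {7, 8} m1 m3" unfolding m3_def using fr2 by (simp add: frame_upd)
          have inp2: "inp m2" using inp_frame[OF inp1 fr2] .
          have inp3: "inp m3" using inp_frame[OF inp1 fr3] .
          have g7: "m3 (fld n 7 v) = (if v = s then 2 else 1) + card (chld v)" if "v < n" for v
          proof -
            have "m2 (fld n 7 v) = (if v = s then 0 else 1) + card (chld v)"
              using f7 z1 unfolding degree_sum[OF that, symmetric] by simp
            then show ?thesis unfolding m3_def by auto
          qed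
          have g8: "m3 (fld n 8 v) = par v + \<Sum>(chld v)" if "v < n" "v \<noteq> s" for v
            using f8 z1 neighbour_sum[OF that(1)] that(2) unfolding m3_def by simp
          have deg: "m3 (fld n 7 v) < 2 \<longleftrightarrow> leaf v" if "v < n" for v
            using g7[OF that] finite_chld[of v] that unfolding leaf_def by auto
          have keep3: "m3 (fld n j v) = m1 (fld n j v)" if "j < 16" "j \<noteq> 7" "j \<noteq> 8" for j v
            using frame_fld[OF fr3] that by simp
          show ?thesis
            apply (simp add: wp_simps wp_call_prog prog_nth s[OF inp2] m3_def[symmetric] s[OF inp3]
              s[OF inp2, unfolded One_nat_def] del: One_nat_def fun_upd_apply)
            apply (rule wp_mono[OF leaf_spec[OF n order_refl s(2)[OF inp3] vws[OF inp3]]], assumption)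
            subgoal for x4 m4 t4
            proof (elim conjE)
              assume f9: "\<forall>v. m4 (fld n 9 v) = (if v < n \<and> m3 (fld n 7 v) < 2 then 1 else m3 (fld n 9 v))"
                and f6: "\<forall>v. m4 (fld n 6 v) = (if v < n \<and> m3 (fld n 7 v) < 2 then vw v else m3 (fld n 6 v))"
                and fr4: "frame n {6, 9} m3 m4" and t4: "t4 \<le> 200 * (n + 1)"
              have inp4: "inp m4" using inp_frame[OF inp3 fr4] .
              have keep4: "m4 (fld n j v) = m3 (fld n j v)" if "j < 16" "j \<noteq> 6" "j \<noteq> 9" for j v
                using frame_fld[OF fr4] that by simp
              show ?thesis
                apply (simp add: wp_simps wp_call_prog prog_nth s[OF inp4] del: One_nat_def)
                apply (rule wp_mono[OF sort_edges[OF inp4]])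
                subgoal for e m5 t5
                proof (elim exE conjE)
                  fix ps
                  assume ps: "follow (\<lambda>e. m5 (fld n 10 e)) e (n - 1) = ps" "distinct ps" "set ps = {..<n - 1}"
                    "sorted (map wt ps)" and fr5: "frame n {10} m4 m5"
                    and t5: "t5 \<le> 400 * (n * (floor_log n + 2))"
                  have inp5: "inp m5" using inp_frame[OF inp4 fr5] .
                  have keep5: "m5 (fld n j v) = m4 (fld n j v)" if "j < 10" for j v
                    using frame_fld[OF fr5] that by simp
                  have inv5: "invar {} m5"
                  proof (rule invar_initial[OF inp5])
                    fix v assume v: "v < n"
                    show "m5 (fld n 6 v) = (if leaf v then vw v else 0)"
                      using f6 deg[OF v] v by (simp add: keep5 keep3 z1)
                    show "m5 (fld n 7 v) = (if v = s then 2 else 1) + card (chld v)"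
                      using g7[OF v] by (simp add: keep5 keep4)
                    show "v \<noteq> s \<Longrightarrow> m5 (fld n 8 v) = par v + \<Sum>(chld v)"
                      using g8[OF v] by (simp add: keep5 keep4)
                    show "m5 (fld n 5 v) = 0" by (simp add: keep5 keep4 keep3 z1)
                  qed (use f1 in \<open>simp_all add: keep5 keep4 keep3\<close>)
                  have K: "{} = ch ` ({..<n - 1} - set ps)" using ps(3) by simp
                  have flag5: "0 < m5 (fld n 9 v) \<longleftrightarrow> leaf v" if "v < n" for v
                    using f9 deg[OF that] that by (simp add: keep5 keep3 z1)
                  show ?thesis
                    apply (simp add: wp_simps wp_call_prog prog_nth s[OF inp4] s[OF inp5] del: One_nat_def)
                    apply (rule wp_mono[OF kruskal_spec[OF ps(1,2) _ K ps(4) _ inv5]])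
                    subgoal using ps(3) by simp
                    subgoal using ps(3) by simp
                    subgoal for x6 m6 t6
                    proof (elim conjE)
                      assume inv6: "invar (V - {s}) m6" and fr6: "frame n {0, 1, 2, 3, 4, 5, 6, 7, 8} m5 m6"
                        and t6: "t6 + 500 * card (acc {}) + 100 * phi {} \<le>
                          4000 * (n - 1 + 1) + 500 * card (acc (V - {s})) + 100 * phi (V - {s})"
                      have flag6: "0 < m6 (fld n 9 v) \<longleftrightarrow> leaf v" if "v < n" for v
                        using flag5[OF that] frame_fld[OF fr6, of 9] by simp
                      have t6': "t6 \<le> 4500 * n + 100 * B" using t6 acc n unfolding phi by simp
                      have t5': "t5 \<le> 400 * B + 800 * n" using t5 unfolding B_def by (simp add: algebra_simps)
                      note out = output_spec[OF inv6 flag6 W, folded tail_def]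
                      show ?thesis
                        apply (simp add: wp_simps del: One_nat_def)
                        apply (rule wp_mono[OF out], assumption)
                        unfolding R_def
                        apply (elim conjE, rule conjI, assumption)
                        apply (rule bound)
                        using t1 t2 t4 t5' t6' n by simp
                    qed
                    done
                qed
                done
            qed
            done
        qed
        done
    qed
    done
  then show ?thesis unfolding R_def .
qed

end

section \<open>Encoded instances and the asymptotic bound\<close>

lemma nth_concat_triples:
  "e < length es \<Longrightarrow> j < 3 \<Longrightarrow>
    concat (map (\<lambda>(u, v). [f u v, g u v, h u v]) es) ! (3 * e + j) =
    (case es ! e of (u, v) \<Rightarrow> [f u v, g u v, h u v] ! j)"
proof (induction es arbitrary: e)
  case (Cons x es)
  show ?case
  proof (cases e)
    case 0
    then show ?thesis using Cons.prems by (cases x) (auto simp: less_Suc_eq numeral_3_eq_3)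
  next
    case (Suc e')
    then show ?thesis using Cons.IH[of e'] Cons.prems by (cases x) (simp add: nth_append)
  qed
qed simp

lemma length_concat_triples:
  "length (concat (map (\<lambda>(u, v). [f u v, g u v, h u v]) es)) = 3 * length es"
  by (induction es) auto

lemma deployment_answer:
  fixes T :: "nat weighted_graph"
  assumes T: "weighted_tree T" and V: "verts T = {..<n}" and es: "edge_listing T es"
  shows "\<exists>k ls. min_agents T k \<and> optimal_leaf_order T ls \<and>
    computes_within prog (encode_instance T es) (encode_result k ls) (10000 * ((n + 1) * (floor_log n + 1)) + 1)"
proof -
  obtain par where rt: "rooted_tree (verts T) (start T) par"
    and E: "edges T = (\<lambda>v. {v, par v}) ` (verts T - {start T})"
    using weighted_tree_rooted[OF T] .
  define s where "s = start T"
  define w where "w e = max 1 (eweight T e)" for e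
  define vw where "vw = vweight T"
  define eu where "eu e = fst (es ! e)" for e
  define ev where "ev e = snd (es ! e)" for e
  define wt where "wt e = eweight T {eu e, ev e}" for e
  \<comment> \<open>The lower end of the edge at position \<open>e\<close>, recovered from the
    bijection between the vertices other than the root and the edges.\<close>
  define ch where "ch = inv_into ({..<n} - {s}) (\<lambda>v. {v, par v}) \<circ> (!) (map (\<lambda>(u, v). {u, v}) es)"
  interpret weighted_rooted_tree "{..<n}" s par w vw
    using rt unfolding V s_def weighted_rooted_tree_def .
  have EV: "edges T = (\<lambda>v. {v, par v}) ` ({..<n} - {s})" using E unfolding V s_def .
  have esE: "set (map (\<lambda>(u, v). {u, v}) es) = edges T" "distinct (map (\<lambda>(u, v). {u, v}) es)"
    using es unfolding edge_listing_def by auto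
  have bij: "bij_betw (\<lambda>v. {v, par v}) ({..<n} - {s}) (edges T)"
    unfolding bij_betw_def using edge_inj EV by auto
  have "length es = card (edges T)" using distinct_card[OF esE(2)] unfolding esE(1) by simp
  also have "\<dots> = n - 1" using bij_betw_same_card[OF bij] root_in_V by simp
  finally have len: "length es = n - 1" .
  have "bij_betw ((!) (map (\<lambda>(u, v). {u, v}) es)) {..<n - 1} (edges T)"
    by (rule bij_betw_nth[OF esE(2)]) (use len esE(1) in auto)
  then have ch: "bij_betw ch {..<n - 1} ({..<n} - {s})"
    unfolding ch_def using bij_betw_inv_into[OF bij] by (rule bij_betw_trans)
  have che: "{ch e, par (ch e)} = {eu e, ev e}" if "e < n - 1" for e
  proof -
    have "map (\<lambda>(u, v). {u, v}) es ! e = {eu e, ev e}"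
      using that len unfolding eu_def ev_def by (simp add: case_prod_unfold)
    moreover have "map (\<lambda>(u, v). {u, v}) es ! e \<in> (\<lambda>v. {v, par v}) ` ({..<n} - {s})"
      using that len esE(1) unfolding EV[symmetric] by (metis length_map nth_mem)
    ultimately show ?thesis
      unfolding ch_def o_def using f_inv_into_f[of "{eu e, ev e}" "\<lambda>v. {v, par v}"] by simp
  qed
  interpret run n s par w vw eu ev wt ch
  proof
    show "eu e = ch e \<and> ev e = par (ch e) \<or> eu e = par (ch e) \<and> ev e = ch e" if "e < n - 1" for e
      using che[OF that] by (auto simp: doubleton_eq_iff)
    show "w {ch e, par (ch e)} = max 1 (wt e)" if "e < n - 1" for e
      unfolding w_def wt_def che[OF that] ..
  qed (rule ch)
  define xs where "xs = encode_instance T es"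
  define m where "m a = (if a < length xs then xs ! a else 0)" for a
  define cc where "cc = concat (map (\<lambda>(u, v). [u, v, eweight T {u, v}]) es)"
  have xs: "xs = [n, s] @ map vw [0..<n] @ cc"
    unfolding xs_def encode_instance_def cc_def V s_def vw_def by simp
  have lcc: "length cc = 3 * (n - 1)" unfolding cc_def length_concat_triples len ..
  have lxs: "length xs = 2 + n + 3 * (n - 1)" unfolding xs by (simp add: lcc)
  have ncc: "cc ! (3 * e + j) = [eu e, ev e, wt e] ! j" if "e < n - 1" "j < 3" for e j
    unfolding cc_def eu_def ev_def wt_def using nth_concat_triples[of e es j] that len
    by (simp add: case_prod_unfold)
  have marg: "m (arg n j e) = [eu e, ev e, wt e] ! j" if "e < n - 1" "j < 3" for e j
  proof -
    have "arg n j e = Suc (Suc (n + (3 * e + j)))" unfolding arg_def by simp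
    moreover have "Suc (Suc (n + (3 * e + j))) < length xs" unfolding lxs using that by simp
    moreover have "xs ! Suc (Suc (n + (3 * e + j))) = cc ! (3 * e + j)"
      unfolding xs by (simp add: nth_append)
    ultimately show ?thesis unfolding m_def ncc[OF that, symmetric] by simp
  qed
  have inp: "inp m"
    unfolding inp_def
  proof (intro conjI allI impI)
    show "m 0 = n" "m 1 = s" unfolding m_def xs by simp_all
    show "m (Suc (Suc v)) = vw v" if "v < n" for v
      unfolding m_def xs using that by (simp add: nth_append)
  qed (simp_all add: marg)
  have zero: "m (fld n j v) = 0" if "j < 16" for j v
  proof -
    \<comment> \<open>The input has \<open>5 * n - 1\<close> entries, fewer than
      \<open>16 * n\<close>, so all records are initially zero.\<close>
    have "length xs \<le> fld n j v" unfolding lxs fld_def using n by (cases n) auto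
    then show ?thesis unfolding m_def by simp
  qed
  have "wp prog [] (Call 0 []) m (\<lambda>p m' t. answer m' p \<and> t \<le> 10000 * ((n + 1) * (floor_log n + 1)) + 1)"
    apply (simp add: wp_call_prog wps_Nil prog_nth)
    apply (rule wp_mono[OF main_spec[OF inp zero]])
    by simp_all
  then obtain p m' t where ev: "eval prog [] (Call 0 []) m p m' t" and ans: "answer m' p"
    and t: "t \<le> 10000 * ((n + 1) * (floor_log n + 1)) + 1"
    unfolding wp_def by blast
  obtain F fl where good: "good s V F fl"
    and out: "\<forall>i<length (encode_result (max 1 (sum vw V + F)) (filter leaf fl)).
       m' (p + i) = encode_result (max 1 (sum vw V + F)) (filter leaf fl) ! i"
    using ans unfolding answer_def by blast
  have goodT: "weighted_rooted_tree.good (verts T) (start T) par (\<lambda>e. max 1 (eweight T e)) (vweight T)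
      (start T) (verts T) F fl"
    using good unfolding w_def[abs_def] vw_def s_def V .
  have lf: "leaf v \<longleftrightarrow> v \<in> leaves T" for v
    using leaves_iff_leaf[OF rt E] unfolding V s_def .
  have "min_agents T (max 1 (sum vw V + F))" "optimal_leaf_order T (filter leaf fl)"
    using good_optimal[OF T rt E goodT] unfolding lf V vw_def by simp_all
  moreover have "computes_within prog (encode_instance T es)
      (encode_result (max 1 (sum vw V + F)) (filter leaf fl)) (10000 * ((n + 1) * (floor_log n + 1)) + 1)"
    unfolding computes_within_def xs_def[symmetric] m_def[abs_def, symmetric] using ev t out by blast
  ultimately show ?thesis by blast
qed

lemma time_bound:
  "(\<lambda>n. real (10000 * ((n + 1) * (floor_log n + 1)) + 1)) \<in> O(\<lambda>n. real n * ln (real n))"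
proof (rule bigoI, rule eventually_sequentiallyI[of 2])
  fix n :: nat assume n: "2 \<le> n"
  have l: "1 \<le> ln (real n) / ln 2" using n by simp
  have "real (floor_log n) \<le> log 2 (real n)"
    using n by (simp add: floor_log_altdef of_nat_nat)
  then have fl: "real (floor_log n) \<le> ln (real n) / ln 2" by (simp add: log_def)
  with l have fl': "real (floor_log n) + 1 \<le> 2 * (ln (real n) / ln 2)" by linarith
  have "real (10000 * ((n + 1) * (floor_log n + 1)) + 1) =
      10000 * ((real n + 1) * (real (floor_log n) + 1)) + 1"
    by (simp only: of_nat_add of_nat_mult of_nat_numeral of_nat_1)
  \<comment> \<open>For \<open>n \<ge> 2\<close>, \<open>n + 1\<close> is at most
    \<open>2 * n\<close>, and \<open>floor_log n + 1\<close> at most twice the binary logarithm. The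
    final 1 is at most \<open>n\<close> times this logarithm, which makes the constant
    \<open>4 * 10000 + 1\<close>.\<close>
  also have "\<dots> \<le> 10000 * ((2 * real n) * (2 * (ln (real n) / ln 2))) + real n * (ln (real n) / ln 2)"
  proof (intro add_mono mult_left_mono mult_mono)
    have "1 * 1 \<le> real n * (ln (real n) / ln 2)" using n l by (intro mult_mono) auto
    then show "1 \<le> real n * (ln (real n) / ln 2)" by simp
  qed (use n fl' in auto)
  also have "\<dots> = 40001 / ln 2 * (real n * ln (real n))" by (simp add: field_simps)
  also have "\<dots> = 40001 / ln 2 * norm (real n * ln (real n))" using n by simp
  finally show "norm (real (10000 * ((n + 1) * (floor_log n + 1)) + 1)) \<le> 40001 / ln 2 * norm (real n * ln (real n))"
    by simp
qed

theorem theorem8: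
  shows "\<exists>(P :: expr list) (f :: nat \<Rightarrow> nat).
    (\<lambda>n. real (f n)) \<in> O(\<lambda>n. real n * ln (real n)) \<and>
    (\<forall>(n :: nat) (T :: nat weighted_graph) (es :: (nat \<times> nat) list).
       weighted_tree T \<and> verts T = {..<n} \<and> edge_listing T es \<longrightarrow>
       (\<exists>(k :: nat) (ls :: nat list).
          min_agents T k \<and> optimal_leaf_order T ls \<and>
          computes_within P (encode_instance T es) (encode_result k ls) (f n)))"
proof (rule exI[of _ prog], rule exI[of _ "\<lambda>n. 10000 * ((n + 1) * (floor_log n + 1)) + 1"],
    intro conjI allI impI)
  show "(\<lambda>n. real (10000 * ((n + 1) * (floor_log n + 1)) + 1)) \<in> O(\<lambda>n. real n * ln (real n))"
    by (rule time_bound)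
qed (use deployment_answer in blast)

end
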